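(* Let $C(\varepsilon)=C+\varepsilon\tilde C$, where $\tilde C=\mathrm{diag}(\tilde c_i:i\in\mathcal S)$ has diagonal blocks $\tilde C_+,\tilde C_0,\tilde C_-$ with $\tilde C_0=0$. Let $\Psi(\varepsilon)$ be the matrix of first return probabilities to the initial level from above of the model with phase generator $A$ and rate matrix $C(\varepsilon)$, that is, the minimal nonnegative solution of $$C_+^{-1}(\varepsilon)Q_{+-}+C_+^{-1}(\varepsilon)Q_{++}X+X|C_-^{-1}(\varepsilon)|Q_{--}+X|C_-^{-1}(\varepsilon)|Q_{-+}X=0,$$ where $C_\pm(\varepsilon)=C_\pm+\varepsilon\tilde C_\pm$. Then $\Psi(\varepsilon)$ is analytic at $\varepsilon=0$ and may be written as $$\Psi(\varepsilon)=\Psi+\varepsilon\Psi^{(1)}+O(\varepsilon^2),$$ where $\Psi$ is the minimal nonnegative solution of $C_+^{-1}Q_{+-}+C_+^{-1}Q_{++}X+X|C_-^{-1}|Q_{--}+X|C_-^{-1}|Q_{-+}X=0$ and $\Psi^{(1)}$ is the unique solution $X$ of the Sylvester equation $$KX+XU=-\Psi|C_-^{-1}|\tilde C_-U-C_+^{-1}\tilde C_+\Psi U .$$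
   Context: Markov modulated fluid model: $\varphi(t)$ is a continuous-time Markov chain (the phase process) on a finite set $\mathcal S$ with generator $A$, and $Y(t)=Y(0)+\int_0^t c_{\varphi(s)}\,\mathrm ds$ with real rates $c_i$, $i\in\mathcal S$. Partition $\mathcal S=\mathcal S_+\cup\mathcal S_0\cup\mathcal S_-$ according to $c_i>0$, $c_i=0$, $c_i<0$; matrices indexed by phases are partitioned accordingly into blocks $A_{++},A_{+0},A_{+-}$, etc. Put $C_+=\mathrm{diag}(c_i:i\in\mathcal S_+)$, $C_-=\mathrm{diag}(c_i:i\in\mathcal S_-)$, and let $C$ be the block-diagonal matrix with diagonal blocks $C_+,0,C_-$; $|\cdot|$ denotes entrywise absolute value and $\mathbf 1$ is the column vector of ones. Standing assumption (positive recurrence): $\boldsymbol\xi C\mathbf 1<0$, where $\boldsymbol\xi$ is the stationary probability vector of the phase process, the unique solution of $\boldsymbol\xi A=0$, $\boldsymbol\xi\mathbf 1=1$. First return probabilities from above: for $i\in\mathcal S_+$, $j\in\mathcal S_-$, $\Psi_{ij}=\mathbb P[\tau_-<\infty,\ \varphi(\tau_-)=j\mid Y(0)=0,\varphi(0)=i]$ with $\tau_-=\inf\{t>0:Y(t)<0\}$. Define $$\begin{bmatrix}Q_{++}&Q_{+-}\\ Q_{-+}&Q_{--}\end{bmatrix}=\begin{bmatrix}A_{++}&A_{+-}\\ A_{-+}&A_{--}\end{bmatrix}+\begin{bmatrix}A_{+0}\\ A_{-0}\end{bmatrix}(-A_{00}^{-1})\begin{bmatrix}A_{0+}&A_{0-}\end{bmatrix},$$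 $$U=|C_-^{-1}|Q_{--}+|C_-^{-1}|Q_{-+}\Psi,\qquad K=C_+^{-1}Q_{++}+\Psi|C_-^{-1}|Q_{-+}.$$ It is assumed that $\varepsilon$ is small enough that the diagonal elements of $C_+(\varepsilon)$ are strictly positive and those of $C_-(\varepsilon)$ are strictly negative. *)

theory Defs
  imports "HOL-Probability.Probability" "HOL-Library.Landau_Symbols"
begin

text \<open>
  Phases are the elements of a finite type \<open>'s\<close>, and a rate vector \<open>c :: real^'s\<close> partitions them
  by sign. Any part of the partition except the one of negative rates may be empty, so blocks are
  not given types of their own: a matrix indexed by \<open>S \<times> T\<close> is a matrix over all phases that
  vanishes outside \<open>S \<times> T\<close>. The order, the absolute value and \<open>0\<close> on vectors and matrices are the
  entrywise ones of the library.
\<close>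

definition up :: "real^'s \<Rightarrow> 's set" where "up c = {i. c $ i > 0}"
definition still :: "real^'s \<Rightarrow> 's set" where "still c = {i. c $ i = 0}"
definition down :: "real^'s \<Rightarrow> 's set" where "down c = {i. c $ i < 0}"

definition diag :: "real^'s \<Rightarrow> real^'s^'s" where
  "diag v = (\<chi> i j. if i = j then v $ i else 0)"

definition block :: "'s set \<Rightarrow> 's set \<Rightarrow> real^'s^'s \<Rightarrow> real^'s^'s" where
  "block S T M = (\<chi> i j. if i \<in> S \<and> j \<in> T then M $ i $ j else 0)"

text \<open>
  The inverse of the square block with index set \<open>S \<times> S\<close>, again extended by zero; the identity
  matrix of that block is \<open>block S S (mat 1)\<close>.
\<close>
definition block_inv :: "'s set \<Rightarrow> real^'s::finite^'s \<Rightarrow> real^'s^'s" where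
  "block_inv S M = (THE X. block S S X = X \<and>
     block S S M ** X = block S S (mat 1) \<and> X ** block S S M = block S S (mat 1))"


subsection \<open>The phase process\<close>

definition generator :: "real^'s::finite^'s \<Rightarrow> bool" where
  "generator A \<longleftrightarrow> (\<forall>i j. i \<noteq> j \<longrightarrow> A $ i $ j \<ge> 0) \<and> (\<forall>i. (\<Sum>j\<in>UNIV. A $ i $ j) = 0)"

definition mat_exp :: "real^'s::finite^'s \<Rightarrow> real^'s^'s" where
  "mat_exp B = (\<Sum>n. (((\<lambda>X. B ** X) ^^ n) (mat 1)) /\<^sub>R fact n)"

text \<open>
  A time-homogeneous continuous-time Markov chain with right-continuous paths (for the discrete
  topology on the phases) and generator \<open>A\<close>; the Markov property is stated through
  finite-dimensional distributions. The initial distribution is left open.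
\<close>
definition markov_chain :: "'w measure \<Rightarrow> (real \<Rightarrow> 'w \<Rightarrow> 's::finite) \<Rightarrow> real^'s^'s \<Rightarrow> bool" where
  "markov_chain M \<phi> A \<longleftrightarrow>
     prob_space M \<and> generator A \<and>
     (\<forall>t\<ge>0. \<phi> t \<in> M \<rightarrow>\<^sub>M count_space UNIV) \<and>
     (\<forall>\<omega>\<in>space M. \<forall>t\<ge>0. \<exists>\<delta>>0. \<forall>s\<in>{t..<t + \<delta>}. \<phi> s \<omega> = \<phi> t \<omega>) \<and>
     (\<forall>(n::nat) (t::nat \<Rightarrow> real) (x::nat \<Rightarrow> 's).
        0 \<le> t 0 \<and> (\<forall>k\<le>n. t k \<le> t (Suc k)) \<longrightarrow>
        \<P>(\<omega> in M. \<forall>k\<le>Suc n. \<phi> (t k) \<omega> = x k) =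
        \<P>(\<omega> in M. \<forall>k\<le>n. \<phi> (t k) \<omega> = x k) *
          mat_exp ((t (Suc n) - t n) *\<^sub>R A) $ x n $ x (Suc n))"

definition stationary :: "real^'s::finite^'s \<Rightarrow> real^'s \<Rightarrow> bool" where
  "stationary A \<xi> \<longleftrightarrow> 0 \<le> \<xi> \<and> \<xi> v* A = 0 \<and> \<xi> \<bullet> 1 = 1 \<and>
     (\<forall>\<eta>. \<eta> v* A = 0 \<and> \<eta> \<bullet> 1 = 1 \<longrightarrow> \<eta> = \<xi>)"


subsection \<open>The fluid level and the first return probabilities\<close>

text \<open>The level process started from \<open>Y(0) = 0\<close>.\<close>
definition level :: "(real \<Rightarrow> 'w \<Rightarrow> 's::finite) \<Rightarrow> real^'s \<Rightarrow> real \<Rightarrow> 'w \<Rightarrow> real" where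
  "level \<phi> c t \<omega> = (LBINT s:{0..t}. c $ (\<phi> s \<omega>))"

definition tau_down :: "(real \<Rightarrow> 'w \<Rightarrow> 's::finite) \<Rightarrow> real^'s \<Rightarrow> 'w \<Rightarrow> ereal" where
  "tau_down \<phi> c \<omega> = Inf {ereal t | t. t > 0 \<and> level \<phi> c t \<omega> < 0}"

definition first_return ::
    "'w measure \<Rightarrow> (real \<Rightarrow> 'w \<Rightarrow> 's::finite) \<Rightarrow> real^'s \<Rightarrow> real^'s^'s" where
  "first_return M \<phi> c = block (up c) (down c)
     (\<chi> i j. \<P>(\<omega> in M. tau_down \<phi> c \<omega> < \<infinity> \<and> \<phi> (real_of_ereal (tau_down \<phi> c \<omega>)) \<omega> = j
                \<bar> \<phi> 0 \<omega> = i))"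


subsection \<open>The matrix equations\<close>

definition Q_block ::
    "real^'s::finite^'s \<Rightarrow> real^'s \<Rightarrow> 's set \<Rightarrow> 's set \<Rightarrow> real^'s^'s" where
  "Q_block A c S T = block S T A +
     block S (still c) A ** (- block_inv (still c) A) ** block (still c) T A"

definition inv_up :: "real^'s::finite \<Rightarrow> real^'s^'s" where
  "inv_up c = block_inv (up c) (diag c)"

definition abs_inv_down :: "real^'s::finite \<Rightarrow> real^'s^'s" where
  "abs_inv_down c = \<bar>block_inv (down c) (diag c)\<bar>"

definition riccati :: "real^'s::finite^'s \<Rightarrow> real^'s \<Rightarrow> real^'s^'s \<Rightarrow> real^'s^'s" where
  "riccati A c X =
     inv_up c ** Q_block A c (up c) (down c) +
     inv_up c ** Q_block A c (up c) (up c) ** X +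
     X ** abs_inv_down c ** Q_block A c (down c) (down c) +
     X ** abs_inv_down c ** Q_block A c (down c) (up c) ** X"

definition nonneg_solution :: "real^'s::finite^'s \<Rightarrow> real^'s \<Rightarrow> real^'s^'s \<Rightarrow> bool" where
  "nonneg_solution A c X \<longleftrightarrow> block (up c) (down c) X = X \<and> 0 \<le> X \<and> riccati A c X = 0"

definition minimal_nonneg_solution ::
    "real^'s::finite^'s \<Rightarrow> real^'s \<Rightarrow> real^'s^'s \<Rightarrow> bool" where
  "minimal_nonneg_solution A c X \<longleftrightarrow>
     nonneg_solution A c X \<and> (\<forall>Z. nonneg_solution A c Z \<longrightarrow> X \<le> Z)"

definition U_matrix ::
    "real^'s::finite^'s \<Rightarrow> real^'s \<Rightarrow> real^'s^'s \<Rightarrow> real^'s^'s" where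
  "U_matrix A c \<Psi> = abs_inv_down c ** Q_block A c (down c) (down c) +
     abs_inv_down c ** Q_block A c (down c) (up c) ** \<Psi>"

definition K_matrix ::
    "real^'s::finite^'s \<Rightarrow> real^'s \<Rightarrow> real^'s^'s \<Rightarrow> real^'s^'s" where
  "K_matrix A c \<Psi> = inv_up c ** Q_block A c (up c) (up c) +
     \<Psi> ** abs_inv_down c ** Q_block A c (down c) (up c)"

text \<open>\<open>c'\<close> is the diagonal of the perturbation of the rate matrix (not a derivative).\<close>
definition sylvester_solution ::
    "real^'s::finite^'s \<Rightarrow> real^'s \<Rightarrow> real^'s \<Rightarrow> real^'s^'s \<Rightarrow> real^'s^'s \<Rightarrow> bool" where
  "sylvester_solution A c c' \<Psi> X \<longleftrightarrow>
     block (up c) (down c) X = X \<and>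
     K_matrix A c \<Psi> ** X + X ** U_matrix A c \<Psi> =
       - (\<Psi> ** abs_inv_down c ** block (down c) (down c) (diag c') ** U_matrix A c \<Psi>)
       - inv_up c ** block (up c) (up c) (diag c') ** \<Psi> ** U_matrix A c \<Psi>"


subsection \<open>Perturbation\<close>

definition admissible :: "real^'s \<Rightarrow> real^'s \<Rightarrow> real \<Rightarrow> bool" where
  "admissible c c' \<epsilon> \<longleftrightarrow>
     (\<forall>i\<in>up c. (c + \<epsilon> *\<^sub>R c') $ i > 0) \<and> (\<forall>i\<in>down c. (c + \<epsilon> *\<^sub>R c') $ i < 0)"

definition real_analytic_at :: "(real \<Rightarrow> 'a::real_normed_vector) \<Rightarrow> real \<Rightarrow> bool" where
  "real_analytic_at f x \<longleftrightarrow>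
     (\<exists>r>0. \<exists>a. \<forall>h. \<bar>h\<bar> < r \<longrightarrow> (\<lambda>n. h ^ n *\<^sub>R a n) sums f (x + h))"

end

theory Submission
  imports Defs "HOL-Complex_Analysis.Cauchy_Integral_Formula"
begin

text \<open>
  The pair of level and phase is a Markov process with generator
  \<open>(L f) y i = c $ i * f' y i + (\<Sum>j. A $ i $ j * f y j)\<close>. The whole argument rests on the functions
  annihilated by \<open>L\<close>: they are the columns of \<open>N ** mat_exp (y *\<^sub>R H)\<close>, where \<open>H\<close> is
  \<open>- C\<^sup>-\<^sup>1 Q\<close> on the phases with non-zero rate and \<open>N\<close> extends a function from these phases to the
  still ones (\<open>harmonic\<close>). Write \<open>E b\<close> for \<open>mat_exp (b *\<^sub>R H)\<close>, and \<open>Pu\<close>, \<open>Pd\<close> for the projections on the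
  phases with positive and negative rate.

  Start the level at 0 in a phase of positive rate and stop it when it
  leaves the strip \<open>{0..b}\<close>. Let \<open>p b\<close> and \<open>r b\<close> be the matrices of the probabilities to leave through
  the bottom and through the top in a given phase. Dynkin's formula (\<open>dynkin\<close>, \<open>exit_inequality\<close>)
  applied to the harmonic functions gives \<open>Pu = p b + r b ** E b\<close> (\<open>exit_identity\<close>). That the strip is
  left at all follows from Dynkin's formula too, for a function on which \<open>L\<close> is constantly 1
  (\<open>lyapunov_function\<close>). As \<open>b\<close> grows, \<open>p b\<close> increases to the matrix \<open>\<Psi>\<close> of return probabilities
  (\<open>exit_law_tendsto\<close>). The identities for \<open>a\<close> and for \<open>a + s\<close>, combined by the semigroup law of \<open>E\<close>,
  say in the limit \<open>a \<rightarrow> \<infinity>\<close> that \<open>V ** E s = V ** E s ** V\<close> for \<open>V = Pu - \<Psi>\<close> (\<open>Psi_semigroup\<close>); the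
  derivative at \<open>s = 0\<close> is \<open>V ** H ** (\<Psi> + Pd) = 0\<close>, and this product is the negative of the Riccati
  expression (\<open>Psi_invariant\<close>, \<open>riccati_eq\<close>). If \<open>Z\<close> is any non-negative solution, then
  \<open>H ** (Z + Pd) = (Z + Pd) ** U\<close> for the matrix \<open>U\<close> belonging to \<open>Z\<close>, and the identity
  \<open>Pu = p b + r b ** E b\<close> multiplied by \<open>Z + Pd\<close> becomes \<open>Z = p b + r b ** Z ** mat_exp (b *\<^sub>R U)\<close>. Its last
  term is non-negative, so \<open>p b \<le> Z\<close> and \<open>\<Psi> \<le> Z\<close> (\<open>Psi_minimal\<close>).

  Negative drift provides a vector \<open>u\<close> such that \<open>L\<close> maps \<open>y + u $ i\<close> to the
  constant \<open>\<mu> < 0\<close>. It bounds \<open>r b\<close> by a multiple of \<open>1 / b\<close>, so the rows of \<open>\<Psi>\<close> sum to 1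
  (\<open>Psi_rowsum\<close>), and \<open>v = V *v u\<close> is a positive vector with \<open>K *v v < 0\<close> (\<open>K_stable\<close>). Both \<open>K\<close> and \<open>U\<close>
  are non-negative off the diagonal and \<open>U\<close> has non-positive row sums; a maximum principle
  then shows that \<open>X \<mapsto> K ** X + X ** U\<close> is injective (\<open>sylvester_injective\<close>), hence invertible.

  Changing the rates multiplies \<open>H\<close> from the left by a diagonal matrix close to
  the identity, and what was said about the Riccati equation applies to each perturbed model. Every limit point
  of \<open>\<Psi>(\<epsilon>)\<close> at 0 is a non-negative solution of the unperturbed equation, hence
  at least \<open>\<Psi>\<close>, and its row sums are at most 1, which are those of \<open>\<Psi>\<close>; so \<open>\<Psi>(\<epsilon>)\<close> tends to \<open>\<Psi>\<close>
  (\<open>Psi_eps_tendsto\<close>). Since the linear part of the Riccati equation at \<open>\<Psi>\<close> is the Sylvester operator,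
  its inverse turns the equation for \<open>\<Psi>(\<epsilon>) - \<Psi>\<close> into the fixed point equation of a contraction which
  makes sense for complex \<open>\<epsilon>\<close> as well; the iterates are holomorphic, and so is their uniform limit
  (\<open>analytic_branch\<close>). Differentiating the factored Riccati equation at \<open>\<epsilon> = 0\<close> gives the Sylvester
  equation for the first-order term (\<open>first_order_term\<close>), which injectivity solves uniquely.
\<close>

section \<open>Matrix exponentials\<close>

lemma matrix_entry: "(A ** B) $ i $ j = (\<Sum>k\<in>UNIV. A $ i $ k * B $ k $ j)"
  for A :: "real^'n^'m" and B :: "real^'p^'n"
  by (simp add: matrix_matrix_mult_def)

lemma bounded_bilinear_matrix_mult:
  "bounded_bilinear ((**) :: real^'n^'n \<Rightarrow> real^'n^'n \<Rightarrow> real^'n^'n)"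
  unfolding bilinear_conv_bounded_bilinear[symmetric] bilinear_def linear_iff
  by (auto simp: vec_eq_iff matrix_entry algebra_simps sum.distrib sum_distrib_left)

interpretation matmul: bounded_bilinear "(**) :: real^'n^'n \<Rightarrow> real^'n^'n \<Rightarrow> real^'n^'n"
  by (rule bounded_bilinear_matrix_mult)

text \<open>The form in which matrix powers occur in the exponential series \<open>mat_exp\<close>.\<close>
abbreviation matpow :: "real^'n^'n \<Rightarrow> nat \<Rightarrow> real^'n^'n" where
  "matpow B n \<equiv> ((\<lambda>X. B ** X) ^^ n) (mat 1)"

lemma matpow_commute: "matpow B n ** B = B ** matpow B n" for B :: "real^'n^'n"
  by (induction n) (simp_all add: matrix_mul_assoc [symmetric])

lemma matpow_scaleR: "matpow (x *\<^sub>R B) n = x ^ n *\<^sub>R matpow B n" for B :: "real^'n^'n"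
  by (induction n) (simp_all add: matmul.scaleR_left matmul.scaleR_right mult.commute)

lemma matpow_bound:
  fixes B :: "real^'n^'n"
  obtains K where "K \<ge> 0" "\<And>n i j. \<bar>matpow B n $ i $ j\<bar> \<le> K ^ n"
proof
  define K where "K = (\<Sum>i\<in>UNIV. \<Sum>k\<in>UNIV. \<bar>B $ i $ k\<bar>)"
  show K0: "K \<ge> 0" unfolding K_def by (intro sum_nonneg) auto
  show "\<bar>matpow B n $ i $ j\<bar> \<le> K ^ n" for n i j
  proof (induction n arbitrary: i)
    case 0 show ?case by (simp add: mat_def)
  next
    case (Suc n)
    have "\<bar>matpow B (Suc n) $ i $ j\<bar> = \<bar>\<Sum>k\<in>UNIV. B $ i $ k * matpow B n $ k $ j\<bar>"
      by (simp add: matrix_entry)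
    also have "\<dots> \<le> (\<Sum>k\<in>UNIV. \<bar>B $ i $ k\<bar> * K ^ n)"
      by (intro sum_abs[THEN order_trans] sum_mono) (auto simp: abs_mult intro!: mult_left_mono Suc.IH)
    also have "\<dots> = (\<Sum>k\<in>UNIV. \<bar>B $ i $ k\<bar>) * K ^ n" by (simp add: sum_distrib_right)
    also have "\<dots> \<le> K * K ^ n"
      unfolding K_def[symmetric]
      by (intro mult_right_mono) (auto simp: K_def K0[unfolded K_def] intro!: member_le_sum[of i UNIV "\<lambda>i. \<Sum>k\<in>UNIV. \<bar>B $ i $ k\<bar>"] sum_nonneg zero_le_power)
    finally show ?case by simp
  qed
qed

lemma summable_matpow:
  fixes B :: "real^'n^'n"
  shows "summable (\<lambda>n. matpow B n $ i $ j / fact n * x ^ n)"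
proof -
  obtain K where K: "K \<ge> 0" "\<And>n i j. \<bar>matpow B n $ i $ j\<bar> \<le> K ^ n"
    using matpow_bound[of B] by metis
  show ?thesis
  proof (rule summable_comparison_test[OF _ summable_exp[of "K * \<bar>x\<bar>"]], intro exI allI impI)
    fix n
    have "norm (matpow B n $ i $ j / fact n * x ^ n) = \<bar>matpow B n $ i $ j\<bar> * \<bar>x\<bar> ^ n / fact n"
      by (simp add: abs_mult power_abs)
    also have "\<dots> \<le> K ^ n * \<bar>x\<bar> ^ n / fact n"
      by (intro divide_right_mono mult_right_mono K) auto
    finally show "norm (matpow B n $ i $ j / fact n * x ^ n) \<le> inverse (fact n) * (K * \<bar>x\<bar>) ^ n"
      by (simp add: power_mult_distrib field_simps)
  qed
qed

lemma mat_exp_entry: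
  fixes B :: "real^'n^'n"
  shows "mat_exp (x *\<^sub>R B) $ i $ j = (\<Sum>n. matpow B n $ i $ j / fact n * x ^ n)"
proof -
  define S :: "real^'n^'n" where "S = (\<chi> i j. \<Sum>n. matpow B n $ i $ j / fact n * x ^ n)"
  have "(\<lambda>n. matpow (x *\<^sub>R B) n /\<^sub>R fact n) sums S"
    unfolding sums_def
  proof (intro vec_tendstoI)
    fix i j
    have "(\<lambda>n. matpow B n $ i $ j / fact n * x ^ n) sums S $ i $ j"
      unfolding S_def using summable_sums[OF summable_matpow[of B i j x]] by simp
    then show "(\<lambda>n. (\<Sum>m<n. matpow (x *\<^sub>R B) m /\<^sub>R fact m) $ i $ j) \<longlonglongrightarrow> S $ i $ j"
      by (simp add: sums_def matpow_scaleR divide_inverse mult_ac)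
  qed
  then have "mat_exp (x *\<^sub>R B) = S" unfolding mat_exp_def by (simp add: sums_iff)
  then show ?thesis by (simp add: S_def)
qed

definition mat_deriv :: "(real \<Rightarrow> real^'n^'n) \<Rightarrow> real^'n^'n \<Rightarrow> real \<Rightarrow> bool" where
  "mat_deriv F F' x \<longleftrightarrow> (\<forall>i j. ((\<lambda>y. F y $ i $ j) has_real_derivative F' $ i $ j) (at x))"

lemma mat_deriv_const: "mat_deriv (\<lambda>_. G) 0 x"
  by (simp add: mat_deriv_def)

lemma mat_deriv_mult:
  assumes "mat_deriv F F' x" "mat_deriv G G' x"
  shows "mat_deriv (\<lambda>y. F y ** G y) (F' ** G x + F x ** G') x"
  unfolding mat_deriv_def
proof (intro allI)
  fix i j
  note [derivative_intros] = assms[unfolded mat_deriv_def, rule_format]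
  show "((\<lambda>y. (F y ** G y) $ i $ j) has_real_derivative (F' ** G x + F x ** G') $ i $ j) (at x)"
    unfolding matrix_entry vector_add_component
    by (auto intro!: derivative_eq_intros simp: sum.distrib algebra_simps)
qed

lemma mat_deriv_zero_const:
  assumes "\<And>x. mat_deriv F 0 x"
  shows "F x = F y"
proof -
  have "F x $ i $ j = F y $ i $ j" for i j
    using DERIV_isconst_all[of "\<lambda>y. F y $ i $ j" x y] assms by (simp add: mat_deriv_def)
  then show ?thesis by (simp add: vec_eq_iff)
qed

lemma mat_exp_commute:
  fixes B :: "real^'n^'n"
  shows "mat_exp (x *\<^sub>R B) ** B = B ** mat_exp (x *\<^sub>R B)"
proof -
  have "(mat_exp (x *\<^sub>R B) ** B) $ i $ j = (B ** mat_exp (x *\<^sub>R B)) $ i $ j" for i j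
  proof -
    have "(mat_exp (x *\<^sub>R B) ** B) $ i $ j = (\<Sum>k\<in>UNIV. \<Sum>n. matpow B n $ i $ k / fact n * x ^ n * B $ k $ j)"
      unfolding matrix_entry mat_exp_entry suminf_mult2[OF summable_matpow] ..
    also have "\<dots> = (\<Sum>n. \<Sum>k\<in>UNIV. matpow B n $ i $ k / fact n * x ^ n * B $ k $ j)"
      by (intro suminf_sum[symmetric] summable_mult2 summable_matpow)
    also have "\<dots> = (\<Sum>n. (matpow B n ** B) $ i $ j / fact n * x ^ n)"
      by (simp add: matrix_entry sum_distrib_left sum_distrib_right sum_divide_distrib mult_ac)
    also have "\<dots> = (\<Sum>n. \<Sum>k\<in>UNIV. B $ i $ k * (matpow B n $ k $ j / fact n * x ^ n))"
      by (simp add: matpow_commute matrix_entry sum_distrib_left sum_distrib_right sum_divide_distrib mult_ac)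
    also have "\<dots> = (\<Sum>k\<in>UNIV. \<Sum>n. B $ i $ k * (matpow B n $ k $ j / fact n * x ^ n))"
      by (intro suminf_sum summable_mult summable_matpow)
    also have "\<dots> = (B ** mat_exp (x *\<^sub>R B)) $ i $ j"
      unfolding matrix_entry mat_exp_entry suminf_mult[OF summable_matpow] ..
    finally show ?thesis .
  qed
  then show ?thesis by (simp add: vec_eq_iff)
qed

lemma mat_deriv_mat_exp:
  fixes B :: "real^'n^'n"
  shows "mat_deriv (\<lambda>y. mat_exp (y *\<^sub>R B)) (B ** mat_exp (x *\<^sub>R B)) x"
  unfolding mat_deriv_def
proof (intro allI)
  fix i j
  define c where "c i = (\<lambda>n. matpow B n $ i $ j / fact n)" for i
  have "((\<lambda>y. \<Sum>n. c i n * y ^ n) has_real_derivative (\<Sum>n. diffs (c i) n * x ^ n)) (at x)"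
    by (rule termdiffs_strong_converges_everywhere) (use summable_matpow[of B i j] in \<open>simp add: c_def\<close>)
  moreover have "(\<Sum>n. diffs (c i) n * x ^ n) = (B ** mat_exp (x *\<^sub>R B)) $ i $ j"
  proof -
    have "diffs (c i) n * x ^ n = (\<Sum>k\<in>UNIV. B $ i $ k * (c k n * x ^ n))" for n
      by (simp add: diffs_def c_def matrix_entry sum_distrib_left sum_distrib_right sum_divide_distrib
          field_simps del: of_nat_Suc)
    then have "(\<Sum>n. diffs (c i) n * x ^ n) = (\<Sum>n. \<Sum>k\<in>UNIV. B $ i $ k * (c k n * x ^ n))" by simp
    also have "\<dots> = (\<Sum>k\<in>UNIV. \<Sum>n. B $ i $ k * (c k n * x ^ n))"
      unfolding c_def by (intro suminf_sum summable_mult summable_matpow)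
    also have "\<dots> = (B ** mat_exp (x *\<^sub>R B)) $ i $ j"
      unfolding matrix_entry mat_exp_entry suminf_mult[OF summable_matpow] c_def ..
    finally show ?thesis .
  qed
  ultimately show "((\<lambda>y. mat_exp (y *\<^sub>R B) $ i $ j) has_real_derivative (B ** mat_exp (x *\<^sub>R B)) $ i $ j) (at x)"
    by (simp add: mat_exp_entry c_def)
qed

lemma mat_deriv_mat_exp_rev:
  fixes B :: "real^'n^'n"
  shows "mat_deriv (\<lambda>y. mat_exp ((c - y) *\<^sub>R B)) (- (mat_exp ((c - x) *\<^sub>R B) ** B)) x"
  unfolding mat_deriv_def
proof (intro allI)
  fix i j
  have "((\<lambda>y. mat_exp (y *\<^sub>R B) $ i $ j) has_real_derivative (mat_exp ((c - x) *\<^sub>R B) ** B) $ i $ j) (at (c - x))"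
    using mat_deriv_mat_exp[of B "c - x"] by (simp add: mat_deriv_def mat_exp_commute)
  moreover have "((\<lambda>y. c - y) has_real_derivative - 1) (at x)" by (auto intro!: derivative_eq_intros)
  ultimately show "((\<lambda>y. mat_exp ((c - y) *\<^sub>R B) $ i $ j) has_real_derivative
      (- (mat_exp ((c - x) *\<^sub>R B) ** B)) $ i $ j) (at x)"
    using DERIV_chain2[of "\<lambda>y. mat_exp (y *\<^sub>R B) $ i $ j" _ "\<lambda>y. c - y" x] by fastforce
qed

lemma mat_exp_zero: "mat_exp (0 :: real^'n^'n) = mat 1"
proof -
  have "mat_exp (0 *\<^sub>R (0 :: real^'n^'n)) $ i $ j = (mat 1 :: real^'n^'n) $ i $ j" for i j
    unfolding mat_exp_entry by (subst powser_zero) simp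
  then show ?thesis by (simp add: vec_eq_iff)
qed

text \<open>The product \<open>mat_exp ((x - u) *\<^sub>R B) ** F u\<close> does not depend on \<open>u\<close>.\<close>
lemma mat_exp_ode_unique:
  fixes B :: "real^'n^'n"
  assumes "\<And>u. mat_deriv F (B ** F u) u"
  shows "F x = mat_exp (x *\<^sub>R B) ** F 0"
proof -
  have "mat_deriv (\<lambda>u. mat_exp ((x - u) *\<^sub>R B) ** F u) 0 u" for u
    using mat_deriv_mult[OF mat_deriv_mat_exp_rev[of x B u] assms[of u]]
    by (simp add: matmul.minus_left matrix_mul_assoc)
  from mat_deriv_zero_const[OF this, of x 0] show ?thesis
    by (simp add: mat_exp_zero)
qed

text \<open>Both sides solve \<open>F' = B ** F\<close> with \<open>F 0 = G\<close>.\<close>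
lemma mat_exp_intertwine:
  fixes B D G :: "real^'n^'n"
  assumes "B ** G = G ** D"
  shows "mat_exp (x *\<^sub>R B) ** G = G ** mat_exp (x *\<^sub>R D)"
proof -
  have "mat_deriv (\<lambda>u. G ** mat_exp (u *\<^sub>R D)) (B ** (G ** mat_exp (u *\<^sub>R D))) u" for u
    using mat_deriv_mult[OF mat_deriv_const[of G u] mat_deriv_mat_exp[of D u]] assms
    by (simp add: matrix_mul_assoc)
  from mat_exp_ode_unique[OF this, of x] show ?thesis by (simp add: mat_exp_zero)
qed

lemma mat_exp_add:
  fixes B :: "real^'n^'n"
  shows "mat_exp ((s + t) *\<^sub>R B) = mat_exp (s *\<^sub>R B) ** mat_exp (t *\<^sub>R B)"
proof -
  have "mat_deriv (\<lambda>u. mat_exp ((u + t) *\<^sub>R B)) (B ** mat_exp ((u + t) *\<^sub>R B)) u" for u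
    using mat_deriv_mat_exp[of B "u + t"] unfolding mat_deriv_def
    by (simp add: DERIV_shift)
  from mat_exp_ode_unique[OF this, of s] show ?thesis by simp
qed

text \<open>Adding a large multiple \<open>l\<close> of the identity to \<open>B\<close> makes all entries non-negative, hence also the
  exponential series, and changes the exponential only by the positive factor \<open>exp (l * x)\<close>.\<close>
lemma mat_exp_nonneg:
  fixes B :: "real^'n^'n"
  assumes "\<And>i j. i \<noteq> j \<Longrightarrow> B $ i $ j \<ge> 0" "x \<ge> 0"
  shows "mat_exp (x *\<^sub>R B) $ i $ j \<ge> 0"
proof -
  define l where "l = (\<Sum>i\<in>UNIV. \<bar>B $ i $ i\<bar>)"
  define D where "D = B + l *\<^sub>R mat 1"
  have D0: "D $ i $ j \<ge> 0" for i j
  proof (cases "i = j")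
    case True
    have "\<bar>B $ i $ i\<bar> \<le> l" unfolding l_def by (intro member_le_sum) auto
    then show ?thesis using True by (simp add: D_def mat_def)
  qed (simp add: D_def mat_def assms)
  have pow0: "matpow D n $ i $ j \<ge> 0" for n i j
    by (induction n arbitrary: i) (auto simp: matrix_entry D0 mat_def intro!: sum_nonneg)
  have E0: "mat_exp (x *\<^sub>R D) $ i $ j \<ge> 0"
    unfolding mat_exp_entry by (intro suminf_nonneg summable_matpow) (simp add: pow0 assms)
  have BD: "B = D - l *\<^sub>R mat 1" by (simp add: D_def)
  have "mat_deriv (\<lambda>u. exp (- l * u) *\<^sub>R mat_exp (u *\<^sub>R D))
      (B ** (exp (- l * u) *\<^sub>R mat_exp (u *\<^sub>R D))) u" for u
    unfolding mat_deriv_def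
  proof (intro allI)
    fix i j
    have [derivative_intros]: "((\<lambda>y. mat_exp (y *\<^sub>R D) $ i $ j) has_real_derivative (D ** mat_exp (u *\<^sub>R D)) $ i $ j) (at u)"
      using mat_deriv_mat_exp[of D u] by (simp add: mat_deriv_def)
    show "((\<lambda>u. (exp (- l * u) *\<^sub>R mat_exp (u *\<^sub>R D)) $ i $ j) has_real_derivative
      (B ** (exp (- l * u) *\<^sub>R mat_exp (u *\<^sub>R D))) $ i $ j) (at u)"
      unfolding vector_scaleR_component
      by (auto intro!: derivative_eq_intros simp: BD matmul.diff_left matmul.scaleR_left matmul.scaleR_right algebra_simps)
  qed
  from mat_exp_ode_unique[OF this, of x] have "mat_exp (x *\<^sub>R B) = exp (- l * x) *\<^sub>R mat_exp (x *\<^sub>R D)"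
    by (simp add: mat_exp_zero)
  then show ?thesis using E0 by simp
qed

text \<open>The mean value inequality, first for \<open>f1\<close> and then for \<open>z \<mapsto> f z - z * f1 y\<close>. The resulting constant
  \<open>m\<close> instead of \<open>m / 2\<close> suffices for all error estimates.\<close>
lemma second_order_bound:
  fixes f f1 f2 :: "real \<Rightarrow> real"
  assumes f: "\<And>y. (f has_real_derivative f1 y) (at y)" "\<And>y. (f1 has_real_derivative f2 y) (at y)"
    and m: "\<And>y. y \<in> {-R..R} \<Longrightarrow> \<bar>f2 y\<bar> \<le> m" "m \<ge> 0"
    and y: "y \<in> {-R..R}" "y + d \<in> {-R..R}"
  shows "\<bar>f (y + d) - f y - d * f1 y\<bar> \<le> m * d\<^sup>2"
proof -
  let ?S = "closed_segment y (y + d)"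
  have sub: "?S \<subseteq> {-R..R}" using y by (intro closed_segment_subset) auto
  have *: "norm (f1 z - f1 y) \<le> m * norm (z - y)" if "z \<in> ?S" for z
  proof (rule field_differentiable_bound[of ?S f1 f2])
    show "(f1 has_field_derivative f2 w) (at w within ?S)" for w
      by (rule has_field_derivative_at_within) (rule f)
    show "norm (f2 w) \<le> m" if "w \<in> ?S" for w
      using m(1) sub that by auto
  qed (use that in simp_all)
  have **: "norm (f1 z - f1 y) \<le> m * \<bar>d\<bar>" if "z \<in> ?S" for z
  proof -
    have "\<bar>z - y\<bar> \<le> \<bar>d\<bar>" using that by (auto simp: closed_segment_eq_real_ivl split: if_splits)
    then show ?thesis using *[OF that] m(2) mult_left_mono[of "\<bar>z - y\<bar>" "\<bar>d\<bar>" m] by simp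
  qed
  have "norm ((f (y + d) - (y + d) * f1 y) - (f y - y * f1 y)) \<le> m * \<bar>d\<bar> * norm ((y + d) - y)"
  proof (rule field_differentiable_bound[of ?S "\<lambda>z. f z - z * f1 y" "\<lambda>z. f1 z - f1 y"])
    show "((\<lambda>z. f z - z * f1 y) has_field_derivative f1 w - f1 y) (at w within ?S)" for w
      by (rule has_field_derivative_at_within) (auto intro!: derivative_eq_intros f(1))
  qed (use ** in simp_all)
  then show ?thesis by (simp add: algebra_simps power2_eq_square)
qed

lemma mat_exp_second_order:
  fixes A :: "real^'n^'n"
  obtains C where "C \<ge> 0" "\<And>h i j. 0 \<le> h \<Longrightarrow> h \<le> T \<Longrightarrow>
    \<bar>mat_exp (h *\<^sub>R A) $ i $ j - (mat 1 :: real^'n^'n) $ i $ j - h * A $ i $ j\<bar> \<le> C * h\<^sup>2"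
proof -
  define F where "F y = A ** (A ** mat_exp (y *\<^sub>R A))" for y
  have d: "((\<lambda>y. mat_exp (y *\<^sub>R A) $ i $ j) has_real_derivative (A ** mat_exp (y *\<^sub>R A)) $ i $ j) (at y)" for i j y
    using mat_deriv_mat_exp[of A y] by (simp add: mat_deriv_def)
  have d2: "((\<lambda>y. (A ** mat_exp (y *\<^sub>R A)) $ i $ j) has_real_derivative F y $ i $ j) (at y)" for i j y
    using mat_deriv_mult[OF mat_deriv_const[of A y] mat_deriv_mat_exp[of A y]]
    by (simp add: mat_deriv_def F_def)
  have "continuous_on {-\<bar>T\<bar>..\<bar>T\<bar>} (\<lambda>y. mat_exp (y *\<^sub>R A) $ i $ j)" for i j
    by (rule DERIV_continuous_on) (rule has_field_derivative_at_within[OF d])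
  then have cont: "continuous_on {-\<bar>T\<bar>..\<bar>T\<bar>} (\<lambda>y. F y $ i $ j)" for i j
    unfolding F_def matrix_entry by (intro continuous_on_sum continuous_on_mult continuous_on_const) auto
  have "\<exists>m. \<forall>y\<in>{-\<bar>T\<bar>..\<bar>T\<bar>}. \<bar>F y $ i $ j\<bar> \<le> m" for i j
    using compact_imp_bounded[OF compact_continuous_image[OF cont[of i j]]] by (auto simp: bounded_iff)
  then obtain m where m: "\<And>i j y. y \<in> {-\<bar>T\<bar>..\<bar>T\<bar>} \<Longrightarrow> \<bar>F y $ i $ j\<bar> \<le> m i j" by metis
  define C where "C = (\<Sum>i\<in>UNIV. \<Sum>j\<in>UNIV. \<bar>m i j\<bar>)"
  have mC: "\<bar>m i j\<bar> \<le> C" for i j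
    unfolding C_def
    by (rule order_trans[OF member_le_sum[of j UNIV "\<lambda>j. \<bar>m i j\<bar>"]
          member_le_sum[of i UNIV "\<lambda>i. \<Sum>j\<in>UNIV. \<bar>m i j\<bar>"]]) (auto intro!: sum_nonneg)
  show ?thesis
  proof
    show "C \<ge> 0" unfolding C_def by (intro sum_nonneg) auto
    fix h i j assume h: "0 \<le> h" "h \<le> T"
    have "\<bar>mat_exp ((0 + h) *\<^sub>R A) $ i $ j - mat_exp (0 *\<^sub>R A) $ i $ j - h * (A ** mat_exp (0 *\<^sub>R A)) $ i $ j\<bar> \<le> C * h\<^sup>2"
      by (rule second_order_bound[OF d d2, of "\<bar>T\<bar>" i j C])
         (use h m[of _ i j] mC[of i j] in \<open>force+\<close>)
    then show "\<bar>mat_exp (h *\<^sub>R A) $ i $ j - (mat 1 :: real^'n^'n) $ i $ j - h * A $ i $ j\<bar> \<le> C * h\<^sup>2"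
      by (simp add: mat_exp_zero)
  qed
qed

section \<open>Blocks and generators with a unique stationary vector\<close>

lemma block_entry [simp]: "block S T M $ i $ j = (if i \<in> S \<and> j \<in> T then M $ i $ j else 0)"
  by (simp add: block_def)

text \<open>Blocks stay matrices over all phases, so taking a block is multiplication by diagonal projections
  from both sides.\<close>
abbreviation proj :: "'s set \<Rightarrow> real^'s::finite^'s" where
  "proj S \<equiv> block S S (mat 1)"

lemma proj_left: "(proj S ** M) $ i $ j = (if i \<in> S then M $ i $ j else 0)"
proof -
  have "(proj S ** M) $ i $ j = (\<Sum>k\<in>UNIV. if k = i then (if i \<in> S then M $ i $ j else 0) else 0)"
    unfolding matrix_entry by (intro sum.cong) (auto simp: mat_def)
  then show ?thesis by simp
qed

lemma proj_right: "(M ** proj S) $ i $ j = (if j \<in> S then M $ i $ j else 0)"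
proof -
  have "(M ** proj S) $ i $ j = (\<Sum>k\<in>UNIV. if k = j then (if j \<in> S then M $ i $ j else 0) else 0)"
    unfolding matrix_entry by (intro sum.cong) (auto simp: mat_def)
  then show ?thesis by simp
qed

lemma block_eq_proj: "block S T M = proj S ** M ** proj T"
  by (auto simp: vec_eq_iff proj_left proj_right)

lemma proj_idem: "proj S ** proj S = proj S"
  by (auto simp: vec_eq_iff proj_left)

lemma block_block_eq: "block S T M = M \<Longrightarrow> proj S ** M = M" "block S T M = M \<Longrightarrow> M ** proj T = M"
  by (auto simp: vec_eq_iff proj_left proj_right) metis+

lemma proj_disjoint: "S \<inter> T = {} \<Longrightarrow> proj S ** proj T = 0"
  by (auto simp: vec_eq_iff proj_left)

lemma block_inv_eqI:
  assumes X: "block S S X = X" "block S S M ** X = proj S" "X ** block S S M = proj S"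
  shows "block_inv S M = X"
  unfolding block_inv_def
proof (rule the_equality)
  show "block S S X = X \<and> block S S M ** X = proj S \<and> X ** block S S M = proj S" using X by simp
next
  fix Y assume Y: "block S S Y = Y \<and> block S S M ** Y = proj S \<and> Y ** block S S M = proj S"
  have "Y = Y ** (block S S M ** X)"
    by (subst X(2)) (use Y block_block_eq(2)[of S S Y] in simp)
  also have "\<dots> = (Y ** block S S M) ** X" by (rule matrix_mul_assoc)
  also have "\<dots> = X" using Y block_block_eq(1)[OF X(1)] by simp
  finally show "Y = X" .
qed

lemma invertible_of_left_kernel:
  fixes M :: "real^'n^'n"
  assumes "\<And>v. v v* M = 0 \<Longrightarrow> v = 0"
  obtains N where "N ** M = mat 1" "M ** N = mat 1"
proof -
  have "\<forall>x. transpose M *v x = 0 \<longrightarrow> x = 0" using assms by simp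
  then obtain B where "B ** transpose M = mat 1" using matrix_left_invertible_ker[of "transpose M"] by auto
  then have "transpose (B ** transpose M) = mat 1" by simp
  then have "M ** transpose B = mat 1" by (simp add: matrix_transpose_mul)
  then show ?thesis using that[of "transpose B"] matrix_left_right_inverse[of M "transpose B"] by simp
qed

lemma vm_entry: "(v v* M) $ j = (\<Sum>i\<in>UNIV. v $ i * M $ i $ j)" for M :: "real^'n^'m"
  by (simp add: vector_matrix_mult_def mult.commute)

lemma mv_entry: "(M *v v) $ i = (\<Sum>j\<in>UNIV. M $ i $ j * v $ j)" for M :: "real^'n^'m"
  by (simp add: matrix_vector_mult_def)

lemma inner_one: "v \<bullet> 1 = (\<Sum>i\<in>UNIV. v $ i)" for v :: "real^'n"
  by (simp add: inner_vec_def)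

text \<open>The condition \<open>active\<close> holds whenever the drift is non-zero. It excludes processes that end up in
  still phases forever, for which the block of \<open>A\<close> on the still phases is singular.\<close>
locale fluid_generator =
  fixes A :: "real^'s::finite^'s" and \<xi> c :: "real^'s"
  assumes gen: "generator A" and stat: "stationary A \<xi>"
    and active: "\<exists>k. \<xi> $ k \<noteq> 0 \<and> c $ k \<noteq> 0"
begin

lemma A_offdiag: "i \<noteq> j \<Longrightarrow> A $ i $ j \<ge> 0"
  using gen by (simp add: generator_def)

lemma A_rowsum: "(\<Sum>j\<in>UNIV. A $ i $ j) = 0"
  using gen by (simp add: generator_def)

lemma \<xi>_nonneg: "\<xi> $ i \<ge> 0" using stat by (simp add: stationary_def less_eq_vec_def)
lemma \<xi>_sum: "(\<Sum>i\<in>UNIV. \<xi> $ i) = 1" using stat by (simp add: stationary_def inner_one)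
lemma \<xi>_inv: "(\<Sum>i\<in>UNIV. \<xi> $ i * A $ i $ j) = 0"
  using stat vm_entry[of \<xi> A j] by (simp add: stationary_def)

text \<open>The vector \<open>\<xi>\<close> is unique only among normalized vectors; adding a multiple of \<open>\<xi>\<close> normalizes \<open>\<eta>\<close>.\<close>
lemma left_kernel:
  assumes "\<eta> v* A = 0"
  shows "\<eta> = (\<eta> \<bullet> 1) *\<^sub>R \<xi>"
proof -
  have u: "\<eta>' = \<xi>" if "\<eta>' v* A = 0" "\<eta>' \<bullet> 1 = 1" for \<eta>'
    using stat that by (auto simp: stationary_def)
  define \<zeta> where "\<zeta> = \<eta> + (1 - \<eta> \<bullet> 1) *\<^sub>R \<xi>"
  have "\<zeta> v* A = 0"
  proof -
    have "(\<zeta> v* A) $ j = (\<eta> v* A) $ j + (1 - \<eta> \<bullet> 1) * (\<xi> v* A) $ j" for j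
      by (simp add: vm_entry \<zeta>_def algebra_simps sum.distrib sum_distrib_left sum_subtractf)
    then show ?thesis using assms stat by (simp add: vec_eq_iff stationary_def)
  qed
  moreover have "\<zeta> \<bullet> 1 = 1" using stat by (simp add: \<zeta>_def inner_left_distrib stationary_def)
  ultimately have "\<zeta> = \<xi>" by (rule u)
  then show ?thesis by (simp add: \<zeta>_def algebra_simps)
qed

text \<open>On a closed set \<open>Z\<close> the generator annihilates the indicator of \<open>Z\<close>, so its block on \<open>Z\<close> is singular and has
  a left null vector too. Extended by zero this is a left null vector of \<open>A\<close>, thus a multiple of \<open>\<xi>\<close>.\<close>
lemma stationary_vanishes_off_closed_set:
  assumes Z: "Z \<noteq> {}" "\<And>i j. i \<in> Z \<Longrightarrow> j \<notin> Z \<Longrightarrow> A $ i $ j = 0" and i: "i \<notin> Z"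
  shows "\<xi> $ i = 0"
proof -
  define M :: "real^'s^'s" where "M = (\<chi> i j. if i \<in> Z then A $ i $ j else if i = j then 1 else 0)"
  define e :: "real^'s" where "e = (\<chi> i. if i \<in> Z then 1 else 0)"
  have "M *v e = 0"
  proof -
    have "(M *v e) $ i = 0" for i
    proof (cases "i \<in> Z")
      case True
      have "(M *v e) $ i = (\<Sum>j\<in>UNIV. A $ i $ j)"
        unfolding mv_entry using True Z(2)[OF True] by (intro sum.cong) (auto simp: M_def e_def)
      then show ?thesis by (simp add: A_rowsum)
    next
      case False
      then show ?thesis unfolding mv_entry by (intro sum.neutral) (auto simp: M_def e_def)
    qed
    then show ?thesis by (simp add: vec_eq_iff)
  qed
  moreover have "e \<noteq> 0" using Z(1) by (auto simp: vec_eq_iff e_def)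
  ultimately have "\<not> (\<exists>N. N ** M = mat 1)" using matrix_left_invertible_ker by blast
  then obtain \<eta> where \<eta>: "\<eta> v* M = 0" "\<eta> \<noteq> 0" using invertible_of_left_kernel[of M] by metis
  have \<eta>0: "\<eta> $ j = 0" if "j \<notin> Z" for j
  proof -
    have "(\<eta> v* M) $ j = (\<Sum>i\<in>UNIV. if i = j then \<eta> $ i else 0)"
      unfolding vm_entry using that by (intro sum.cong) (auto simp: M_def Z)
    then show ?thesis using \<eta> by simp
  qed
  have "(\<eta> v* A) $ j = (\<eta> v* M) $ j" for j
    unfolding vm_entry by (intro sum.cong) (auto simp: M_def \<eta>0)
  then have "\<eta> v* A = 0" using \<eta> by (simp add: vec_eq_iff)
  from left_kernel[OF this] have eq: "\<eta> = (\<eta> \<bullet> 1) *\<^sub>R \<xi>" .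
  then have "\<eta> \<bullet> 1 \<noteq> 0" using \<eta>(2) by auto
  moreover have "(\<eta> \<bullet> 1) * \<xi> $ i = 0" using \<eta>0[OF i] arg_cong[OF eq, of "\<lambda>v. v $ i"] by simp
  ultimately show ?thesis by simp
qed

lemma no_closed_still:
  assumes "Z \<subseteq> still c" "\<And>i j. i \<in> Z \<Longrightarrow> j \<notin> Z \<Longrightarrow> A $ i $ j = 0"
  shows "Z = {}"
  using stationary_vanishes_off_closed_set[of Z] assms active by (auto simp: still_def)

text \<open>The set on which a negative minimum is attained consists of still phases and cannot be left.\<close>
lemma still_minimum_principle:
  assumes v: "\<And>i. i \<notin> still c \<Longrightarrow> v $ i = 0" and Av: "\<And>i. i \<in> still c \<Longrightarrow> (A *v v) $ i \<le> 0"
  shows "v $ i \<ge> 0"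
proof (rule ccontr)
  assume neg: "\<not> v $ i \<ge> 0"
  define m where "m = Min (range (\<lambda>i. v $ i))"
  have m: "m \<le> v $ j" for j unfolding m_def by (intro Min_le) auto
  have "m < 0" using m[of i] neg by simp
  define Z where "Z = {j. v $ j = m}"
  have "m \<in> range (\<lambda>i. v $ i)" unfolding m_def by (intro Min_in) auto
  then have Zne: "Z \<noteq> {}" by (auto simp: Z_def)
  have Zs: "Z \<subseteq> still c" using v \<open>m < 0\<close> by (force simp: Z_def)
  have "A $ k $ j = 0" if k: "k \<in> Z" and j: "j \<notin> Z" for k j
  proof -
    have "(\<Sum>j\<in>UNIV. A $ k $ j * (v $ j - m)) = (A *v v) $ k"
      by (simp add: mv_entry right_diff_distrib sum_subtractf sum_distrib_right[symmetric] A_rowsum)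
    also have "\<dots> \<le> 0" using Av Zs k by auto
    finally have le: "(\<Sum>j\<in>UNIV. A $ k $ j * (v $ j - m)) \<le> 0" .
    have nn: "A $ k $ j * (v $ j - m) \<ge> 0" for j
    proof (cases "j = k")
      case True then show ?thesis using k by (simp add: Z_def)
    qed (use m[of j] A_offdiag[of k j] in auto)
    have "(\<Sum>j\<in>UNIV. A $ k $ j * (v $ j - m)) = 0" using le nn by (intro antisym sum_nonneg) auto
    then have "A $ k $ j * (v $ j - m) = 0" using nn by (subst (asm) sum_nonneg_eq_0_iff) auto
    then show ?thesis using j by (simp add: Z_def)
  qed
  from no_closed_still[OF Zs this] Zne show False by simp
qed

text \<open>The inverse \<open>(-A\<^sub>0\<^sub>0)\<^sup>-\<^sup>1\<close>; its entries are the expected times spent in a still phase before the first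
  non-still one.\<close>
definition B :: "real^'s^'s" where "B = - block_inv (still c) A"

text \<open>The block \<open>A\<^sub>0\<^sub>0\<close>, completed by the identity outside the still phases, is injective by the minimum
  principle applied to \<open>x\<close> and to \<open>- x\<close>.\<close>
lemma block_inv_still:
  "block (still c) (still c) (block_inv (still c) A) = block_inv (still c) A \<and>
   block (still c) (still c) A ** block_inv (still c) A = proj (still c) \<and>
   block_inv (still c) A ** block (still c) (still c) A = proj (still c)"
proof -
  let ?S = "still c"
  define M where "M = block ?S ?S A + proj (- ?S)"
  have inj: "x = 0" if x: "M *v x = 0" for x
  proof -
    have Mx: "(M *v x) $ i = (if i \<in> ?S then (\<Sum>j\<in>?S. A $ i $ j * x $ j) else x $ i)" for i
    proof -
      have "(M *v x) $ i = (\<Sum>j\<in>UNIV. if i \<in> ?S then (if j \<in> ?S then A $ i $ j * x $ j else 0) else (if j = i then x $ j else 0))"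
        unfolding mv_entry by (intro sum.cong) (auto simp: M_def mat_def)
      then show ?thesis by (auto simp: sum.If_cases)
    qed
    have x0: "x $ i = 0" if "i \<notin> ?S" for i using Mx[of i] that x by simp
    have Ax: "(A *v x) $ i = 0" if "i \<in> ?S" for i
    proof -
      have "(A *v x) $ i = (\<Sum>j\<in>?S. A $ i $ j * x $ j)"
        unfolding mv_entry by (rule sum.mono_neutral_right) (auto simp: x0)
      then show ?thesis using Mx[of i] that x by simp
    qed
    have "x $ i \<ge> 0" for i by (rule still_minimum_principle) (auto simp: x0 Ax)
    moreover have "(- x) $ i \<ge> 0" for i
    proof (rule still_minimum_principle)
      show "(A *v - x) $ i \<le> 0" if "i \<in> ?S" for i
        using Ax[OF that] by (simp add: mv_entry sum_negf)
    qed (auto simp: x0)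
    ultimately show ?thesis by (auto simp: vec_eq_iff intro: antisym)
  qed
  then obtain N where N: "N ** M = mat 1" using matrix_left_invertible_ker[of M] by auto
  then have N': "M ** N = mat 1" using matrix_left_right_inverse[of N M] by simp
  have PM: "proj ?S ** M = block ?S ?S A" "M ** proj ?S = block ?S ?S A"
    by (auto simp: vec_eq_iff proj_left proj_right M_def)
  have NP: "proj ?S ** N = N ** proj ?S"
  proof -
    have "proj ?S ** N = (N ** M) ** (proj ?S ** N)" by (simp add: N)
    also have "\<dots> = N ** (M ** proj ?S) ** N" by (simp add: matrix_mul_assoc)
    also have "\<dots> = N ** (proj ?S ** M) ** N" unfolding PM ..
    also have "\<dots> = N ** proj ?S ** (M ** N)" by (simp add: matrix_mul_assoc)
    also have "\<dots> = N ** proj ?S" by (simp add: N')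
    finally show ?thesis .
  qed
  define X where "X = proj ?S ** N"
  have XN: "X = N ** proj ?S" by (simp add: X_def NP)
  have X1: "proj ?S ** X = X" unfolding X_def matrix_mul_assoc proj_idem ..
  have X2: "X ** proj ?S = X" unfolding XN matrix_mul_assoc[symmetric] proj_idem ..
  have X: "block ?S ?S X = X" unfolding block_eq_proj[of ?S ?S X] X1 X2 ..
  have "block ?S ?S A ** X = M ** (proj ?S ** X)" unfolding PM(2)[symmetric] matrix_mul_assoc ..
  also have "\<dots> = (M ** N) ** proj ?S" unfolding X1 unfolding XN matrix_mul_assoc ..
  finally have 1: "block ?S ?S A ** X = proj ?S" by (simp add: N')
  have "X ** block ?S ?S A = (X ** proj ?S) ** M" unfolding PM(1)[symmetric] matrix_mul_assoc ..
  also have "\<dots> = proj ?S ** (N ** M)" unfolding X2 unfolding X_def matrix_mul_assoc ..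
  finally have 2: "X ** block ?S ?S A = proj ?S" by (simp add: N)
  show ?thesis using block_inv_eqI[OF X 1 2] X 1 2 by simp
qed

lemma block_uminus: "block S T (- X) = - block S T X"
  by (simp add: vec_eq_iff)

lemma B_block: "block (still c) (still c) B = B"
  and A_B: "block (still c) (still c) A ** B = - proj (still c)"
  and B_A: "B ** block (still c) (still c) A = - proj (still c)"
  using block_inv_still by (simp_all add: B_def block_uminus matmul.minus_left matmul.minus_right)

lemma B_zero: "i \<notin> still c \<or> j \<notin> still c \<Longrightarrow> B $ i $ j = 0"
  using B_block by (metis (no_types, lifting) block_entry)

lemma B_nonneg: "B $ i $ j \<ge> 0"
proof (cases "j \<in> still c")
  case True
  define v where "v = column j B"
  have "(A *v v) $ i = (block (still c) (still c) A ** B) $ i $ j" if "i \<in> still c" for i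
    unfolding mv_entry matrix_entry v_def using that by (intro sum.cong) (auto simp: column_def B_zero)
  then have "(A *v v) $ i \<le> 0" if "i \<in> still c" for i
    using that by (simp add: A_B mat_def)
  then have "v $ i \<ge> 0" by (intro still_minimum_principle) (auto simp: v_def column_def B_zero)
  then show ?thesis by (simp add: v_def column_def)
qed (simp add: B_zero)

text \<open>The Schur complement, in a form that needs no blocks: its still rows and columns vanish, and its
  other blocks are the matrices \<open>Q_block\<close>.\<close>
definition Q :: "real^'s^'s" where "Q = A + A ** B ** A"

lemma Q_block_eq: "Q_block A c S T = block S T Q"
proof -
  have B: "proj (still c) ** B ** proj (still c) = B"
    unfolding block_eq_proj[of "still c" "still c" B, symmetric] by (rule B_block)
  have "block S (still c) A ** (- block_inv (still c) A) ** block (still c) T A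
      = proj S ** (A ** (proj (still c) ** B ** proj (still c)) ** A) ** proj T"
    unfolding block_eq_proj[of S "still c" A] block_eq_proj[of "still c" T A] B_def[symmetric]
    by (simp only: matrix_mul_assoc)
  then show ?thesis unfolding Q_block_def Q_def B block_eq_proj[of S T A]
    block_eq_proj[of S T "A + A ** B ** A"] by (simp only: matmul.add_left matmul.add_right)
qed

lemma Q_still_row: "i \<in> still c \<Longrightarrow> Q $ i $ j = 0"
proof -
  assume i: "i \<in> still c"
  have "(A ** B) $ i $ k = (block (still c) (still c) A ** B) $ i $ k" for k
    unfolding matrix_entry using i by (intro sum.cong) (auto simp: B_zero)
  then have *: "(A ** B) $ i $ k = - (if i = k then 1 else 0)" for k
    using i by (auto simp: A_B mat_def)
  have "(A ** B ** A) $ i $ j = (\<Sum>k\<in>UNIV. if k = i then - A $ k $ j else 0)"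
    unfolding matrix_entry[of "A ** B"] * by (intro sum.cong) auto
  then show ?thesis by (simp add: Q_def)
qed

lemma Q_still_col: "j \<in> still c \<Longrightarrow> Q $ i $ j = 0"
proof -
  assume j: "j \<in> still c"
  have "(B ** A) $ k $ j = (B ** block (still c) (still c) A) $ k $ j" for k
    unfolding matrix_entry using j by (intro sum.cong) (auto simp: B_zero)
  then have *: "(B ** A) $ k $ j = - (if j = k then 1 else 0)" for k
    using j by (auto simp: B_A mat_def)
  have "(A ** (B ** A)) $ i $ j = (\<Sum>k\<in>UNIV. if k = j then - A $ i $ k else 0)"
    unfolding matrix_entry[of A] * by (intro sum.cong) auto
  then show ?thesis by (simp add: Q_def matrix_mul_assoc)
qed

lemma Q_offdiag: "i \<noteq> j \<Longrightarrow> Q $ i $ j \<ge> 0"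
proof -
  assume ij: "i \<noteq> j"
  consider "i \<in> still c" | "j \<in> still c" | "i \<notin> still c" "j \<notin> still c" by auto
  then show ?thesis
  proof cases
    case 3
    have "(A ** B) $ i $ k \<ge> 0" for k
      unfolding matrix_entry using 3 B_nonneg A_offdiag B_zero
      by (intro sum_nonneg) (metis mult_nonneg_nonneg mult_zero_right order_refl)
    moreover have "(A ** B) $ i $ k = 0" if "k \<notin> still c" for k
      unfolding matrix_entry using that by (intro sum.neutral) (auto simp: B_zero)
    ultimately have "(A ** B ** A) $ i $ j \<ge> 0"
      unfolding matrix_entry[of "A ** B"] using 3 A_offdiag
      by (intro sum_nonneg) (metis mult_nonneg_nonneg mult_zero_left order_refl)
    then show ?thesis using A_offdiag[OF ij] by (simp add: Q_def)
  qed (auto simp: Q_still_row Q_still_col)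
qed

lemma Q_rowsum: "(\<Sum>j\<in>UNIV. Q $ i $ j) = 0"
proof -
  have "A *v 1 = 0" by (simp add: vec_eq_iff mv_entry A_rowsum)
  then have "Q *v 1 = 0"
    by (simp add: Q_def matrix_vector_mult_add_rdistrib matrix_vector_mul_assoc[symmetric])
  then show ?thesis by (simp add: vec_eq_iff mv_entry)
qed

text \<open>Solutions of \<open>c $ i * f' y i + (\<Sum>j. A $ i $ j * f y j) = 0\<close> satisfy \<open>f' = H f\<close> on the phases with non-zero
  rate, and \<open>N\<close> determines their values on the still phases. Still rows of \<open>H\<close> are zero: there both
  the row of \<open>Q\<close> and the value of the division vanish.\<close>
definition H :: "real^'s^'s" where "H = (\<chi> i j. - Q $ i $ j / c $ i)"
definition N :: "real^'s^'s" where "N = mat 1 + B ** A"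

lemma A_N: "A ** N = Q"
  by (simp add: N_def Q_def matmul.add_right matrix_mul_assoc)

lemma N_nonstill: "i \<notin> still c \<Longrightarrow> (N ** X) $ i $ j = X $ i $ j" for X :: "real^'s^'s"
  by (simp add: N_def matmul.add_left matrix_mul_assoc[symmetric]) (simp add: matrix_entry B_zero)

text \<open>Both terms are rows of \<open>Q ** X\<close>: since \<open>A ** N = Q\<close>, the second is one, and in a non-still phase the
  definition of \<open>H\<close> makes the first its negative. In a still phase the row vanishes.\<close>
lemma harmonic: "c $ i * (N ** (H ** X)) $ i $ j + (A ** (N ** X)) $ i $ j = 0" for X :: "real^'s^'s"
proof (cases "i \<in> still c")
  case True
  have "(Q ** X) $ i $ j = 0" using True by (simp add: matrix_entry Q_still_row)
  then show ?thesis using True by (simp add: matrix_mul_assoc A_N still_def)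
next
  case False
  then have "c $ i \<noteq> 0" by (simp add: still_def)
  then have "c $ i * (H ** X) $ i $ j = - (Q ** X) $ i $ j"
    by (simp add: matrix_entry H_def sum_distrib_left sum_negf)
  then show ?thesis using False by (simp add: N_nonstill matrix_mul_assoc A_N) (simp add: N_nonstill matrix_mul_assoc[symmetric])
qed

text \<open>The matrix \<open>A - 1 \<xi>\<^sup>T\<close> is invertible, and for right-hand sides orthogonal to \<open>\<xi>\<close> the rank-one term
  disappears from the solution.\<close>
lemma poisson_equation:
  assumes g: "(\<Sum>i\<in>UNIV. \<xi> $ i * g i) = 0"
  obtains u where "\<And>i. (\<Sum>j\<in>UNIV. A $ i $ j * u j) = g i"
proof -
  define M :: "real^'s^'s" where "M = (\<chi> i j. A $ i $ j - \<xi> $ j)"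
  have "\<eta> = 0" if \<eta>: "\<eta> v* M = 0" for \<eta>
  proof -
    have 1: "(\<Sum>i\<in>UNIV. \<eta> $ i * A $ i $ j) = (\<eta> \<bullet> 1) * \<xi> $ j" for j
      using arg_cong[OF \<eta>, of "\<lambda>v. v $ j"]
      by (simp add: vm_entry M_def right_diff_distrib sum_subtractf inner_one sum_distrib_right)
    have "(\<eta> \<bullet> 1) = (\<Sum>j\<in>UNIV. \<Sum>i\<in>UNIV. \<eta> $ i * A $ i $ j)"
      unfolding 1 by (simp add: sum_distrib_left[symmetric] \<xi>_sum)
    also have "\<dots> = (\<Sum>i\<in>UNIV. \<eta> $ i * (\<Sum>j\<in>UNIV. A $ i $ j))"
      by (subst sum.swap) (simp add: sum_distrib_left)
    finally have 2: "\<eta> \<bullet> 1 = 0" by (simp add: A_rowsum)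
    with 1 have "\<eta> v* A = 0" by (simp add: vec_eq_iff vm_entry)
    from left_kernel[OF this] 2 show ?thesis by simp
  qed
  then obtain N' where N': "M ** N' = mat 1" using invertible_of_left_kernel[of M] by metis
  define u where "u = N' *v (\<chi> i. g i)"
  have "M *v u = (\<chi> i. g i)" by (simp add: u_def matrix_vector_mul_assoc N')
  then have Mu: "(\<Sum>j\<in>UNIV. A $ i $ j * u $ j) - (\<Sum>j\<in>UNIV. \<xi> $ j * u $ j) = g i" for i
    by (simp add: vec_eq_iff mv_entry M_def left_diff_distrib sum_subtractf)
  define s where "s = (\<Sum>j\<in>UNIV. \<xi> $ j * u $ j)"
  have "0 = (\<Sum>i\<in>UNIV. \<xi> $ i * ((\<Sum>j\<in>UNIV. A $ i $ j * u $ j) - s))"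
    using g Mu by (simp add: s_def)
  also have "\<dots> = (\<Sum>i\<in>UNIV. \<Sum>j\<in>UNIV. \<xi> $ i * A $ i $ j * u $ j) - s"
    by (simp add: right_diff_distrib sum_subtractf sum_distrib_left mult.assoc)
       (simp add: sum_distrib_right[symmetric] \<xi>_sum)
  also have "(\<Sum>i\<in>UNIV. \<Sum>j\<in>UNIV. \<xi> $ i * A $ i $ j * u $ j) = (\<Sum>j\<in>UNIV. (\<Sum>i\<in>UNIV. \<xi> $ i * A $ i $ j) * u $ j)"
    by (subst sum.swap) (simp add: sum_distrib_right)
  finally have "s = 0" by (simp add: \<xi>_inv)
  then show ?thesis using that[of "\<lambda>i. u $ i"] Mu by (simp add: s_def)
qed

definition \<mu> :: real where "\<mu> = (\<Sum>i\<in>UNIV. \<xi> $ i * c $ i)"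

text \<open>Equivalently, the generator of level and phase maps the function \<open>y + u i\<close> to the constant \<open>\<mu>\<close>.\<close>
lemma drift_equation:
  obtains u where "\<And>i. c $ i + (\<Sum>j\<in>UNIV. A $ i $ j * u j) = \<mu>"
proof -
  have "(\<Sum>i\<in>UNIV. \<xi> $ i * (\<mu> - c $ i)) = 0"
    by (simp add: right_diff_distrib sum_subtractf sum_distrib_right[symmetric] \<xi>_sum \<mu>_def)
  from poisson_equation[OF this] obtain u where "\<And>i. (\<Sum>j\<in>UNIV. A $ i $ j * u j) = \<mu> - c $ i" by blast
  then show ?thesis using that[of u] by simp
qed

text \<open>Twice the sum is \<open>\<Sum>i j. \<xi> $ i * A $ i $ j * (u i - u j)\<^sup>2\<close>. If this vanished, \<open>u\<close> would be
  constant along all transitions from a phase \<open>k\<close> with \<open>\<xi> $ k \<noteq> 0\<close>, and its equation would force \<open>c $ k = 0\<close>.\<close>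
lemma variance_positive:
  assumes u: "\<And>i. c $ i + (\<Sum>j\<in>UNIV. A $ i $ j * u j) = 0"
  shows "(\<Sum>i\<in>UNIV. \<xi> $ i * (c $ i * u i)) > 0"
proof -
  let ?\<sigma> = "\<Sum>i\<in>UNIV. \<xi> $ i * (c $ i * u i)"
  have c: "c $ i = - (\<Sum>j\<in>UNIV. A $ i $ j * u j)" for i using u[of i] by simp
  have "(\<Sum>i\<in>UNIV. \<Sum>j\<in>UNIV. \<xi> $ i * A $ i $ j * (u i - u j)\<^sup>2) =
      (\<Sum>i\<in>UNIV. \<xi> $ i * (u i)\<^sup>2 * (\<Sum>j\<in>UNIV. A $ i $ j))
      - 2 * (\<Sum>i\<in>UNIV. \<xi> $ i * (u i * (\<Sum>j\<in>UNIV. A $ i $ j * u j)))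
      + (\<Sum>i\<in>UNIV. \<Sum>j\<in>UNIV. \<xi> $ i * A $ i $ j * (u j)\<^sup>2)"
  proof -
    have "\<xi> $ i * A $ i $ j * (u i - u j)\<^sup>2 = \<xi> $ i * (u i)\<^sup>2 * A $ i $ j
        - 2 * (\<xi> $ i * (u i * (A $ i $ j * u j))) + \<xi> $ i * A $ i $ j * (u j)\<^sup>2" for i j
      by (simp add: power2_diff algebra_simps)
    then show ?thesis by (simp add: sum.distrib sum_subtractf sum_distrib_left)
  qed
  also have "(\<Sum>i\<in>UNIV. \<Sum>j\<in>UNIV. \<xi> $ i * A $ i $ j * (u j)\<^sup>2) =
      (\<Sum>j\<in>UNIV. (\<Sum>i\<in>UNIV. \<xi> $ i * A $ i $ j) * (u j)\<^sup>2)"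
    by (subst sum.swap) (simp add: sum_distrib_right)
  finally have eq: "(\<Sum>i\<in>UNIV. \<Sum>j\<in>UNIV. \<xi> $ i * A $ i $ j * (u i - u j)\<^sup>2) = 2 * ?\<sigma>"
    by (simp add: A_rowsum \<xi>_inv c sum_negf mult.commute)
  have nn: "\<xi> $ i * A $ i $ j * (u i - u j)\<^sup>2 \<ge> 0" for i j
    using A_offdiag[of i j] \<xi>_nonneg[of i] by (cases "i = j") (auto intro!: mult_nonneg_nonneg)
  have "(\<Sum>i\<in>UNIV. \<Sum>j\<in>UNIV. \<xi> $ i * A $ i $ j * (u i - u j)\<^sup>2) \<ge> 0"
    by (intro sum_nonneg nn)
  then have ge: "?\<sigma> \<ge> 0" using eq by linarith
  have "?\<sigma> \<noteq> 0"
  proof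
    assume "?\<sigma> = 0"
    then have z: "\<xi> $ i * A $ i $ j * (u i - u j)\<^sup>2 = 0" for i j
    proof -
      have "(\<Sum>i\<in>UNIV. \<Sum>j\<in>UNIV. \<xi> $ i * A $ i $ j * (u i - u j)\<^sup>2) = 0"
        using eq \<open>?\<sigma> = 0\<close> by linarith
      then have "(\<Sum>j\<in>UNIV. \<xi> $ i * A $ i $ j * (u i - u j)\<^sup>2) = 0"
        by (subst (asm) sum_nonneg_eq_0_iff) (auto intro: sum_nonneg nn)
      then show ?thesis using nn by (subst (asm) sum_nonneg_eq_0_iff) auto
    qed
    obtain k where k: "\<xi> $ k \<noteq> 0" "c $ k \<noteq> 0" using active by blast
    have "(\<Sum>j\<in>UNIV. A $ k $ j * u j) = (\<Sum>j\<in>UNIV. A $ k $ j * u k)"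
      using z[of k] k by (intro sum.cong) (auto, metis)
    also have "\<dots> = 0" by (simp add: sum_distrib_right[symmetric] A_rowsum)
    finally show False using c[of k] k by simp
  qed
  then show ?thesis using ge by simp
qed

text \<open>If \<open>\<mu> \<noteq> 0\<close> the function can be chosen affine in the level. If \<open>\<mu> = 0\<close> it has to be quadratic, and
  the positive constant \<open>\<sigma>\<close> of the previous lemma plays the role of the drift.\<close>
lemma lyapunov_function:
  obtains f f1 f2 :: "real \<Rightarrow> 's \<Rightarrow> real" where
    "\<And>i y. ((\<lambda>y. f y i) has_real_derivative f1 y i) (at y)"
    "\<And>i y. ((\<lambda>y. f1 y i) has_real_derivative f2 y i) (at y)"
    "\<And>i. continuous_on UNIV (\<lambda>y. f2 y i)"
    "\<And>i y. c $ i * f1 y i + (\<Sum>j\<in>UNIV. A $ i $ j * f y j) = 1"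
proof -
  obtain u where u: "\<And>i. c $ i + (\<Sum>j\<in>UNIV. A $ i $ j * u j) = \<mu>" using drift_equation by blast
  show ?thesis
  proof (cases "\<mu> = 0")
    case False
    show ?thesis
    proof (rule that[of "\<lambda>y i. (y + u i) / \<mu>" "\<lambda>y i. 1 / \<mu>" "\<lambda>y i. 0"])
      fix i y
      have "(\<Sum>j\<in>UNIV. A $ i $ j * ((y + u j) / \<mu>)) =
          ((\<Sum>j\<in>UNIV. A $ i $ j) * y + (\<Sum>j\<in>UNIV. A $ i $ j * u j)) / \<mu>"
      proof -
        have "A $ i $ j * ((y + u j) / \<mu>) = (A $ i $ j * y + A $ i $ j * u j) / \<mu>" for j
          by (simp add: algebra_simps)
        then show ?thesis
          by (simp only: sum_divide_distrib[symmetric] sum.distrib sum_distrib_right[symmetric])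
      qed
      then show "c $ i * (1 / \<mu>) + (\<Sum>j\<in>UNIV. A $ i $ j * ((y + u j) / \<mu>)) = 1"
        using u[of i] False by (simp add: A_rowsum add_divide_distrib[symmetric])
    qed (use False in \<open>auto intro!: derivative_eq_intros continuous_intros\<close>)
  next
    case True
    define \<sigma> where "\<sigma> = (\<Sum>i\<in>UNIV. \<xi> $ i * (c $ i * u i))"
    have "\<sigma> > 0" unfolding \<sigma>_def by (rule variance_positive) (simp add: u True)
    have "(\<Sum>i\<in>UNIV. \<xi> $ i * (\<sigma> - c $ i * u i)) = 0"
      by (simp add: right_diff_distrib sum_subtractf sum_distrib_right[symmetric] \<xi>_sum \<sigma>_def)
    from poisson_equation[OF this] obtain w
      where w: "\<And>i. (\<Sum>j\<in>UNIV. A $ i $ j * w j) = \<sigma> - c $ i * u i" by blast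
    show ?thesis
    proof (rule that[of "\<lambda>y i. (y\<^sup>2 / 2 + y * u i + w i) / \<sigma>" "\<lambda>y i. (y + u i) / \<sigma>" "\<lambda>y i. 1 / \<sigma>"])
      fix i y
      have "(\<Sum>j\<in>UNIV. A $ i $ j * ((y\<^sup>2 / 2 + y * u j + w j) / \<sigma>)) =
          ((\<Sum>j\<in>UNIV. A $ i $ j) * (y\<^sup>2 / 2) + y * (\<Sum>j\<in>UNIV. A $ i $ j * u j) + (\<Sum>j\<in>UNIV. A $ i $ j * w j)) / \<sigma>"
      proof -
        have "A $ i $ j * ((y\<^sup>2 / 2 + y * u j + w j) / \<sigma>) =
            (A $ i $ j * (y\<^sup>2 / 2) + y * (A $ i $ j * u j) + A $ i $ j * w j) / \<sigma>" for j
          by (simp add: algebra_simps)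
        then show ?thesis
          by (simp only: sum_divide_distrib[symmetric] sum.distrib sum_distrib_right[symmetric] sum_distrib_left[symmetric])
      qed
      also have "\<dots> = (y * (- c $ i) + (\<sigma> - c $ i * u i)) / \<sigma>"
      proof -
        have "(\<Sum>j\<in>UNIV. A $ i $ j * u j) = - c $ i" using u[of i] True by simp
        then show ?thesis by (simp add: A_rowsum w)
      qed
      finally show "c $ i * ((y + u i) / \<sigma>) + (\<Sum>j\<in>UNIV. A $ i $ j * ((y\<^sup>2 / 2 + y * u j + w j) / \<sigma>)) = 1"
        using \<open>\<sigma> > 0\<close> by (simp add: field_simps)
    qed (use \<open>\<sigma> > 0\<close> in \<open>auto intro!: derivative_eq_intros continuous_intros simp: field_simps\<close>)
  qed
qed

end

section \<open>The Markov property relative to the past\<close>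

lemma measurable_discrete_limit:
  fixes f :: "'a \<Rightarrow> 'b::finite"
  assumes g [measurable]: "\<And>n. g n \<in> N \<rightarrow>\<^sub>M count_space UNIV"
    and lim: "\<And>p. p \<in> space N \<Longrightarrow> \<exists>K::nat. \<forall>n\<ge>K. g n p = f p"
  shows "f \<in> N \<rightarrow>\<^sub>M count_space UNIV"
proof -
  have "f -` {a} \<inter> space N \<in> sets N" for a
  proof -
    have "f -` {a} \<inter> space N = {p \<in> space N. \<exists>K. \<forall>n\<ge>K. g n p = a}"
    proof (intro set_eqI iffI)
      fix p assume p: "p \<in> {p \<in> space N. \<exists>K. \<forall>n\<ge>K. g n p = a}"
      then obtain K1 where K1: "\<And>n. n \<ge> K1 \<Longrightarrow> g n p = a" by blast
      from p lim obtain K2 where K2: "\<And>n. n \<ge> K2 \<Longrightarrow> g n p = f p" by blast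
      have "f p = a" using K1[of "max K1 K2"] K2[of "max K1 K2"] by simp
      with p show "p \<in> f -` {a} \<inter> space N" by simp
    qed (use lim in auto)
    also have "\<dots> \<in> sets N" by measurable
    finally show ?thesis .
  qed
  then show ?thesis by (simp add: measurable_count_space_eq2)
qed

locale fluid_process =
  fixes M :: "'w measure" and \<phi> :: "real \<Rightarrow> 'w \<Rightarrow> 's::finite" and A :: "real^'s^'s" and c :: "real^'s"
  assumes chain: "markov_chain M \<phi> A"
begin

sublocale prob_space M
  using chain by (simp add: markov_chain_def)

lemma phase_measurable [measurable]: "t \<ge> 0 \<Longrightarrow> \<phi> t \<in> M \<rightarrow>\<^sub>M count_space UNIV"
  using chain by (simp add: markov_chain_def)

lemma right_continuous:
  "\<omega> \<in> space M \<Longrightarrow> t \<ge> 0 \<Longrightarrow> \<exists>\<delta>>0. \<forall>s\<in>{t..<t + \<delta>}. \<phi> s \<omega> = \<phi> t \<omega>"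
  using chain unfolding markov_chain_def by blast

lemma finite_dim_markov:
  fixes n :: nat and t :: "nat \<Rightarrow> real"
  assumes "0 \<le> t 0" "\<And>k. k \<le> n \<Longrightarrow> t k \<le> t (Suc k)"
  shows "measure M {\<omega>\<in>space M. \<forall>k\<le>Suc n. \<phi> (t k) \<omega> = x k} =
         measure M {\<omega>\<in>space M. \<forall>k\<le>n. \<phi> (t k) \<omega> = x k} * mat_exp ((t (Suc n) - t n) *\<^sub>R A) $ x n $ x (Suc n)"
  using chain assms unfolding markov_chain_def by blast

definition cyl :: "real set \<Rightarrow> (real \<Rightarrow> 's) \<Rightarrow> 'w set" where
  "cyl F x = {\<omega>\<in>space M. \<forall>r\<in>F. \<phi> r \<omega> = x r}"

text \<open>Cylinders prescribe exact phases at finitely many times, so the intersection of two of them is a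
  cylinder or empty.\<close>
definition past_events :: "real \<Rightarrow> 'w set set" where
  "past_events s = insert {} {cyl F x | F x. finite F \<and> F \<subseteq> {0..s}}"

definition past :: "real \<Rightarrow> 'w measure" where
  "past s = sigma (space M) (past_events s)"

lemma past_events_Pow: "past_events s \<subseteq> Pow (space M)"
  by (auto simp: past_events_def cyl_def)

lemma space_past [simp]: "space (past s) = space M"
  unfolding past_def by (rule space_measure_of) (rule past_events_Pow)

lemma sets_past: "sets (past s) = sigma_sets (space M) (past_events s)"
  unfolding past_def by (rule sets_measure_of) (rule past_events_Pow)

lemma past_events_sets: "past_events s \<subseteq> sets M"
proof -
  have "cyl F x \<in> sets M" if "finite F" "F \<subseteq> {0..s}" for F x
  proof -
    have "cyl F x = space M \<inter> (\<Inter>r\<in>F. {\<omega>\<in>space M. \<phi> r \<omega> = x r})" by (auto simp: cyl_def)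
    moreover have "{\<omega>\<in>space M. \<phi> r \<omega> = x r} \<in> sets M" if "r \<in> F" for r
    proof -
      have [measurable]: "\<phi> r \<in> M \<rightarrow>\<^sub>M count_space UNIV" using that \<open>F \<subseteq> {0..s}\<close> by (intro phase_measurable) auto
      show ?thesis by measurable
    qed
    ultimately show ?thesis using that(1) by (cases "F = {}") (auto intro!: sets.Int sets.finite_INT)
  qed
  then show ?thesis by (auto simp: past_events_def)
qed

lemma subalgebra_past: "subalgebra M (past s)"
  unfolding subalgebra_def sets_past using sets.sigma_sets_subset[OF past_events_sets] by simp

sublocale past: finite_measure_subalgebra M "past s" for s
  by unfold_locales (rule subalgebra_past)

lemma past_sets: "B \<in> sets (past s) \<Longrightarrow> B \<in> sets M"
  using subalgebra_past[of s] by (auto simp: subalgebra_def)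

lemma phase_past [measurable]:
  assumes "0 \<le> r" "r \<le> s" shows "\<phi> r \<in> past s \<rightarrow>\<^sub>M count_space UNIV"
proof -
  have "\<phi> r -` {a} \<inter> space (past s) \<in> sets (past s)" for a
  proof -
    have "\<phi> r -` {a} \<inter> space (past s) = cyl {r} (\<lambda>_. a)" by (auto simp: cyl_def)
    moreover have "cyl {r} (\<lambda>_. a) \<in> past_events s"
      unfolding past_events_def using assms by (intro insertI2 CollectI exI[of _ "{r}"] exI[of _ "\<lambda>_. a"]) auto
    ultimately show ?thesis unfolding sets_past by (simp add: sigma_sets.Basic)
  qed
  then show ?thesis by (simp add: measurable_count_space_eq2)
qed

lemma Int_stable_past_events: "Int_stable (past_events s)"
proof (rule Int_stableI)
  fix a b assume a: "a \<in> past_events s" and b: "b \<in> past_events s"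
  show "a \<inter> b \<in> past_events s"
  proof (cases "a \<inter> b = {}")
    case False
    then obtain F x G y where ab: "a = cyl F x" "b = cyl G y" "finite F" "finite G" "F \<subseteq> {0..s}" "G \<subseteq> {0..s}"
      using a b by (auto simp: past_events_def)
    obtain \<omega> where \<omega>: "\<omega> \<in> a" "\<omega> \<in> b" using False by blast
    have "a \<inter> b = cyl (F \<union> G) (\<lambda>r. \<phi> r \<omega>)"
      using \<omega> ab by (auto simp: cyl_def)
    then show ?thesis unfolding past_events_def using ab by blast
  qed (simp add: past_events_def)
qed

text \<open>The Markov property of the chain is about increasing lists of times. So \<open>s\<close> is added to the times of
  the cylinder, which are then sorted; the last one is \<open>s\<close>.\<close>
lemma cylinder_markov:
  assumes F: "finite F" "F \<subseteq> {0..s}" and s: "s \<ge> 0" "h \<ge> 0"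
  shows "measure M (cyl F x \<inter> {\<omega>\<in>space M. \<phi> s \<omega> = i \<and> \<phi> (s + h) \<omega> = j}) =
    measure M (cyl F x \<inter> {\<omega>\<in>space M. \<phi> s \<omega> = i}) * mat_exp (h *\<^sub>R A) $ i $ j"
proof (cases "s \<in> F \<and> x s \<noteq> i")
  case True
  then have "cyl F x \<inter> {\<omega>\<in>space M. \<phi> s \<omega> = i} = {}"
    "cyl F x \<inter> {\<omega>\<in>space M. \<phi> s \<omega> = i \<and> \<phi> (s + h) \<omega> = j} = {}"
    by (auto simp: cyl_def)
  then show ?thesis by simp
next
  case False
  define G where "G = insert s F"
  define y where "y = x(s := i)"
  define L where "L = sorted_list_of_set G"
  define n where "n = length L - 1"
  have finG: "finite G" using F by (simp add: G_def)
  have setL: "set L = G" and sorted: "sorted L" using finG by (auto simp: L_def)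
  have Lne: "L \<noteq> []" using setL by (auto simp: G_def)
  then have len: "length L = Suc n" by (simp add: n_def)
  have Gs: "G \<subseteq> {0..s}" using F s by (auto simp: G_def)
  obtain p where p: "p < length L" "L ! p = s" using setL by (metis G_def in_set_conv_nth insertI1)
  have "L ! n \<ge> s" using sorted_nth_mono[OF sorted, of p n] p len by auto
  moreover have "L ! n \<in> G" using len setL nth_mem[of n L] by simp
  ultimately have Ln: "L ! n = s" using Gs by force
  define t where "t k = (if k \<le> n then L ! k else s + h)" for k
  define z where "z k = (if k \<le> n then y (L ! k) else j)" for k
  have "t 0 \<in> G" using len setL nth_mem[of 0 L] by (simp add: t_def)
  then have t0: "0 \<le> t 0" using Gs by auto
  have mono: "t k \<le> t (Suc k)" if "k \<le> n" for k
  proof (cases "Suc k \<le> n")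
    case True then show ?thesis using sorted_nth_mono[OF sorted, of k "Suc k"] len by (simp add: t_def)
  next
    case False then have "k = n" using that by simp
    then show ?thesis using Ln s by (simp add: t_def)
  qed
  have G_iff: "(\<forall>k\<le>n. \<phi> (t k) \<omega> = z k) \<longleftrightarrow> (\<forall>r\<in>G. \<phi> r \<omega> = y r)" for \<omega>
    unfolding setL[symmetric] all_set_conv_all_nth len by (auto simp: t_def z_def less_Suc_eq_le)
  have G_iff': "(\<forall>r\<in>G. \<phi> r \<omega> = y r) \<longleftrightarrow> (\<forall>r\<in>F. \<phi> r \<omega> = x r) \<and> \<phi> s \<omega> = i" for \<omega>
    using False by (auto simp: G_def y_def)
  have 1: "{\<omega>\<in>space M. \<forall>k\<le>n. \<phi> (t k) \<omega> = z k} = cyl F x \<inter> {\<omega>\<in>space M. \<phi> s \<omega> = i}"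
    unfolding G_iff G_iff' by (auto simp: cyl_def)
  have Suc_iff: "(\<forall>k\<le>Suc n. \<phi> (t k) \<omega> = z k) \<longleftrightarrow> (\<forall>k\<le>n. \<phi> (t k) \<omega> = z k) \<and> \<phi> (s + h) \<omega> = j" for \<omega>
    by (auto simp: le_Suc_eq t_def z_def)
  have 2: "{\<omega>\<in>space M. \<forall>k\<le>Suc n. \<phi> (t k) \<omega> = z k} = cyl F x \<inter> {\<omega>\<in>space M. \<phi> s \<omega> = i \<and> \<phi> (s + h) \<omega> = j}"
    unfolding Suc_iff G_iff G_iff' by (auto simp: cyl_def)
  have "t (Suc n) - t n = h" "z n = i" "z (Suc n) = j" using Ln by (auto simp: t_def z_def y_def)
  then show ?thesis using finite_dim_markov[of t n z, OF t0 mono] unfolding 1 2 by simp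
qed

lemma phase_sets [measurable]: "r \<ge> 0 \<Longrightarrow> {\<omega>\<in>space M. \<phi> r \<omega> = i} \<in> sets M"
  by measurable

lemma phase2_sets: "r \<ge> 0 \<Longrightarrow> u \<ge> 0 \<Longrightarrow> {\<omega>\<in>space M. \<phi> r \<omega> = i \<and> \<phi> u \<omega> = j} \<in> sets M"
  by measurable

lemma past_markov:
  assumes s: "s \<ge> 0" "h \<ge> 0" and B: "B \<in> sets (past s)"
  shows "measure M (B \<inter> {\<omega>\<in>space M. \<phi> s \<omega> = i \<and> \<phi> (s + h) \<omega> = j}) =
    measure M (B \<inter> {\<omega>\<in>space M. \<phi> s \<omega> = i}) * mat_exp (h *\<^sub>R A) $ i $ j"
proof -
  let ?D = "{\<omega>\<in>space M. \<phi> s \<omega> = i \<and> \<phi> (s + h) \<omega> = j}" and ?E = "{\<omega>\<in>space M. \<phi> s \<omega> = i}"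
  have DE [measurable]: "?D \<in> sets M" "?E \<in> sets M" using s by (auto intro: phase_sets phase2_sets)
  from B have "B \<in> sigma_sets (space M) (past_events s)" by (simp add: sets_past)
  from Int_stable_past_events past_events_Pow this show ?thesis
  proof (induction rule: sigma_sets_induct_disjoint)
    case (basic B)
    show ?case
    proof (cases "B = {}")
      case False
      then obtain F x where "B = cyl F x" "finite F" "F \<subseteq> {0..s}" using basic by (auto simp: past_events_def)
      then show ?thesis using cylinder_markov s by blast
    qed simp
  next
    case empty show ?case by simp
  next
    case (compl B)
    have [measurable]: "B \<in> sets M" using compl(1) past_sets by (simp add: sets_past)
    have minus: "measure M ((space M - B) \<inter> E) = measure M E - measure M (B \<inter> E)" if E: "E \<in> sets M" for E
    proof -
      have "(space M - B) \<inter> E = E - B \<inter> E" using sets.sets_into_space[OF E] by auto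
      then show ?thesis using finite_measure_Diff[of E "B \<inter> E"] E by simp
    qed
    have D: "measure M ?D = measure M ?E * mat_exp (h *\<^sub>R A) $ i $ j"
    proof -
      have "cyl {} undefined = space M" by (simp add: cyl_def)
      moreover have "space M \<inter> ?D = ?D" "space M \<inter> ?E = ?E" by auto
      ultimately show ?thesis using cylinder_markov[of "{}" s h undefined i j] s by simp
    qed
    show ?case unfolding minus[OF DE(1)] minus[OF DE(2)] compl(2) D by (simp add: left_diff_distrib)
  next
    case (union B)
    have [measurable]: "B k \<in> sets M" for k using union(2) past_sets by (auto simp: sets_past)
    have "(\<lambda>k. measure M (B k \<inter> ?D)) sums measure M (\<Union>k. B k \<inter> ?D)"
      by (rule finite_measure_UNION) (use union(1) in \<open>auto simp: disjoint_family_on_def\<close>)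
    moreover have "(\<lambda>k. measure M (B k \<inter> ?E)) sums measure M (\<Union>k. B k \<inter> ?E)"
      by (rule finite_measure_UNION) (use union(1) in \<open>auto simp: disjoint_family_on_def\<close>)
    then have "(\<lambda>k. measure M (B k \<inter> ?E) * mat_exp (h *\<^sub>R A) $ i $ j) sums (measure M (\<Union>k. B k \<inter> ?E) * mat_exp (h *\<^sub>R A) $ i $ j)"
      by (rule sums_mult2)
    ultimately have "measure M (\<Union>k. B k \<inter> ?D) = measure M (\<Union>k. B k \<inter> ?E) * mat_exp (h *\<^sub>R A) $ i $ j"
      unfolding union(3) by (rule sums_unique2)
    moreover have "(\<Union>k. B k \<inter> ?D) = (\<Union>k. B k) \<inter> ?D" "(\<Union>k. B k \<inter> ?E) = (\<Union>k. B k) \<inter> ?E" by auto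
    ultimately show ?case by simp
  qed
qed

text \<open>The set version identifies the conditional probability, given the past, of being in \<open>i\<close> at time \<open>s\<close> and in
  \<open>j\<close> at time \<open>s + h\<close>.\<close>
lemma past_markov_integral:
  fixes G :: "'w \<Rightarrow> real"
  assumes s: "s \<ge> 0" "h \<ge> 0" and G [measurable]: "G \<in> borel_measurable (past s)"
    and bound: "\<And>\<omega>. \<omega> \<in> space M \<Longrightarrow> \<bar>G \<omega>\<bar> \<le> K"
  shows "(\<integral>\<omega>. G \<omega> * indicator {\<omega>\<in>space M. \<phi> s \<omega> = i \<and> \<phi> (s + h) \<omega> = j} \<omega> \<partial>M) =
    mat_exp (h *\<^sub>R A) $ i $ j * (\<integral>\<omega>. G \<omega> * indicator {\<omega>\<in>space M. \<phi> s \<omega> = i} \<omega> \<partial>M)"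
proof -
  let ?D = "{\<omega>\<in>space M. \<phi> s \<omega> = i \<and> \<phi> (s + h) \<omega> = j}" and ?E = "{\<omega>\<in>space M. \<phi> s \<omega> = i}"
  let ?p = "mat_exp (h *\<^sub>R A) $ i $ j"
  have DE [measurable]: "?D \<in> sets M" "?E \<in> sets M" using s by (auto intro: phase_sets phase2_sets)
  have E' [measurable]: "?E \<in> sets (past s)"
  proof -
    have [measurable]: "\<phi> s \<in> past s \<rightarrow>\<^sub>M count_space UNIV" using s by (intro phase_past) auto
    have "{\<omega>\<in>space (past s). \<phi> s \<omega> = i} \<in> sets (past s)" by measurable
    then show ?thesis by simp
  qed
  have GM [measurable]: "G \<in> borel_measurable M" using measurable_from_subalg[OF subalgebra_past G] .
  have ce: "AE \<omega> in M. real_cond_exp M (past s) (indicator ?D) \<omega> = ?p * indicator ?E \<omega>"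
  proof (rule past.real_cond_exp_charact)
    fix B assume B: "B \<in> sets (past s)"
    then have [measurable]: "B \<in> sets M" by (rule past_sets)
    have e1: "(\<integral>\<omega>\<in>B. indicator ?D \<omega> \<partial>M) = measure M (B \<inter> ?D)"
      by (simp add: set_lebesgue_integral_def indicator_inter_arith[symmetric])
    have e2: "(\<integral>\<omega>\<in>B. ?p * indicator ?E \<omega> \<partial>M) = ?p * measure M (B \<inter> ?E)"
      by (simp add: set_lebesgue_integral_def indicator_inter_arith[symmetric] mult.left_commute)
    show "(\<integral>\<omega>\<in>B. indicator ?D \<omega> \<partial>M) = (\<integral>\<omega>\<in>B. ?p * indicator ?E \<omega> \<partial>M)"
      unfolding e1 e2 past_markov[OF s B] by (rule mult.commute)
  qed (auto simp: integrable_indicator_iff less_top[symmetric])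
  have int: "integrable M (\<lambda>\<omega>. G \<omega> * indicator ?D \<omega>)"
  proof (rule integrable_const_bound[where B = "\<bar>K\<bar>"])
    show "AE \<omega> in M. norm (G \<omega> * indicator ?D \<omega>) \<le> \<bar>K\<bar>"
      using bound by (intro AE_I2) (fastforce simp: indicator_def)
  qed measurable
  have "(\<integral>\<omega>. G \<omega> * indicator ?D \<omega> \<partial>M) = (\<integral>\<omega>. G \<omega> * real_cond_exp M (past s) (indicator ?D) \<omega> \<partial>M)"
    by (rule past.real_cond_exp_intg(2)[symmetric]) (use int in auto)
  also have "\<dots> = (\<integral>\<omega>. ?p * (G \<omega> * indicator ?E \<omega>) \<partial>M)"
    by (rule integral_cong_AE) (use ce in \<open>auto elim!: eventually_mono\<close>)
  finally show ?thesis by simp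
qed

text \<open>Grid points approximating \<open>u\<close> strictly from the right, where the paths are continuous, and clipped at \<open>s\<close>
  so that they never look beyond the past of \<open>s\<close>.\<close>
lemma time_approx:
  fixes u s :: real and n :: nat
  defines "a \<equiv> min s (max 0 ((real_of_int \<lfloor>u * Suc n\<rfloor> + 1) / Suc n))"
  shows "min s (max 0 u) \<le> a" "a \<le> min s (max 0 u) + 1 / Suc n"
proof -
  let ?v = "(real_of_int \<lfloor>u * Suc n\<rfloor> + 1) / Suc n"
  have "u * Suc n < real_of_int \<lfloor>u * Suc n\<rfloor> + 1" "real_of_int \<lfloor>u * Suc n\<rfloor> \<le> u * Suc n" by linarith+
  then have v: "u < ?v" "?v \<le> u + 1 / Suc n"
    by (simp_all only: pos_less_divide_eq pos_divide_le_eq of_nat_0_less_iff zero_less_Suc ring_distribs) simp_all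
  have d: "1 / Suc n > (0::real)" by simp
  show "min s (max 0 u) \<le> a" unfolding a_def using v by linarith
  show "a \<le> min s (max 0 u) + 1 / Suc n" unfolding a_def using v d by linarith
qed

lemma phase_joint_measurable [measurable]:
  assumes "s \<ge> 0"
  shows "(\<lambda>(\<omega>, u). \<phi> (min s (max 0 u)) \<omega>) \<in> past s \<Otimes>\<^sub>M borel \<rightarrow>\<^sub>M count_space UNIV"
proof -
  let ?a = "\<lambda>n k. min s (max 0 ((real_of_int k + 1) / Suc n))"
  let ?g = "\<lambda>n p. \<phi> (?a n \<lfloor>snd p * real (Suc n)\<rfloor>) (fst p)"
  have g: "?g n \<in> past s \<Otimes>\<^sub>M borel \<rightarrow>\<^sub>M count_space UNIV" for n
  proof (rule measurable_compose_countable[where f = "\<lambda>k p. \<phi> (?a n k) (fst p)" and g = "\<lambda>p. \<lfloor>snd p * real (Suc n)\<rfloor>"])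
    fix k :: int
    have "\<phi> (?a n k) \<in> past s \<rightarrow>\<^sub>M count_space UNIV" using assms by (intro phase_past) auto
    then show "(\<lambda>p. \<phi> (?a n k) (fst p)) \<in> past s \<Otimes>\<^sub>M borel \<rightarrow>\<^sub>M count_space UNIV"
      by (rule measurable_compose[OF measurable_fst])
  next
    have "(\<lambda>x::real. \<lfloor>x * Suc n\<rfloor>) \<in> borel \<rightarrow>\<^sub>M count_space UNIV" by measurable
    then show "(\<lambda>p. \<lfloor>snd p * real (Suc n)\<rfloor>) \<in> past s \<Otimes>\<^sub>M borel \<rightarrow>\<^sub>M count_space UNIV"
      by (rule measurable_compose[OF measurable_snd])
  qed
  have lim: "\<exists>N. \<forall>n\<ge>N. ?g n (\<omega>, u) = \<phi> (min s (max 0 u)) \<omega>" if \<omega>: "\<omega> \<in> space M" for \<omega> u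
  proof -
    have "min s (max 0 u) \<ge> 0" using assms by simp
    from right_continuous[OF \<omega> this] obtain \<delta> where
      \<delta>: "\<delta> > 0" "\<And>r. r \<in> {min s (max 0 u)..<min s (max 0 u) + \<delta>} \<Longrightarrow> \<phi> r \<omega> = \<phi> (min s (max 0 u)) \<omega>" by blast
    obtain N where N: "1 / real (Suc N) < \<delta>" using \<delta>(1) nat_approx_posE by blast
    have "?g n (\<omega>, u) = \<phi> (min s (max 0 u)) \<omega>" if "n \<ge> N" for n
    proof -
      have "1 / real (Suc n) \<le> 1 / real (Suc N)" using that by (simp add: frac_le)
      then have "?a n \<lfloor>u * Suc n\<rfloor> \<in> {min s (max 0 u)..<min s (max 0 u) + \<delta>}"
        using time_approx[of s u n] N by auto
      from \<delta>(2)[OF this] show ?thesis by simp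
    qed
    then show ?thesis by blast
  qed
  have "(\<lambda>p. \<phi> (min s (max 0 (snd p))) (fst p)) \<in> past s \<Otimes>\<^sub>M borel \<rightarrow>\<^sub>M count_space UNIV"
  proof (rule measurable_discrete_limit[of ?g, OF g])
    fix p assume "p \<in> space (past s \<Otimes>\<^sub>M (borel :: real measure))"
    then have "fst p \<in> space M" by (auto simp: space_pair_measure)
    from lim[OF this, of "snd p"] show "\<exists>K. \<forall>n\<ge>K. ?g n p = \<phi> (min s (max 0 (snd p))) (fst p)" by simp
  qed
  then show ?thesis by (simp add: case_prod_unfold)
qed

lemma path_measurable [measurable]:
  assumes "s \<ge> 0" "\<omega> \<in> space M"
  shows "(\<lambda>u. \<phi> (min s (max 0 u)) \<omega>) \<in> borel \<rightarrow>\<^sub>M count_space UNIV"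
proof -
  have "(\<lambda>u. (\<omega>, u)) \<in> borel \<rightarrow>\<^sub>M past s \<Otimes>\<^sub>M borel" using assms by (intro measurable_Pair1') simp
  from measurable_compose[OF this phase_joint_measurable[OF assms(1)]] show ?thesis by simp
qed

end

section \<open>The fluid level over short times\<close>

definition C2 :: "(real \<Rightarrow> 's \<Rightarrow> real) \<Rightarrow> (real \<Rightarrow> 's \<Rightarrow> real) \<Rightarrow> (real \<Rightarrow> 's \<Rightarrow> real) \<Rightarrow> bool" where
  "C2 f f1 f2 \<longleftrightarrow> (\<forall>i y. ((\<lambda>y. f y i) has_real_derivative f1 y i) (at y)) \<and>
     (\<forall>i y. ((\<lambda>y. f1 y i) has_real_derivative f2 y i) (at y)) \<and> (\<forall>i. continuous_on UNIV (\<lambda>y. f2 y i))"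

lemma C2_continuous:
  assumes "C2 f f1 f2"
  shows "continuous_on UNIV (\<lambda>y. f y i)" "continuous_on UNIV (\<lambda>y. f1 y i)" "continuous_on UNIV (\<lambda>y. f2 y i)"
proof -
  show "continuous_on UNIV (\<lambda>y. f y i)"
    by (rule DERIV_continuous_on[where D = "\<lambda>y. f1 y i"]) (use assms in \<open>simp add: C2_def\<close>)
  show "continuous_on UNIV (\<lambda>y. f1 y i)"
    by (rule DERIV_continuous_on[where D = "\<lambda>y. f2 y i"]) (use assms in \<open>simp add: C2_def\<close>)
qed (use assms in \<open>simp add: C2_def\<close>)

lemma C2_bounds:
  fixes f :: "real \<Rightarrow> 's::finite \<Rightarrow> real"
  assumes "C2 f f1 f2"
  obtains m where "m \<ge> 0" "\<And>y i. y \<in> {-R..R} \<Longrightarrow> \<bar>f y i\<bar> \<le> m" "\<And>y i. y \<in> {-R..R} \<Longrightarrow> \<bar>f1 y i\<bar> \<le> m"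
    "\<And>y i. y \<in> {-R..R} \<Longrightarrow> \<bar>f2 y i\<bar> \<le> m"
proof -
  have ex: "\<exists>m\<ge>0. \<forall>y\<in>{-R..R}. \<forall>i. \<bar>g y i\<bar> \<le> m" if "\<And>i. continuous_on UNIV (\<lambda>y. g y i)" for g :: "real \<Rightarrow> 's \<Rightarrow> real"
  proof -
    have "\<exists>b. \<forall>y\<in>{-R..R}. \<bar>g y i\<bar> \<le> b" for i
      using compact_imp_bounded[OF compact_continuous_image[OF continuous_on_subset[OF that subset_UNIV], of "{-R..R}" i]]
      by (auto simp: bounded_iff)
    then obtain b where b: "\<And>y i. y \<in> {-R..R} \<Longrightarrow> \<bar>g y i\<bar> \<le> b i" by metis
    have "\<bar>g y i\<bar> \<le> (\<Sum>i\<in>UNIV. \<bar>b i\<bar>)" if "y \<in> {-R..R}" for y i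
      using b[OF that, of i] member_le_sum[of i UNIV "\<lambda>i. \<bar>b i\<bar>"] by simp
    then show ?thesis by (intro exI[of _ "\<Sum>i\<in>UNIV. \<bar>b i\<bar>"]) (auto intro!: sum_nonneg)
  qed
  obtain m0 where m0: "m0 \<ge> 0" "\<forall>y\<in>{-R..R}. \<forall>i. \<bar>f y i\<bar> \<le> m0"
    using ex[of f, OF C2_continuous(1)[OF assms]] by blast
  obtain m1 where m1: "m1 \<ge> 0" "\<forall>y\<in>{-R..R}. \<forall>i. \<bar>f1 y i\<bar> \<le> m1"
    using ex[of f1, OF C2_continuous(2)[OF assms]] by blast
  obtain m2 where m2: "m2 \<ge> 0" "\<forall>y\<in>{-R..R}. \<forall>i. \<bar>f2 y i\<bar> \<le> m2"
    using ex[of f2, OF C2_continuous(3)[OF assms]] by blast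
  show ?thesis
  proof (rule that[of "m0 + m1 + m2"])
    show "\<bar>f y i\<bar> \<le> m0 + m1 + m2" if "y \<in> {-R..R}" for y i
      using m0(2)[rule_format, OF that, of i] m1(1) m2(1) by linarith
    show "\<bar>f1 y i\<bar> \<le> m0 + m1 + m2" if "y \<in> {-R..R}" for y i
      using m1(2)[rule_format, OF that, of i] m0(1) m2(1) by linarith
    show "\<bar>f2 y i\<bar> \<le> m0 + m1 + m2" if "y \<in> {-R..R}" for y i
      using m2(2)[rule_format, OF that, of i] m0(1) m1(1) by linarith
  qed (use m0(1) m1(1) m2(1) in linarith)
qed

lemma C2_lipschitz:
  assumes "C2 f f1 f2" and m: "\<And>y i. y \<in> {-R..R} \<Longrightarrow> \<bar>f1 y i\<bar> \<le> m" and y: "y \<in> {-R..R}" "z \<in> {-R..R}"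
  shows "\<bar>f y i - f z i\<bar> \<le> m * \<bar>y - z\<bar>"
proof -
  have "norm (f y i - f z i) \<le> m * norm (y - z)"
  proof (rule field_differentiable_bound[of "{-R..R}" "\<lambda>y. f y i" "\<lambda>y. f1 y i"])
    show "((\<lambda>y. f y i) has_field_derivative f1 w i) (at w within {-R..R})" for w
      by (rule has_field_derivative_at_within) (use assms(1) in \<open>simp add: C2_def\<close>)
  qed (use m y in auto)
  then show ?thesis by simp
qed

text \<open>First-order expansion of the phase transition semigroup and, simultaneously, of \<open>f\<close> along a linear
  motion of the level.\<close>
lemma semigroup_step:
  fixes A :: "real^'s::finite^'s" and c :: "real^'s"
  assumes "C2 f f1 f2"
  obtains C where "C \<ge> 0" "\<And>h y j. 0 \<le> h \<Longrightarrow> h \<le> T \<Longrightarrow> y \<in> {-R..R} \<Longrightarrow> y + c $ j * h \<in> {-R..R} \<Longrightarrow>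
    \<bar>(\<Sum>k\<in>UNIV. mat_exp (h *\<^sub>R A) $ j $ k * f (y + c $ j * h) k) - f y j
      - h * (c $ j * f1 y j + (\<Sum>k\<in>UNIV. A $ j $ k * f y k))\<bar> \<le> C * h\<^sup>2"
proof -
  obtain m where m: "m \<ge> 0" "\<And>y i. y \<in> {-R..R} \<Longrightarrow> \<bar>f y i\<bar> \<le> m" "\<And>y i. y \<in> {-R..R} \<Longrightarrow> \<bar>f1 y i\<bar> \<le> m"
    "\<And>y i. y \<in> {-R..R} \<Longrightarrow> \<bar>f2 y i\<bar> \<le> m" using C2_bounds[OF assms, of R] by metis
  obtain CA where CA: "CA \<ge> 0" "\<And>h i j. 0 \<le> h \<Longrightarrow> h \<le> T \<Longrightarrow>
    \<bar>mat_exp (h *\<^sub>R A) $ i $ j - (mat 1 :: real^'s^'s) $ i $ j - h * A $ i $ j\<bar> \<le> CA * h\<^sup>2"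
    using mat_exp_second_order[of T A] by metis
  define S where "S = (\<Sum>j\<in>UNIV. \<Sum>k\<in>UNIV. \<bar>A $ j $ k\<bar>)"
  define n where "n = norm c"
  define C where "C = m * n\<^sup>2 + S * (m * n) + real (CARD('s)) * (CA * m)"
  have n: "\<bar>c $ j\<bar> \<le> n" for j unfolding n_def by (rule component_le_norm_cart)
  have n0: "n \<ge> 0" by (simp add: n_def)
  have S0: "S \<ge> 0" unfolding S_def by (intro sum_nonneg) auto
  show ?thesis
  proof
    show "C \<ge> 0" unfolding C_def using m(1) n0 S0 CA(1) by (intro add_nonneg_nonneg mult_nonneg_nonneg) auto
    fix h y j assume h: "0 \<le> h" "h \<le> T" and y: "y \<in> {-R..R}" "y + c $ j * h \<in> {-R..R}"
    define F where "F k = f (y + c $ j * h) k" for k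
    define e where "e k = mat_exp (h *\<^sub>R A) $ j $ k - (mat 1 :: real^'s^'s) $ j $ k - h * A $ j $ k" for k
    have chm: "\<bar>c $ j * h\<bar> \<le> n * h" using n[of j] h by (simp add: abs_mult mult_right_mono)
    have "(\<Sum>k\<in>UNIV. mat_exp (h *\<^sub>R A) $ j $ k * F k) = (\<Sum>k\<in>UNIV. (if k = j then F k else 0) + h * (A $ j $ k * F k) + e k * F k)"
      by (intro sum.cong) (auto simp: e_def mat_def algebra_simps)
    also have "\<dots> = F j + h * (\<Sum>k\<in>UNIV. A $ j $ k * F k) + (\<Sum>k\<in>UNIV. e k * F k)"
      by (simp add: sum.distrib sum_distrib_left)
    finally have eq: "(\<Sum>k\<in>UNIV. mat_exp (h *\<^sub>R A) $ j $ k * F k) - f y j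
        - h * (c $ j * f1 y j + (\<Sum>k\<in>UNIV. A $ j $ k * f y k)) =
      (F j - f y j - (c $ j * h) * f1 y j) + h * (\<Sum>k\<in>UNIV. A $ j $ k * (F k - f y k)) + (\<Sum>k\<in>UNIV. e k * F k)"
      by (simp add: algebra_simps sum_subtractf)
    have 1: "\<bar>F j - f y j - (c $ j * h) * f1 y j\<bar> \<le> m * n\<^sup>2 * h\<^sup>2"
    proof -
      have "\<bar>F j - f y j - (c $ j * h) * f1 y j\<bar> \<le> m * (c $ j * h)\<^sup>2"
        unfolding F_def
        by (rule second_order_bound[of "\<lambda>y. f y j" "\<lambda>y. f1 y j" "\<lambda>y. f2 y j" R]) (use assms m y in \<open>auto simp: C2_def\<close>)
      also have "\<dots> \<le> m * (n * h)\<^sup>2"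
        using m(1) chm by (intro mult_left_mono) (auto simp: abs_le_square_iff[symmetric])
      finally show ?thesis by (simp add: power_mult_distrib mult.assoc)
    qed
    have Fk: "\<bar>F k - f y k\<bar> \<le> m * n * h" for k
    proof -
      have "\<bar>F k - f y k\<bar> \<le> m * \<bar>y + c $ j * h - y\<bar>"
        unfolding F_def using C2_lipschitz[OF assms m(3) y(2,1)] .
      also have "\<dots> \<le> m * (n * h)" using chm m(1) by (intro mult_left_mono) auto
      finally show ?thesis by (simp add: mult.assoc)
    qed
    have 2: "\<bar>h * (\<Sum>k\<in>UNIV. A $ j $ k * (F k - f y k))\<bar> \<le> S * (m * n) * h\<^sup>2"
    proof -
      have "\<bar>\<Sum>k\<in>UNIV. A $ j $ k * (F k - f y k)\<bar> \<le> (\<Sum>k\<in>UNIV. \<bar>A $ j $ k\<bar> * (m * n * h))"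
        by (rule order_trans[OF sum_abs]) (intro sum_mono, simp add: abs_mult mult_left_mono Fk)
      also have "\<dots> = (\<Sum>k\<in>UNIV. \<bar>A $ j $ k\<bar>) * (m * n * h)" by (simp add: sum_distrib_right)
      also have "\<dots> \<le> S * (m * n * h)"
        unfolding S_def using m(1) n0 h
        by (intro mult_right_mono member_le_sum[of j UNIV "\<lambda>j. \<Sum>k\<in>UNIV. \<bar>A $ j $ k\<bar>"]) (auto intro!: sum_nonneg mult_nonneg_nonneg)
      finally have "h * \<bar>\<Sum>k\<in>UNIV. A $ j $ k * (F k - f y k)\<bar> \<le> h * (S * (m * n * h))"
        using h by (intro mult_left_mono) auto
      then show ?thesis using h by (simp add: abs_mult power2_eq_square mult_ac)
    qed
    have 3: "\<bar>\<Sum>k\<in>UNIV. e k * F k\<bar> \<le> real (CARD('s)) * (CA * m) * h\<^sup>2"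
    proof -
      have "\<bar>\<Sum>k\<in>UNIV. e k * F k\<bar> \<le> (\<Sum>k\<in>(UNIV::'s set). (CA * h\<^sup>2) * m)"
      proof (rule order_trans[OF sum_abs], intro sum_mono)
        fix k
        have "\<bar>e k\<bar> \<le> CA * h\<^sup>2" unfolding e_def using CA(2)[OF h] .
        moreover have "\<bar>F k\<bar> \<le> m" unfolding F_def using m(2)[OF y(2)] .
        ultimately show "\<bar>e k * F k\<bar> \<le> (CA * h\<^sup>2) * m"
          unfolding abs_mult using CA(1) by (intro mult_mono) auto
      qed
      then show ?thesis by (simp add: mult_ac)
    qed
    have "\<bar>(\<Sum>k\<in>UNIV. mat_exp (h *\<^sub>R A) $ j $ k * F k) - f y j
      - h * (c $ j * f1 y j + (\<Sum>k\<in>UNIV. A $ j $ k * f y k))\<bar> \<le> C * h\<^sup>2"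
      unfolding eq C_def using 1 2 3 by (simp add: distrib_right)
    then show "\<bar>(\<Sum>k\<in>UNIV. mat_exp (h *\<^sub>R A) $ j $ k * f (y + c $ j * h) k) - f y j
      - h * (c $ j * f1 y j + (\<Sum>k\<in>UNIV. A $ j $ k * f y k))\<bar> \<le> C * h\<^sup>2" by (simp add: F_def)
  qed
qed

context fluid_process
begin

abbreviation Y :: "real \<Rightarrow> 'w \<Rightarrow> real" where "Y \<equiv> level \<phi> c"

lemma rate_measurable: "(\<lambda>j. c $ j) \<in> count_space UNIV \<rightarrow>\<^sub>M borel" by simp

lemma path_set_integrable:
  assumes \<omega>: "\<omega> \<in> space M" and S: "S \<in> sets borel" "S \<subseteq> {0..b}"
  shows "set_integrable lborel S (\<lambda>u. g (\<phi> u \<omega>) :: real)"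
proof (cases "b \<ge> 0")
  case True
  define B where "B = (\<Sum>j\<in>UNIV. \<bar>g j\<bar>)"
  have B: "\<bar>g j\<bar> \<le> B" for j unfolding B_def by (intro member_le_sum) auto
  have m: "(\<lambda>u. g (\<phi> (min b (max 0 u)) \<omega>)) \<in> borel_measurable lborel"
    using measurable_compose[OF path_measurable[OF True \<omega>], of g borel] by simp
  have "emeasure lborel S \<le> emeasure lborel {0..b}" using S by (intro emeasure_mono) auto
  then have fin: "emeasure lborel S < \<infinity>" by (simp add: True le_less_trans)
  have "set_integrable lborel S (\<lambda>u. g (\<phi> (min b (max 0 u)) \<omega>))"
    unfolding set_integrable_def
    by (rule integrableI_bounded_set_indicator[where B = B]) (use S m fin B in auto)
  moreover have "(\<lambda>u. indicat_real S u *\<^sub>R g (\<phi> (min b (max 0 u)) \<omega>)) = (\<lambda>u. indicat_real S u *\<^sub>R g (\<phi> u \<omega>))"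
  proof
    fix u
    have "min b (max 0 u) = u" if "u \<in> S" using S(2) that by force
    then show "indicat_real S u *\<^sub>R g (\<phi> (min b (max 0 u)) \<omega>) = indicat_real S u *\<^sub>R g (\<phi> u \<omega>)"
      by (cases "u \<in> S") auto
  qed
  ultimately show ?thesis by (simp only: set_integrable_def)
next
  case False
  then have "S = {}" using S by auto
  then show ?thesis by (simp add: set_integrable_def)
qed

lemma level_increment:
  assumes \<omega>: "\<omega> \<in> space M" and ab: "0 \<le> a" "a \<le> b"
  shows "Y b \<omega> - Y a \<omega> - k * (b - a) = (LBINT u:{a<..b}. c $ \<phi> u \<omega> - k)"
proof -
  have un: "{0..b} = {0..a} \<union> {a<..b}" and dis: "{0..a} \<inter> {a<..b} = {}" using ab by auto
  have "Y b \<omega> = Y a \<omega> + (LBINT u:{a<..b}. c $ \<phi> u \<omega>)"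
    unfolding level_def un using ab dis
    by (intro set_integral_Un path_set_integrable[OF \<omega>, of _ b "\<lambda>j. c $ j"]) auto
  moreover have "(LBINT u:{a<..b}. c $ \<phi> u \<omega> - k) = (LBINT u:{a<..b}. c $ \<phi> u \<omega>) - (LBINT u:{a<..b}. k)"
    using ab by (intro set_integral_diff path_set_integrable[OF \<omega>, of _ b "\<lambda>j. c $ j"]
        path_set_integrable[OF \<omega>, of _ b "\<lambda>j. k"]) auto
  moreover have "(LBINT u:{a<..b}. k) = k * (b - a)"
    using ab by (simp add: set_lebesgue_integral_def)
  ultimately show ?thesis by simp
qed

lemma level_increment_abs:
  assumes \<omega>: "\<omega> \<in> space M" and ab: "0 \<le> a" "a \<le> b"
  shows "\<bar>Y b \<omega> - Y a \<omega> - k * (b - a)\<bar> \<le> (LBINT u:{a<..b}. \<bar>c $ \<phi> u \<omega> - k\<bar>)"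
  unfolding level_increment[OF assms] using ab
  by (intro set_integral_norm_bound[where f = "\<lambda>u. c $ \<phi> u \<omega> - k", simplified]
      path_set_integrable[OF \<omega>, of "{a<..b}" b "\<lambda>j. c $ j - k"]) auto

lemma level_increment_bound:
  assumes \<omega>: "\<omega> \<in> space M" and ab: "0 \<le> a" "a \<le> b"
    and B: "\<And>u. u \<in> {a<..b} \<Longrightarrow> \<bar>c $ \<phi> u \<omega> - k\<bar> \<le> B"
  shows "\<bar>Y b \<omega> - Y a \<omega> - k * (b - a)\<bar> \<le> B * (b - a)"
proof -
  have "{a<..b} \<subseteq> {0..b}" using ab by auto
  then have "(LBINT u:{a<..b}. \<bar>c $ \<phi> u \<omega> - k\<bar>) \<le> (LBINT u:{a<..b}. B)"
    using ab B path_set_integrable[OF \<omega>, of "{a<..b}" b "\<lambda>j. \<bar>c $ j - k\<bar>"]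
      path_set_integrable[OF \<omega>, of "{a<..b}" b "\<lambda>j. B"]
    by (intro set_integral_mono) auto
  also have "\<dots> = B * (b - a)" using ab by (simp add: set_lebesgue_integral_def)
  finally show ?thesis using level_increment_abs[OF assms(1-3), of k] by simp
qed

lemma level_lipschitz:
  assumes "\<omega> \<in> space M" "0 \<le> a" "a \<le> b"
  shows "\<bar>Y b \<omega> - Y a \<omega>\<bar> \<le> norm c * (b - a)"
  using level_increment_bound[OF assms, of 0 "norm c"] component_le_norm_cart[of c] by simp

lemma level_linear:
  assumes "\<omega> \<in> space M" "0 \<le> a" "a \<le> b" "\<And>u. u \<in> {a<..b} \<Longrightarrow> \<phi> u \<omega> = i"
  shows "Y b \<omega> = Y a \<omega> + c $ i * (b - a)"
  using level_increment_bound[OF assms(1-3), of "c $ i" 0] assms(4) by simp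

lemma level_zero: "Y 0 \<omega> = 0"
proof -
  have "(LBINT s:{0..0::real}. c $ \<phi> s \<omega>) = 0"
    unfolding set_lebesgue_integral_def
  proof (rule integral_eq_zero_AE)
    show "AE u in lborel. indicat_real {0..0} u *\<^sub>R c $ \<phi> u \<omega> = 0"
      using AE_lborel_singleton[of "0::real"] by eventually_elim (auto simp: indicator_def)
  qed
  then show ?thesis by (simp add: level_def)
qed

lemma level_continuous:
  assumes "\<omega> \<in> space M" shows "continuous_on {0..} (\<lambda>t. Y t \<omega>)"
proof -
  have "\<bar>Y x \<omega> - Y y \<omega>\<bar> \<le> norm c * \<bar>x - y\<bar>" if "x \<ge> 0" "y \<ge> 0" for x y
    using level_lipschitz[OF assms, of x y] level_lipschitz[OF assms, of y x] that
    by (cases "x \<le> y") (auto simp: abs_minus_commute)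
  then have "(norm c)-lipschitz_on {0..} (\<lambda>t. Y t \<omega>)" by (intro lipschitz_onI) (auto simp: dist_real_def)
  then show ?thesis by (rule lipschitz_on_continuous_on)
qed

text \<open>Fubini for the jointly measurable phase process: the level is a parameter integral over times
  up to \<open>t\<close>.\<close>
lemma level_past:
  assumes "0 \<le> t" "t \<le> s"
  shows "Y t \<in> borel_measurable (past s)"
proof -
  have s: "s \<ge> 0" using assms by simp
  have "(\<lambda>(\<omega>, u). c $ \<phi> (min s (max 0 u)) \<omega>) \<in> borel_measurable (past s \<Otimes>\<^sub>M borel)"
    using measurable_compose[OF phase_joint_measurable[OF s] rate_measurable] by (simp add: case_prod_unfold)
  then have [measurable]: "(\<lambda>p. c $ \<phi> (min s (max 0 (snd p))) (fst p)) \<in> borel_measurable (past s \<Otimes>\<^sub>M lborel)"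
    by (simp add: case_prod_unfold cong: measurable_cong_sets)
  have "(\<lambda>\<omega>. \<integral>u. indicat_real {0..t} u *\<^sub>R c $ \<phi> (min s (max 0 (snd (\<omega>, u)))) (fst (\<omega>, u)) \<partial>lborel) \<in> borel_measurable (past s)"
    by (rule lborel.borel_measurable_lebesgue_integral) (simp add: case_prod_unfold)
  moreover have "Y t = (\<lambda>\<omega>. \<integral>u. indicat_real {0..t} u *\<^sub>R c $ \<phi> (min s (max 0 u)) \<omega> \<partial>lborel)"
  proof
    fix \<omega>
    have "min s (max 0 u) = u" if "u \<in> {0..t}" for u using that assms by auto
    then show "Y t \<omega> = (\<integral>u. indicat_real {0..t} u *\<^sub>R c $ \<phi> (min s (max 0 u)) \<omega> \<partial>lborel)"
      unfolding level_def set_lebesgue_integral_def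
      by (intro Bochner_Integration.integral_cong) (auto simp: indicator_def)
  qed
  ultimately show ?thesis by (simp only: fst_conv snd_conv)
qed

lemma level_measurable [measurable]: "t \<ge> 0 \<Longrightarrow> Y t \<in> borel_measurable M"
  using measurable_from_subalg[OF subalgebra_past level_past[of t t]] by simp

lemma jump_probability:
  obtains C where "C \<ge> 0" "\<And>(s::real) (u::real). 0 \<le> s \<Longrightarrow> s \<le> u \<Longrightarrow> u \<le> s + T \<Longrightarrow>
    measure M {\<omega>\<in>space M. \<phi> u \<omega> \<noteq> \<phi> s \<omega>} \<le> C * (u - s)"
proof -
  obtain CA where CA: "CA \<ge> 0" "\<And>h i j. 0 \<le> h \<Longrightarrow> h \<le> \<bar>T\<bar> \<Longrightarrow>
    \<bar>mat_exp (h *\<^sub>R A) $ i $ j - (mat 1 :: real^'s^'s) $ i $ j - h * A $ i $ j\<bar> \<le> CA * h\<^sup>2"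
    using mat_exp_second_order[of "\<bar>T\<bar>" A] by metis
  define a where "a = (\<Sum>i\<in>UNIV. \<bar>A $ i $ i\<bar>)"
  have a: "\<bar>A $ i $ i\<bar> \<le> a" for i unfolding a_def by (intro member_le_sum) auto
  have a0: "a \<ge> 0" unfolding a_def by (intro sum_nonneg) auto
  show ?thesis
  proof (rule that[of "a + CA * \<bar>T\<bar>"])
    show "a + CA * \<bar>T\<bar> \<ge> 0" using a0 CA by simp
    fix s u :: real assume su: "0 \<le> s" "s \<le> u" "u \<le> s + T"
    define h where "h = u - s"
    have h: "0 \<le> h" "h \<le> \<bar>T\<bar>" using su by (auto simp: h_def)
    have uh: "u = s + h" by (simp add: h_def)
    let ?E = "\<lambda>i. {\<omega>\<in>space M. \<phi> s \<omega> = i}" and ?D = "\<lambda>i. {\<omega>\<in>space M. \<phi> s \<omega> = i \<and> \<phi> (s + h) \<omega> = i}"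
    have [measurable]: "?E i \<in> sets M" "?D i \<in> sets M" for i using su h by (auto intro: phase_sets phase2_sets)
    have D: "measure M (?D i) = measure M (?E i) * mat_exp (h *\<^sub>R A) $ i $ i" for i
      using past_markov[of s h "space M" i i] su h sets.top[of "past s"] by (simp add: Int_def)
    have sumE: "(\<Sum>i\<in>UNIV. measure M (?E i)) = 1"
    proof -
      have "(\<Sum>i\<in>UNIV. measure M (?E i)) = measure M (\<Union>i\<in>UNIV. ?E i)"
        by (rule finite_measure_finite_Union[symmetric]) (auto simp: disjoint_family_on_def)
      also have "(\<Union>i\<in>UNIV. ?E i) = space M" by auto
      finally show ?thesis by (simp add: prob_space)
    qed
    have sumD: "(\<Sum>i\<in>UNIV. measure M (?D i)) = measure M (space M - {\<omega>\<in>space M. \<phi> u \<omega> \<noteq> \<phi> s \<omega>})"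
    proof -
      have "(\<Sum>i\<in>UNIV. measure M (?D i)) = measure M (\<Union>i\<in>UNIV. ?D i)"
        by (rule finite_measure_finite_Union[symmetric]) (auto simp: disjoint_family_on_def)
      also have "(\<Union>i\<in>UNIV. ?D i) = space M - {\<omega>\<in>space M. \<phi> u \<omega> \<noteq> \<phi> s \<omega>}" by (auto simp: uh)
      finally show ?thesis .
    qed
    have "{\<omega>\<in>space M. \<phi> u \<omega> \<noteq> \<phi> s \<omega>} = space M - (\<Union>i\<in>UNIV. ?D i)" by (auto simp: uh)
    then have ms: "{\<omega>\<in>space M. \<phi> u \<omega> \<noteq> \<phi> s \<omega>} \<in> sets M" by simp
    have "1 - (a + CA * \<bar>T\<bar>) * h = (\<Sum>i\<in>UNIV. measure M (?E i) * (1 - (a + CA * \<bar>T\<bar>) * h))"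
      unfolding sum_distrib_right[symmetric] sumE by simp
    also have "\<dots> \<le> (\<Sum>i\<in>UNIV. measure M (?E i) * mat_exp (h *\<^sub>R A) $ i $ i)"
    proof (intro sum_mono mult_left_mono)
      fix i
      have "\<bar>mat_exp (h *\<^sub>R A) $ i $ i - 1 - h * A $ i $ i\<bar> \<le> CA * h\<^sup>2"
        using CA(2)[OF h, of i i] by (simp add: mat_def)
      moreover have "CA * h\<^sup>2 \<le> CA * (\<bar>T\<bar> * h)"
        unfolding power2_eq_square using h CA(1) by (intro mult_left_mono mult_right_mono)
      moreover have "h * A $ i $ i \<ge> - (a * h)"
        using mult_left_mono[OF a[of i] h(1)] abs_le_D2[of "h * A $ i $ i" "h * a"] h by (simp add: abs_mult mult.commute)
      ultimately show "1 - (a + CA * \<bar>T\<bar>) * h \<le> mat_exp (h *\<^sub>R A) $ i $ i"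
        by (simp add: algebra_simps)
    qed simp
    also have "\<dots> = 1 - measure M {\<omega>\<in>space M. \<phi> u \<omega> \<noteq> \<phi> s \<omega>}"
      unfolding D[symmetric] sumD using prob_compl[OF ms] by simp
    finally show "measure M {\<omega>\<in>space M. \<phi> u \<omega> \<noteq> \<phi> s \<omega>} \<le> (a + CA * \<bar>T\<bar>) * (u - s)" by (simp add: h_def)
  qed
qed

sublocale LM: pair_sigma_finite M lborel ..

lemma phase_joint_measurable_M:
  assumes "s \<ge> 0"
  shows "(\<lambda>(\<omega>, u). \<phi> (min s (max 0 u)) \<omega>) \<in> M \<Otimes>\<^sub>M lborel \<rightarrow>\<^sub>M count_space UNIV"
proof -
  have "(\<lambda>x. x) \<in> M \<rightarrow>\<^sub>M past s" by (rule measurable_from_subalg[OF subalgebra_past[of s]]) simp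
  then have "fst \<in> M \<Otimes>\<^sub>M lborel \<rightarrow>\<^sub>M past s" using measurable_compose[OF measurable_fst] by blast
  moreover have "snd \<in> M \<Otimes>\<^sub>M lborel \<rightarrow>\<^sub>M (borel :: real measure)" by simp
  ultimately have "(\<lambda>p. (fst p, snd p)) \<in> M \<Otimes>\<^sub>M lborel \<rightarrow>\<^sub>M past s \<Otimes>\<^sub>M (borel :: real measure)" by (rule measurable_Pair)
  from measurable_compose[OF this phase_joint_measurable[OF assms]] show ?thesis by (simp add: case_prod_unfold)
qed

text \<open>The level deviates from linear motion only after a jump, so the deviation is at most the integral of
  \<open>2 * norm c\<close> over the times at which the phase differs from its initial one. Such a time has
  probability \<open>O(h)\<close>, which together with the length \<open>h\<close> of the interval gives \<open>h\<^sup>2\<close>.\<close>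
lemma expected_increment_error:
  obtains C where "C \<ge> 0" "\<And>(s::real) (h::real). 0 \<le> s \<Longrightarrow> 0 \<le> h \<Longrightarrow> h \<le> T \<Longrightarrow>
    (\<integral>\<omega>. \<bar>Y (s + h) \<omega> - Y s \<omega> - c $ \<phi> s \<omega> * h\<bar> \<partial>M) \<le> C * h\<^sup>2"
proof -
  obtain C where C: "C \<ge> 0" "\<And>(s::real) (u::real). 0 \<le> s \<Longrightarrow> s \<le> u \<Longrightarrow> u \<le> s + T \<Longrightarrow>
    measure M {\<omega>\<in>space M. \<phi> u \<omega> \<noteq> \<phi> s \<omega>} \<le> C * (u - s)" using jump_probability[of T] by metis
  show ?thesis
  proof (rule that[of "2 * norm c * C"])
    show "2 * norm c * C \<ge> 0" using C(1) by simp
    fix s h :: real assume sh: "0 \<le> s" "0 \<le> h" "h \<le> T"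
    define t where "t = s + h"
    have t: "0 \<le> t" "s \<le> t" using sh by (auto simp: t_def)
    have st: "{s<..t} \<in> sets borel" "{s<..t} \<subseteq> {0..t}" using sh by auto
    define e where "e \<omega> u = ennreal (indicat_real {s<..t} u * (2 * norm c) * (if \<phi> (min t (max 0 u)) \<omega> = \<phi> s \<omega> then 0 else 1))" for \<omega> u
    have m1 [measurable]: "(\<lambda>p. \<phi> (min t (max 0 (snd p))) (fst p)) \<in> M \<Otimes>\<^sub>M lborel \<rightarrow>\<^sub>M count_space UNIV"
      using phase_joint_measurable_M[OF t(1)] by (simp add: case_prod_unfold)
    have m2 [measurable]: "(\<lambda>p. \<phi> s (fst p)) \<in> M \<Otimes>\<^sub>M lborel \<rightarrow>\<^sub>M count_space UNIV"
      using measurable_compose[OF measurable_fst phase_measurable[OF sh(1)]] .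
    have em: "(\<lambda>(\<omega>, u). e \<omega> u) \<in> borel_measurable (M \<Otimes>\<^sub>M lborel)"
      unfolding e_def case_prod_unfold by measurable
    define g where "g \<omega> = \<bar>Y t \<omega> - Y s \<omega> - c $ \<phi> s \<omega> * h\<bar>" for \<omega>
    have gm [measurable]: "g \<in> borel_measurable M"
    proof -
      have [measurable]: "(\<lambda>\<omega>. c $ \<phi> s \<omega>) \<in> borel_measurable M"
        by (rule measurable_compose[OF phase_measurable[OF sh(1)] rate_measurable])
      have [measurable]: "Y t \<in> borel_measurable M" "Y s \<in> borel_measurable M" using sh t by (auto intro: level_measurable)
      show ?thesis unfolding g_def by measurable
    qed
    have pt: "ennreal (g \<omega>) \<le> (\<integral>\<^sup>+u. e \<omega> u \<partial>lborel)" if \<omega>: "\<omega> \<in> space M" for \<omega>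
    proof -
      have "g \<omega> \<le> (LBINT u:{s<..t}. \<bar>c $ \<phi> u \<omega> - c $ \<phi> s \<omega>\<bar>)"
        unfolding g_def using level_increment_abs[OF \<omega> sh(1) t(2), of "c $ \<phi> s \<omega>"] by (simp add: t_def)
      also have "\<dots> \<le> (LBINT u:{s<..t}. (2 * norm c) * (if \<phi> u \<omega> = \<phi> s \<omega> then 0 else 1))"
      proof (rule set_integral_mono)
        show "set_integrable lborel {s<..t} (\<lambda>u. \<bar>c $ \<phi> u \<omega> - c $ \<phi> s \<omega>\<bar>)"
          using path_set_integrable[OF \<omega> st, of "\<lambda>j. \<bar>c $ j - c $ \<phi> s \<omega>\<bar>"] by simp
        show "set_integrable lborel {s<..t} (\<lambda>u. 2 * norm c * (if \<phi> u \<omega> = \<phi> s \<omega> then 0 else 1))"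
          using path_set_integrable[OF \<omega> st, of "\<lambda>j. 2 * norm c * (if j = \<phi> s \<omega> then 0 else 1)"] by simp
        show "\<bar>c $ \<phi> u \<omega> - c $ \<phi> s \<omega>\<bar> \<le> 2 * norm c * (if \<phi> u \<omega> = \<phi> s \<omega> then 0 else 1)" for u
          using component_le_norm_cart[of c "\<phi> u \<omega>"] component_le_norm_cart[of c "\<phi> s \<omega>"] by auto
      qed
      finally have "ennreal (g \<omega>) \<le> ennreal (LBINT u:{s<..t}. (2 * norm c) * (if \<phi> u \<omega> = \<phi> s \<omega> then 0 else 1))"
        by (rule ennreal_leI)
      also have "\<dots> = (\<integral>\<^sup>+u. ennreal (indicat_real {s<..t} u *\<^sub>R ((2 * norm c) * (if \<phi> u \<omega> = \<phi> s \<omega> then 0 else 1))) \<partial>lborel)"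
        unfolding set_lebesgue_integral_def
        by (rule nn_integral_eq_integral[symmetric])
           (use path_set_integrable[OF \<omega> st, of "\<lambda>j. 2 * norm c * (if j = \<phi> s \<omega> then 0 else 1)"] in \<open>auto simp: set_integrable_def\<close>)
      also have "\<dots> = (\<integral>\<^sup>+u. e \<omega> u \<partial>lborel)"
        unfolding e_def using sh by (intro nn_integral_cong) (auto simp: indicator_def min_def max_def)
      finally show ?thesis .
    qed
    have inner: "(\<integral>\<^sup>+\<omega>. e \<omega> u \<partial>M) \<le> ennreal (2 * norm c * (C * h)) * indicator {s<..t} u" for u
    proof (cases "u \<in> {s<..t}")
      case True
      have ms: "{\<omega>\<in>space M. \<phi> u \<omega> \<noteq> \<phi> s \<omega>} \<in> sets M"
      proof -
        have "u \<ge> 0" using True sh by auto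
        then have "{\<omega>\<in>space M. \<phi> u \<omega> \<noteq> \<phi> s \<omega>} = space M - (\<Union>i\<in>UNIV. {\<omega>\<in>space M. \<phi> u \<omega> = i \<and> \<phi> s \<omega> = i})" by auto
        moreover have "{\<omega>\<in>space M. \<phi> u \<omega> = i \<and> \<phi> s \<omega> = i} \<in> sets M" for i using \<open>u \<ge> 0\<close> sh by (intro phase2_sets)
        ultimately show ?thesis by (auto intro!: sets.Diff sets.finite_UN)
      qed
      have "(\<integral>\<^sup>+\<omega>. e \<omega> u \<partial>M) = (\<integral>\<^sup>+\<omega>. ennreal (2 * norm c) * indicator {\<omega>\<in>space M. \<phi> u \<omega> \<noteq> \<phi> s \<omega>} \<omega> \<partial>M)"
        unfolding e_def using True sh by (intro nn_integral_cong) (auto simp: indicator_def min_def max_def)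
      also have "\<dots> = ennreal (2 * norm c) * emeasure M {\<omega>\<in>space M. \<phi> u \<omega> \<noteq> \<phi> s \<omega>}"
        using ms by (rule nn_integral_cmult_indicator)
      also have "\<dots> = ennreal (2 * norm c * measure M {\<omega>\<in>space M. \<phi> u \<omega> \<noteq> \<phi> s \<omega>})"
        by (simp add: emeasure_eq_measure ennreal_mult)
      also have "\<dots> \<le> ennreal (2 * norm c * (C * h))"
      proof -
        have "measure M {\<omega>\<in>space M. \<phi> u \<omega> \<noteq> \<phi> s \<omega>} \<le> C * (u - s)" using C(2)[of s u] True sh by (auto simp: t_def)
        also have "\<dots> \<le> C * h" using True C(1) by (intro mult_left_mono) (auto simp: t_def)
        finally show ?thesis by (intro ennreal_leI mult_left_mono) auto
      qed
      finally show ?thesis using True by simp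
    qed (simp add: e_def)
    have "(\<integral>\<^sup>+\<omega>. ennreal (g \<omega>) \<partial>M) \<le> (\<integral>\<^sup>+\<omega>. (\<integral>\<^sup>+u. e \<omega> u \<partial>lborel) \<partial>M)"
      by (intro nn_integral_mono pt)
    also have "\<dots> = (\<integral>\<^sup>+u. (\<integral>\<^sup>+\<omega>. e \<omega> u \<partial>M) \<partial>lborel)"
      using LM.Fubini'[OF em] by simp
    also have "\<dots> \<le> (\<integral>\<^sup>+u. ennreal (2 * norm c * (C * h)) * indicator {s<..t} u \<partial>lborel)"
      by (intro nn_integral_mono inner)
    also have "\<dots> = ennreal (2 * norm c * (C * h)) * emeasure lborel {s<..t}"
      by (rule nn_integral_cmult_indicator) simp
    also have "\<dots> = ennreal (2 * norm c * (C * h) * h)"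
      using t C(1) sh by (simp add: t_def ennreal_mult[symmetric])
    finally have le: "(\<integral>\<^sup>+\<omega>. ennreal (g \<omega>) \<partial>M) \<le> ennreal (2 * norm c * (C * h) * h)" .
    have "(\<integral>\<omega>. g \<omega> \<partial>M) = enn2real (\<integral>\<^sup>+\<omega>. ennreal (g \<omega>) \<partial>M)"
      by (rule integral_eq_nn_integral[OF gm]) (simp add: g_def)
    also have "\<dots> \<le> 2 * norm c * (C * h) * h"
      using le C(1) sh by (simp add: enn2real_leI)
    finally show "(\<integral>\<omega>. \<bar>Y (s + h) \<omega> - Y s \<omega> - c $ \<phi> s \<omega> * h\<bar> \<partial>M) \<le> 2 * norm c * C * h\<^sup>2"
      by (simp add: g_def t_def power2_eq_square mult_ac)
  qed
qed

end

section \<open>Dynkin's inequality at the exit from a strip\<close>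

lemma measurable_state_function:
  fixes f :: "real \<Rightarrow> 's::finite \<Rightarrow> real"
  assumes f: "\<And>k. continuous_on UNIV (\<lambda>y. f y k)" and y: "y \<in> borel_measurable N"
    and p: "p \<in> N \<rightarrow>\<^sub>M count_space UNIV"
  shows "(\<lambda>\<omega>. f (y \<omega>) (p \<omega>)) \<in> borel_measurable N"
proof (rule measurable_compose_countable'[where f = "\<lambda>k \<omega>. f (y \<omega>) k" and g = p and I = UNIV])
  show "(\<lambda>\<omega>. f (y \<omega>) k) \<in> borel_measurable N" for k
    using measurable_compose[OF y borel_measurable_continuous_onI[OF f]] .
qed (use p in \<open>auto intro: countable_finite\<close>)

context fluid_process
begin

lemma level_range:
  assumes "\<omega> \<in> space M" "0 \<le> s" "s \<le> T" shows "\<bar>Y s \<omega>\<bar> \<le> norm c * T"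
proof -
  have "\<bar>Y s \<omega>\<bar> \<le> norm c * s" using level_lipschitz[OF assms(1), of 0 s] assms by (simp add: level_zero)
  also have "\<dots> \<le> norm c * T" using assms by (intro mult_left_mono) auto
  finally show ?thesis .
qed

lemma integrable_bounded:
  fixes g :: "'w \<Rightarrow> real"
  assumes "g \<in> borel_measurable M" "\<And>\<omega>. \<omega> \<in> space M \<Longrightarrow> \<bar>g \<omega>\<bar> \<le> K"
  shows "integrable M g"
  by (rule integrable_const_bound[where B = K]) (use assms in auto)

text \<open>Replacing the level at the end of the step by its linear prediction costs
  \<open>O(h\<^sup>2)\<close> by \<open>expected_increment_error\<close>; then the Markov property replaces the phase by its conditional
  law, and \<open>semigroup_step\<close> applies.\<close>
lemma one_step:
  assumes f: "C2 f f1 f2" and T: "T \<ge> 0"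
    and harm: "\<And>y i. y \<in> {0..b} \<Longrightarrow> \<kappa> \<le> c $ i * f1 y i + (\<Sum>j\<in>UNIV. A $ i $ j * f y j)"
  obtains C where "C \<ge> 0" "\<And>(s::real) (h::real) B. 0 \<le> s \<Longrightarrow> 0 \<le> h \<Longrightarrow> s + h \<le> T \<Longrightarrow> B \<in> sets (past s) \<Longrightarrow>
    \<forall>\<omega>\<in>B. Y s \<omega> \<in> {0..b} \<Longrightarrow>
    \<kappa> * h * measure M B - C * h\<^sup>2 \<le>
      (\<integral>\<omega>. indicator B \<omega> * (f (Y (s + h) \<omega>) (\<phi> (s + h) \<omega>) - f (Y s \<omega>) (\<phi> s \<omega>)) \<partial>M)"
proof -
  define R where "R = norm c * T"
  obtain m where m: "m \<ge> 0" "\<And>y i. y \<in> {-R..R} \<Longrightarrow> \<bar>f y i\<bar> \<le> m" "\<And>y i. y \<in> {-R..R} \<Longrightarrow> \<bar>f1 y i\<bar> \<le> m"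
    "\<And>y i. y \<in> {-R..R} \<Longrightarrow> \<bar>f2 y i\<bar> \<le> m"
    by (rule C2_bounds[OF f, of R]) (rule that)
  obtain C1 where C1: "C1 \<ge> 0" "\<And>h y j. 0 \<le> h \<Longrightarrow> h \<le> T \<Longrightarrow> y \<in> {-R..R} \<Longrightarrow> y + c $ j * h \<in> {-R..R} \<Longrightarrow>
    \<bar>(\<Sum>k\<in>UNIV. mat_exp (h *\<^sub>R A) $ j $ k * f (y + c $ j * h) k) - f y j
      - h * (c $ j * f1 y j + (\<Sum>k\<in>UNIV. A $ j $ k * f y k))\<bar> \<le> C1 * h\<^sup>2"
    by (rule semigroup_step[OF f, of T R c A]) (rule that)
  obtain Ce where Ce: "Ce \<ge> 0" "\<And>(s::real) (h::real). 0 \<le> s \<Longrightarrow> 0 \<le> h \<Longrightarrow> h \<le> T \<Longrightarrow>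
    (\<integral>\<omega>. \<bar>Y (s + h) \<omega> - Y s \<omega> - c $ \<phi> s \<omega> * h\<bar> \<partial>M) \<le> Ce * h\<^sup>2"
    by (rule expected_increment_error[of T]) (rule that)
  show ?thesis
  proof (rule that[of "C1 + m * Ce"])
    show "C1 + m * Ce \<ge> 0" using C1(1) m(1) Ce(1) by simp
    fix s h :: real and B
    assume sh: "0 \<le> s" "0 \<le> h" "s + h \<le> T" and B: "B \<in> sets (past s)" and BY: "\<forall>\<omega>\<in>B. Y s \<omega> \<in> {0..b}"
    have hT: "h \<le> T" using sh by simp
    have BM [measurable]: "B \<in> sets M" using B by (rule past_sets)
    have BS: "\<omega> \<in> space M" if "\<omega> \<in> B" for \<omega> using that sets.sets_into_space[OF BM] by auto
    have [measurable]: "Y s \<in> borel_measurable M" "Y (s + h) \<in> borel_measurable M"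
      "\<phi> s \<in> M \<rightarrow>\<^sub>M count_space UNIV" "\<phi> (s + h) \<in> M \<rightarrow>\<^sub>M count_space UNIV"
      using sh by (auto intro!: level_measurable phase_measurable)
    have cm [measurable]: "(\<lambda>\<omega>. c $ \<phi> s \<omega>) \<in> borel_measurable M"
      by (rule measurable_compose[OF _ rate_measurable]) measurable
    note cont = C2_continuous(1)[OF f]
    have R1: "Y s \<omega> \<in> {-R..R}" "Y (s + h) \<omega> \<in> {-R..R}" if "\<omega> \<in> space M" for \<omega>
      using level_range[OF that, of s T] level_range[OF that, of "s + h" T] sh by (auto simp: R_def abs_le_iff)
    have R2: "Y s \<omega> + c $ j * h \<in> {-R..R}" if "\<omega> \<in> space M" for \<omega> j
    proof -
      have "\<bar>c $ j * h\<bar> \<le> norm c * h" using component_le_norm_cart[of c j] sh by (simp add: abs_mult mult_right_mono)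
      moreover have "\<bar>Y s \<omega>\<bar> \<le> norm c * s" using level_range[OF that, of s s] sh by simp
      moreover have "norm c * s + norm c * h \<le> R" unfolding R_def distrib_left[symmetric] using sh by (intro mult_left_mono) auto
      ultimately show ?thesis by (auto simp: abs_le_iff)
    qed
    define X where "X \<omega> = f (Y (s + h) \<omega>) (\<phi> (s + h) \<omega>)" for \<omega>
    define Z where "Z \<omega> = f (Y s \<omega>) (\<phi> s \<omega>)" for \<omega>
    \<comment> \<open>\<open>V\<close> is \<open>f\<close> at the linearly predicted level, \<open>W\<close> its conditional expectation given the past.\<close>
    define V where "V \<omega> = f (Y s \<omega> + c $ \<phi> s \<omega> * h) (\<phi> (s + h) \<omega>)" for \<omega>
    define D where "D y j = (\<Sum>k\<in>UNIV. mat_exp (h *\<^sub>R A) $ j $ k * f (y + c $ j * h) k)" for y j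
    define W where "W \<omega> = D (Y s \<omega>) (\<phi> s \<omega>)" for \<omega>
    define err where "err \<omega> = \<bar>Y (s + h) \<omega> - Y s \<omega> - c $ \<phi> s \<omega> * h\<bar>" for \<omega>
    have Xm [measurable]: "X \<in> borel_measurable M" and Zm [measurable]: "Z \<in> borel_measurable M"
      and Vm [measurable]: "V \<in> borel_measurable M"
      unfolding X_def[abs_def] Z_def[abs_def] V_def[abs_def]
      by (rule measurable_state_function[OF cont]; measurable)+
    have errm [measurable]: "err \<in> borel_measurable M" unfolding err_def[abs_def] by measurable
    have bX: "\<bar>X \<omega>\<bar> \<le> m" "\<bar>Z \<omega>\<bar> \<le> m" "\<bar>V \<omega>\<bar> \<le> m" if "\<omega> \<in> space M" for \<omega>
      unfolding X_def Z_def V_def using m(2) R1[OF that] R2[OF that] by blast+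
    have berr: "\<bar>err \<omega>\<bar> \<le> R + R + R" if "\<omega> \<in> space M" for \<omega>
      using R1[OF that] R2[OF that, of "\<phi> s \<omega>"] unfolding err_def by auto
    have XV: "X \<omega> \<ge> V \<omega> - m * err \<omega>" if "\<omega> \<in> space M" for \<omega>
    proof -
      have "\<bar>X \<omega> - V \<omega>\<bar> \<le> m * \<bar>Y (s + h) \<omega> - (Y s \<omega> + c $ \<phi> s \<omega> * h)\<bar>"
        unfolding X_def V_def by (rule C2_lipschitz[OF f m(3) R1(2)[OF that] R2[OF that]])
      then show ?thesis by (simp add: err_def algebra_simps abs_le_iff)
    qed
    have intB: "integrable M (\<lambda>\<omega>. indicator B \<omega> * g \<omega>)" if "g \<in> borel_measurable M" "\<And>\<omega>. \<omega> \<in> space M \<Longrightarrow> \<bar>g \<omega>\<bar> \<le> K" for g :: "'w \<Rightarrow> real" and K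
    proof (rule integrable_bounded[where K = "\<bar>K\<bar>"])
      show "(\<lambda>\<omega>. indicator B \<omega> * g \<omega>) \<in> borel_measurable M" using that(1) by measurable
      show "\<bar>indicator B \<omega> * g \<omega>\<bar> \<le> \<bar>K\<bar>" if "\<omega> \<in> space M" for \<omega>
        using \<open>\<And>\<omega>. \<omega> \<in> space M \<Longrightarrow> \<bar>g \<omega>\<bar> \<le> K\<close>[OF that] by (auto simp: indicator_def)
    qed
    define I2 where "I2 j k = {\<omega>\<in>space M. \<phi> s \<omega> = j \<and> \<phi> (s + h) \<omega> = k}" for j k
    define I1 where "I1 j = {\<omega>\<in>space M. \<phi> s \<omega> = j}" for j
    have I2m [measurable]: "I2 j k \<in> sets M" and I1m [measurable]: "I1 j \<in> sets M" for j k
      unfolding I2_def I1_def using sh by (auto intro: phase_sets phase2_sets)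
    define G where "G j k \<omega> = indicat_real B \<omega> * f (Y s \<omega> + c $ j * h) k" for j k \<omega>
    have Gp: "G j k \<in> borel_measurable (past s)" for j k
    proof -
      have "Y s \<in> borel_measurable (past s)" using sh by (intro level_past) auto
      then have "(\<lambda>\<omega>. Y s \<omega> + c $ j * h) \<in> borel_measurable (past s)" by simp
      from measurable_compose[OF this borel_measurable_continuous_onI[OF cont]]
      have "(\<lambda>\<omega>. f (Y s \<omega> + c $ j * h) k) \<in> borel_measurable (past s)" .
      then show ?thesis unfolding G_def[abs_def] using B by simp
    qed
    have Gm [measurable]: "G j k \<in> borel_measurable M" for j k
      by (rule measurable_from_subalg[OF subalgebra_past Gp])
    have Gb: "\<bar>G j k \<omega>\<bar> \<le> m" if "\<omega> \<in> space M" for j k \<omega>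
      unfolding G_def using m(1) m(2)[OF R2[OF that]] by (auto simp: indicator_def)
    have Gi: "integrable M (\<lambda>\<omega>. G j k \<omega> * indicator S \<omega>)" if "S \<in> sets M" for j k S
    proof (rule integrable_bounded[where K = m])
      show "(\<lambda>\<omega>. G j k \<omega> * indicator S \<omega>) \<in> borel_measurable M" using that by measurable
      show "\<bar>G j k \<omega> * indicator S \<omega>\<bar> \<le> m" if "\<omega> \<in> space M" for \<omega>
        using Gb[OF that, of j k] m(1) by (auto simp: indicator_def)
    qed
    have "(\<integral>\<omega>. indicator B \<omega> * V \<omega> \<partial>M) = (\<integral>\<omega>. (\<Sum>j\<in>UNIV. \<Sum>k\<in>UNIV. G j k \<omega> * indicator (I2 j k) \<omega>) \<partial>M)"
    proof (rule Bochner_Integration.integral_cong)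
      fix \<omega> assume \<omega>: "\<omega> \<in> space M"
      have "(\<Sum>j\<in>UNIV. \<Sum>k\<in>UNIV. G j k \<omega> * indicator (I2 j k) \<omega>) =
          (\<Sum>j\<in>UNIV. if j = \<phi> s \<omega> then (\<Sum>k\<in>UNIV. if k = \<phi> (s + h) \<omega> then G j k \<omega> else 0) else 0)"
        using \<omega> by (intro sum.cong) (auto simp: I2_def indicator_def intro!: sum.cong)
      then show "indicator B \<omega> * V \<omega> = (\<Sum>j\<in>UNIV. \<Sum>k\<in>UNIV. G j k \<omega> * indicator (I2 j k) \<omega>)"
        by (simp add: G_def V_def)
    qed simp
    also have "\<dots> = (\<Sum>j\<in>UNIV. (\<integral>\<omega>. (\<Sum>k\<in>UNIV. G j k \<omega> * indicator (I2 j k) \<omega>) \<partial>M))"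
      by (intro Bochner_Integration.integral_sum Bochner_Integration.integrable_sum Gi I2m)
    also have "\<dots> = (\<Sum>j\<in>UNIV. \<Sum>k\<in>UNIV. (\<integral>\<omega>. G j k \<omega> * indicator (I2 j k) \<omega> \<partial>M))"
      by (intro sum.cong refl Bochner_Integration.integral_sum Gi I2m)
    also have "\<dots> = (\<Sum>j\<in>UNIV. \<Sum>k\<in>UNIV. mat_exp (h *\<^sub>R A) $ j $ k * (\<integral>\<omega>. G j k \<omega> * indicator (I1 j) \<omega> \<partial>M))"
      unfolding I2_def I1_def by (intro sum.cong refl past_markov_integral[OF sh(1,2) Gp Gb])
    also have "\<dots> = (\<Sum>j\<in>UNIV. \<Sum>k\<in>UNIV. (\<integral>\<omega>. mat_exp (h *\<^sub>R A) $ j $ k * (G j k \<omega> * indicator (I1 j) \<omega>) \<partial>M))"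
      by (intro sum.cong refl integral_mult_right_zero[symmetric])
    also have "\<dots> = (\<Sum>j\<in>UNIV. (\<integral>\<omega>. (\<Sum>k\<in>UNIV. mat_exp (h *\<^sub>R A) $ j $ k * (G j k \<omega> * indicator (I1 j) \<omega>)) \<partial>M))"
      by (intro sum.cong refl Bochner_Integration.integral_sum[symmetric] integrable_mult_right Gi I1m)
    also have "\<dots> = (\<integral>\<omega>. (\<Sum>j\<in>UNIV. \<Sum>k\<in>UNIV. mat_exp (h *\<^sub>R A) $ j $ k * (G j k \<omega> * indicator (I1 j) \<omega>)) \<partial>M)"
      by (intro Bochner_Integration.integral_sum[symmetric] Bochner_Integration.integrable_sum integrable_mult_right Gi I1m)
    also have "\<dots> = (\<integral>\<omega>. indicator B \<omega> * W \<omega> \<partial>M)"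
    proof (rule Bochner_Integration.integral_cong)
      fix \<omega> assume \<omega>: "\<omega> \<in> space M"
      have "(\<Sum>j\<in>UNIV. \<Sum>k\<in>UNIV. mat_exp (h *\<^sub>R A) $ j $ k * (G j k \<omega> * indicator (I1 j) \<omega>)) =
        (\<Sum>j\<in>UNIV. if j = \<phi> s \<omega> then (\<Sum>k\<in>UNIV. mat_exp (h *\<^sub>R A) $ j $ k * G j k \<omega>) else 0)"
        using \<omega> by (intro sum.cong) (auto simp: I1_def indicator_def)
      then show "(\<Sum>j\<in>UNIV. \<Sum>k\<in>UNIV. mat_exp (h *\<^sub>R A) $ j $ k * (G j k \<omega> * indicator (I1 j) \<omega>)) = indicator B \<omega> * W \<omega>"
        by (simp add: G_def W_def D_def sum_distrib_left mult_ac)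
    qed simp
    finally have VW: "(\<integral>\<omega>. indicator B \<omega> * V \<omega> \<partial>M) = (\<integral>\<omega>. indicator B \<omega> * W \<omega> \<partial>M)" .
    have Dcont: "continuous_on UNIV (\<lambda>y. D y j)" for j
      unfolding D_def by (intro continuous_intros continuous_on_compose2[OF cont]) auto
    have Wm [measurable]: "W \<in> borel_measurable M"
      unfolding W_def[abs_def] by (rule measurable_state_function[OF Dcont]; measurable)
    have WZ: "W \<omega> \<ge> Z \<omega> + (\<kappa> * h - C1 * h\<^sup>2)" if \<omega>: "\<omega> \<in> B" for \<omega>
    proof -
      have \<omega>': "\<omega> \<in> space M" by (rule BS[OF \<omega>])
      have "\<bar>W \<omega> - Z \<omega> - h * (c $ \<phi> s \<omega> * f1 (Y s \<omega>) (\<phi> s \<omega>) + (\<Sum>k\<in>UNIV. A $ \<phi> s \<omega> $ k * f (Y s \<omega>) k))\<bar> \<le> C1 * h\<^sup>2"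
        unfolding W_def Z_def D_def by (rule C1(2)[OF sh(2) hT R1(1)[OF \<omega>'] R2[OF \<omega>']])
      moreover have "h * \<kappa> \<le> h * (c $ \<phi> s \<omega> * f1 (Y s \<omega>) (\<phi> s \<omega>) + (\<Sum>k\<in>UNIV. A $ \<phi> s \<omega> $ k * f (Y s \<omega>) k))"
        using harm[OF BY[rule_format, OF \<omega>], of "\<phi> s \<omega>"] sh by (intro mult_left_mono) auto
      ultimately show ?thesis unfolding abs_le_iff by (simp add: mult.commute)
    qed
    have Wb: "\<bar>W \<omega>\<bar> \<le> (\<Sum>j\<in>UNIV. \<Sum>k\<in>UNIV. \<bar>mat_exp (h *\<^sub>R A) $ j $ k\<bar> * m)" if "\<omega> \<in> space M" for \<omega>
    proof -
      have "\<bar>W \<omega>\<bar> \<le> (\<Sum>k\<in>UNIV. \<bar>mat_exp (h *\<^sub>R A) $ \<phi> s \<omega> $ k\<bar> * m)"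
        unfolding W_def D_def
        by (rule order_trans[OF sum_abs]) (auto simp: abs_mult intro!: sum_mono mult_left_mono m(2) R2[OF that])
      also have "\<dots> \<le> (\<Sum>j\<in>UNIV. \<Sum>k\<in>UNIV. \<bar>mat_exp (h *\<^sub>R A) $ j $ k\<bar> * m)"
        using m(1) by (intro member_le_sum[of "\<phi> s \<omega>" UNIV "\<lambda>j. \<Sum>k\<in>UNIV. \<bar>mat_exp (h *\<^sub>R A) $ j $ k\<bar> * m"] sum_nonneg) auto
      finally show ?thesis .
    qed
    note iX = intB[OF Xm bX(1)] and iZ = intB[OF Zm bX(2)] and iV = intB[OF Vm bX(3)] and iW = intB[OF Wm Wb]
    have ierr: "integrable M (\<lambda>\<omega>. m * err \<omega>)" using integrable_bounded[OF errm berr] by simp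
    have "(\<integral>\<omega>. indicator B \<omega> * V \<omega> - m * err \<omega> \<partial>M) \<le> (\<integral>\<omega>. indicator B \<omega> * X \<omega> \<partial>M)"
    proof (rule integral_mono)
      fix \<omega> assume \<omega>: "\<omega> \<in> space M"
      have "m * err \<omega> \<ge> 0" using m(1) by (simp add: err_def)
      then show "indicator B \<omega> * V \<omega> - m * err \<omega> \<le> indicator B \<omega> * X \<omega>"
        using XV[OF \<omega>] by (auto simp: indicator_def)
    qed (use iX iV ierr in auto)
    moreover have "(\<integral>\<omega>. indicator B \<omega> * V \<omega> - m * err \<omega> \<partial>M) = (\<integral>\<omega>. indicator B \<omega> * W \<omega> \<partial>M) - m * (\<integral>\<omega>. err \<omega> \<partial>M)"
      using iV ierr VW by (simp add: Bochner_Integration.integral_diff)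
    moreover have "m * (\<integral>\<omega>. err \<omega> \<partial>M) \<le> m * (Ce * h\<^sup>2)"
      unfolding err_def using m(1) by (intro mult_left_mono Ce(2) sh hT)
    moreover have "(\<integral>\<omega>. indicator B \<omega> * Z \<omega> + indicator B \<omega> * (\<kappa> * h - C1 * h\<^sup>2) \<partial>M) \<le> (\<integral>\<omega>. indicator B \<omega> * W \<omega> \<partial>M)"
    proof (rule integral_mono)
      show "integrable M (\<lambda>\<omega>. indicator B \<omega> * Z \<omega> + indicator B \<omega> * (\<kappa> * h - C1 * h\<^sup>2))"
        using iZ by (intro Bochner_Integration.integrable_add) (auto simp: less_top[symmetric])
    qed (use iW WZ in \<open>auto simp: indicator_def\<close>)
    moreover have "(\<integral>\<omega>. indicator B \<omega> * Z \<omega> + indicator B \<omega> * (\<kappa> * h - C1 * h\<^sup>2) \<partial>M) =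
        (\<integral>\<omega>. indicator B \<omega> * Z \<omega> \<partial>M) + measure M B * (\<kappa> * h - C1 * h\<^sup>2)"
      using iZ by (subst Bochner_Integration.integral_add) (auto simp: less_top[symmetric])
    moreover have "measure M B * (\<kappa> * h - C1 * h\<^sup>2) \<ge> \<kappa> * h * measure M B - C1 * h\<^sup>2"
    proof -
      have "measure M B * (C1 * h\<^sup>2) \<le> C1 * h\<^sup>2" using C1(1) prob_le_1[of B] by (intro mult_left_le_one_le) auto
      then show ?thesis by (simp add: algebra_simps)
    qed
    moreover have "(\<integral>\<omega>. indicator B \<omega> * (X \<omega> - Z \<omega>) \<partial>M) = (\<integral>\<omega>. indicator B \<omega> * X \<omega> \<partial>M) - (\<integral>\<omega>. indicator B \<omega> * Z \<omega> \<partial>M)"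
      using iX iZ by (simp add: right_diff_distrib Bochner_Integration.integral_diff)
    ultimately have "\<kappa> * h * measure M B - C1 * h\<^sup>2 - m * (Ce * h\<^sup>2) \<le> (\<integral>\<omega>. indicator B \<omega> * (X \<omega> - Z \<omega>) \<partial>M)"
      by linarith
    then show "\<kappa> * h * measure M B - (C1 + m * Ce) * h\<^sup>2 \<le>
      (\<integral>\<omega>. indicator B \<omega> * (f (Y (s + h) \<omega>) (\<phi> (s + h) \<omega>) - f (Y s \<omega>) (\<phi> s \<omega>)) \<partial>M)"
      by (simp add: X_def Z_def algebra_simps)
  qed
qed

end

context fluid_process
begin

text \<open>Touching an edge does not count as leaving, so the level is still in the strip at the exit time. The
  truncation at \<open>T\<close> keeps it finite.\<close>
definition exit_time :: "real \<Rightarrow> real \<Rightarrow> 'w \<Rightarrow> real" where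
  "exit_time b T \<omega> = Inf (insert T {s. 0 \<le> s \<and> s \<le> T \<and> Y s \<omega> \<notin> {0..b}})"

definition grid_index :: "real \<Rightarrow> real \<Rightarrow> nat \<Rightarrow> 'w \<Rightarrow> nat" where
  "grid_index b T N \<omega> = (LEAST k. k = N \<or> Y (real k * (T / real N)) \<omega> \<notin> {0..b})"

definition grid_time :: "real \<Rightarrow> real \<Rightarrow> nat \<Rightarrow> 'w \<Rightarrow> real" where
  "grid_time b T N \<omega> = real (grid_index b T N \<omega>) * (T / real N)"

lemma exit_set_bdd: "bdd_below (insert T {s. 0 \<le> s \<and> s \<le> T \<and> Y s \<omega> \<notin> {0..b}})"
proof (rule bdd_belowI[of _ "min 0 T"])
  fix x assume "x \<in> insert T {s. 0 \<le> s \<and> s \<le> T \<and> Y s \<omega> \<notin> {0..b}}"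
  then show "min 0 T \<le> x" by auto
qed

lemma exit_time_bounds:
  assumes "T \<ge> 0" shows "0 \<le> exit_time b T \<omega>" "exit_time b T \<omega> \<le> T"
proof -
  show "0 \<le> exit_time b T \<omega>" unfolding exit_time_def using assms by (intro cInf_greatest) auto
  show "exit_time b T \<omega> \<le> T" unfolding exit_time_def by (intro cInf_lower exit_set_bdd) simp
qed

lemma exit_time_le:
  assumes "0 \<le> s" "s \<le> T" "Y s \<omega> \<notin> {0..b}" shows "exit_time b T \<omega> \<le> s"
  unfolding exit_time_def by (intro cInf_lower exit_set_bdd) (use assms in simp)

lemma before_exit:
  assumes \<omega>: "\<omega> \<in> space M" and T: "T \<ge> 0" "b \<ge> 0" and s: "0 \<le> s" "s \<le> exit_time b T \<omega>"
  shows "Y s \<omega> \<in> {0..b}"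
proof (cases "s = 0")
  case True then show ?thesis using T by (simp add: level_zero)
next
  case False
  let ?S = "exit_time b T \<omega>"
  have S: "0 < ?S" "?S \<le> T" using False s exit_time_bounds[OF T(1), of b \<omega>] by auto
  have lt: "Y r \<omega> \<in> {0..b}" if "0 \<le> r" "r < ?S" for r
    using exit_time_le[of r T \<omega> b] that S by (meson less_imp_le linorder_not_less order_trans)
  have "closed {r \<in> {0..?S}. Y r \<omega> \<in> {0..b}}"
    using continuous_closed_preimage[OF continuous_on_subset[OF level_continuous[OF \<omega>], of "{0..?S}"], of "{0..b}"]
    by (auto simp: vimage_def Int_def)
  moreover have "{0..<?S} \<subseteq> {r \<in> {0..?S}. Y r \<omega> \<in> {0..b}}" using lt by auto
  ultimately have "closure {0..<?S} \<subseteq> {r \<in> {0..?S}. Y r \<omega> \<in> {0..b}}" by (intro closure_minimal)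
  then show ?thesis using S s by auto
qed

lemma after_exit:
  assumes \<omega>: "\<omega> \<in> space M" and T: "T \<ge> 0" "b \<ge> 0" and S: "exit_time b T \<omega> < T" and \<delta>: "\<delta> > 0"
  obtains s where "exit_time b T \<omega> < s" "s < exit_time b T \<omega> + \<delta>" "s \<le> T" "Y s \<omega> \<notin> {0..b}"
proof -
  have "Inf (insert T {s. 0 \<le> s \<and> s \<le> T \<and> Y s \<omega> \<notin> {0..b}}) < min T (exit_time b T \<omega> + \<delta>)"
    unfolding exit_time_def[symmetric] using S \<delta> by simp
  from cInf_lessD[OF _ this] obtain s where s: "0 \<le> s" "s \<le> T" "Y s \<omega> \<notin> {0..b}" "s < exit_time b T \<omega> + \<delta>" by auto
  moreover have "exit_time b T \<omega> < s" using before_exit[OF \<omega> T s(1)] s(3) by force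
  ultimately show ?thesis using that by blast
qed

lemma grid_index_le: "grid_index b T N \<omega> \<le> N"
  unfolding grid_index_def by (rule Least_le) simp

lemma less_grid_index:
  assumes "k < N"
  shows "k < grid_index b T N \<omega> \<longleftrightarrow> (\<forall>m\<le>k. Y (real m * (T / real N)) \<omega> \<in> {0..b})"
proof
  assume k: "k < grid_index b T N \<omega>"
  show "\<forall>m\<le>k. Y (real m * (T / real N)) \<omega> \<in> {0..b}"
  proof (intro allI impI)
    fix m assume "m \<le> k"
    then have "m < grid_index b T N \<omega>" using k by simp
    from not_less_Least[OF this[unfolded grid_index_def]] show "Y (real m * (T / real N)) \<omega> \<in> {0..b}" by simp
  qed
next
  assume good: "\<forall>m\<le>k. Y (real m * (T / real N)) \<omega> \<in> {0..b}"
  let ?P = "\<lambda>k. k = N \<or> Y (real k * (T / real N)) \<omega> \<notin> {0..b}"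
  have "?P (grid_index b T N \<omega>)" unfolding grid_index_def by (rule LeastI[of ?P N]) simp
  then show "k < grid_index b T N \<omega>" using good assms by (metis linorder_not_less)
qed

lemma grid_time_bounds:
  assumes "T \<ge> 0" "N > 0" shows "0 \<le> grid_time b T N \<omega>" "grid_time b T N \<omega> \<le> T"
proof -
  show "0 \<le> grid_time b T N \<omega>" using assms by (simp add: grid_time_def)
  have "real (grid_index b T N \<omega>) * (T / real N) \<le> real N * (T / real N)"
    using grid_index_le[of b T N \<omega>] assms by (intro mult_right_mono) auto
  then show "grid_time b T N \<omega> \<le> T" using assms by (simp add: grid_time_def)
qed

lemma exit_le_grid_time:
  assumes \<omega>: "\<omega> \<in> space M" and T: "T \<ge> 0" "b \<ge> 0" and N: "N > 0"
  shows "exit_time b T \<omega> \<le> grid_time b T N \<omega>"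
proof (cases "grid_index b T N \<omega> = N")
  case True
  then show ?thesis using exit_time_bounds(2)[OF T(1), of b \<omega>] N by (simp add: grid_time_def)
next
  case False
  let ?P = "\<lambda>k. k = N \<or> Y (real k * (T / real N)) \<omega> \<notin> {0..b}"
  have "?P (grid_index b T N \<omega>)" unfolding grid_index_def by (rule LeastI[of ?P N]) simp
  then have "Y (grid_time b T N \<omega>) \<omega> \<notin> {0..b}" using False by (simp add: grid_time_def)
  then show ?thesis using exit_time_le grid_time_bounds[OF T(1) N] by blast
qed

text \<open>Shortly after the exit time there are times outside the strip, and by continuity a whole
  interval of them; a fine enough grid meets it.\<close>
lemma grid_time_tendsto:
  assumes \<omega>: "\<omega> \<in> space M" and T: "T > 0" "b \<ge> 0"
  shows "(\<lambda>n. grid_time b T (Suc n) \<omega>) \<longlonglongrightarrow> exit_time b T \<omega>"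
proof (rule LIMSEQ_I)
  fix \<delta> :: real assume \<delta>: "\<delta> > 0"
  let ?S = "exit_time b T \<omega>"
  have T0: "T \<ge> 0" using T by simp
  have ge: "?S \<le> grid_time b T (Suc n) \<omega>" for n using exit_le_grid_time[OF \<omega> T0 T(2)] by simp
  show "\<exists>no. \<forall>n\<ge>no. norm (grid_time b T (Suc n) \<omega> - ?S) < \<delta>"
  proof (cases "?S < T")
    case False
    then have "?S = T" using exit_time_bounds(2)[OF T0, of b \<omega>] by simp
    then have "grid_time b T (Suc n) \<omega> = ?S" for n using ge[of n] grid_time_bounds(2)[OF T0, of "Suc n" b \<omega>] by simp
    then show ?thesis using \<delta> by simp
  next
    case True
    obtain s where s: "?S < s" "s < ?S + \<delta>" "s \<le> T" "Y s \<omega> \<notin> {0..b}" using after_exit[OF \<omega> T0 T(2) True \<delta>] .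
    have s0: "s > 0" using s(1) exit_time_bounds(1)[OF T0, of b \<omega>] by simp
    obtain \<eta> where \<eta>: "\<eta> > 0" "\<And>r. r \<ge> 0 \<Longrightarrow> \<bar>r - s\<bar> < \<eta> \<Longrightarrow> Y r \<omega> \<notin> {0..b}"
    proof -
      have "open (- {0..b})" by auto
      moreover have "isCont (\<lambda>t. Y t \<omega>) s"
        using continuous_on_interior[OF level_continuous[OF \<omega>], of s] s0 by simp
      ultimately have "\<forall>\<^sub>F r in nhds s. Y r \<omega> \<in> - {0..b}"
        using s(4) by (metis Compl_iff topological_tendstoD isCont_def continuous_at_imp_continuous_at_within tendsto_at_iff_tendsto_nhds)
      then obtain \<eta> where "\<eta> > 0" "\<And>r. dist r s < \<eta> \<Longrightarrow> Y r \<omega> \<in> - {0..b}" by (auto simp: eventually_nhds_metric)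
      then show ?thesis using that[of \<eta>] by (auto simp: dist_real_def)
    qed
    obtain n0 where n0: "1 / real (Suc n0) < \<eta> / T" using nat_approx_posE[of "\<eta> / T"] \<eta> T by auto
    show ?thesis
    proof (intro exI allI impI)
      fix n assume n: "n \<ge> n0"
      define h where "h = T / real (Suc n)"
      have h0: "h > 0" using T by (simp add: h_def)
      have "1 / real (Suc n) \<le> 1 / real (Suc n0)" using n by (simp add: frac_le)
      then have "1 / real (Suc n) < \<eta> / T" using n0 by simp
      then have h\<eta>: "h < \<eta>" using T by (simp add: h_def pos_less_divide_eq mult.commute)
      define k where "k = nat \<lfloor>s / h\<rfloor>"
      have k: "real k \<le> s / h" "s / h < real k + 1" using s0 h0 by (auto simp: k_def)
      have kh: "real k * h \<le> s" "s - h < real k * h"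
        using k h0 by (simp_all add: pos_le_divide_eq pos_divide_less_eq algebra_simps)
      have "real k * h \<le> real (Suc n) * h" using kh s(3) h_def by simp
      then have kn: "k \<le> Suc n" using h0 by (simp only: mult_le_cancel_right_pos of_nat_le_iff)
      have "Y (real k * h) \<omega> \<notin> {0..b}" using kh h\<eta> h0 by (intro \<eta>(2)) auto
      then have "grid_index b T (Suc n) \<omega> \<le> k" unfolding grid_index_def by (intro Least_le) (simp add: h_def)
      then have "grid_time b T (Suc n) \<omega> \<le> real k * h"
        unfolding grid_time_def h_def[symmetric] using h0 by (intro mult_right_mono) auto
      then show "norm (grid_time b T (Suc n) \<omega> - ?S) < \<delta>" using ge[of n] kh s by simp
    qed
  qed
qed

text \<open>Grid times approach the exit time from the right, where the phase is constant for a while.\<close>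
lemma phase_grid_tendsto:
  assumes \<omega>: "\<omega> \<in> space M" and T: "T > 0" "b \<ge> 0"
  shows "\<exists>K. \<forall>n\<ge>K. \<phi> (grid_time b T (Suc n) \<omega>) \<omega> = \<phi> (exit_time b T \<omega>) \<omega>"
proof -
  have T0: "T \<ge> 0" using T by simp
  from right_continuous[OF \<omega> exit_time_bounds(1)[OF T0, of b \<omega>]] obtain \<delta> where
    \<delta>: "\<delta> > 0" "\<And>r. r \<in> {exit_time b T \<omega>..<exit_time b T \<omega> + \<delta>} \<Longrightarrow> \<phi> r \<omega> = \<phi> (exit_time b T \<omega>) \<omega>" by blast
  from LIMSEQ_D[OF grid_time_tendsto[OF assms] \<delta>(1)] obtain K where
    K: "\<And>n. n \<ge> K \<Longrightarrow> norm (grid_time b T (Suc n) \<omega> - exit_time b T \<omega>) < \<delta>" by blast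
  have "\<phi> (grid_time b T (Suc n) \<omega>) \<omega> = \<phi> (exit_time b T \<omega>) \<omega>" if "n \<ge> K" for n
    using K[OF that] exit_le_grid_time[OF \<omega> T0 T(2), of "Suc n"] by (intro \<delta>(2)) auto
  then show ?thesis by blast
qed

lemma grid_index_measurable:
  assumes "T \<ge> 0" shows "grid_index b T N \<in> M \<rightarrow>\<^sub>M count_space UNIV"
proof -
  have [measurable]: "Y (real k * (T / real N)) \<in> borel_measurable M" for k
    using assms by (intro level_measurable) simp
  show ?thesis unfolding grid_index_def[abs_def] by measurable
qed

lemma grid_state_measurable:
  assumes "T \<ge> 0"
  shows "(\<lambda>\<omega>. \<phi> (grid_time b T N \<omega>) \<omega>) \<in> M \<rightarrow>\<^sub>M count_space UNIV"
    "(\<lambda>\<omega>. Y (grid_time b T N \<omega>) \<omega>) \<in> borel_measurable M"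
    "grid_time b T N \<in> borel_measurable M"
  unfolding grid_time_def
  by (rule measurable_compose_countable[OF _ grid_index_measurable[OF assms], where f = "\<lambda>k \<omega>. \<phi> (real k * (T / real N)) \<omega>"],
      use assms in \<open>simp add: phase_measurable\<close>)
     (rule measurable_compose_countable[OF _ grid_index_measurable[OF assms], where f = "\<lambda>k \<omega>. Y (real k * (T / real N)) \<omega>"]
           measurable_compose_countable[OF _ grid_index_measurable[OF assms], where f = "\<lambda>k \<omega>. real k * (T / real N)"],
      use assms in \<open>simp add: level_measurable\<close>)+

lemma exit_state_measurable:
  assumes T: "T > 0" "b \<ge> 0"
  shows "(\<lambda>\<omega>. \<phi> (exit_time b T \<omega>) \<omega>) \<in> M \<rightarrow>\<^sub>M count_space UNIV"
    and "exit_time b T \<in> borel_measurable M"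
proof -
  have T0: "T \<ge> 0" using T by simp
  show "(\<lambda>\<omega>. \<phi> (exit_time b T \<omega>) \<omega>) \<in> M \<rightarrow>\<^sub>M count_space UNIV"
    by (rule measurable_discrete_limit[of "\<lambda>n \<omega>. \<phi> (grid_time b T (Suc n) \<omega>) \<omega>", OF grid_state_measurable(1)[OF T0] phase_grid_tendsto[OF _ T]])
  show "exit_time b T \<in> borel_measurable M"
    by (rule borel_measurable_LIMSEQ_real[OF grid_time_tendsto[OF _ T] grid_state_measurable(3)[OF T0]])
qed

lemma grid_telescope:
  assumes N: "N > 0"
  shows "F (grid_index b T N \<omega>) = F 0 + (\<Sum>k<N. (if \<forall>m\<le>k. Y (real m * (T / real N)) \<omega> \<in> {0..b} then F (Suc k) - F k else (0::real)))"
proof -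
  let ?\<nu> = "grid_index b T N \<omega>"
  have "(\<Sum>k<N. (if \<forall>m\<le>k. Y (real m * (T / real N)) \<omega> \<in> {0..b} then F (Suc k) - F k else 0)) =
      (\<Sum>k<N. (if k < ?\<nu> then F (Suc k) - F k else 0))"
  proof (rule sum.cong)
    fix k assume "k \<in> {..<N}"
    then have k: "k < N" by simp
    show "(if \<forall>m\<le>k. Y (real m * (T / real N)) \<omega> \<in> {0..b} then F (Suc k) - F k else 0) = (if k < ?\<nu> then F (Suc k) - F k else 0)"
      by (simp only: less_grid_index[OF k])
  qed simp
  also have "\<dots> = (\<Sum>k<?\<nu>. F (Suc k) - F k)"
    using grid_index_le[of b T N \<omega>] by (intro sum.mono_neutral_cong_right) auto
  also have "\<dots> = F ?\<nu> - F 0" by (rule sum_lessThan_telescope)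
  finally show ?thesis by simp
qed

text \<open>Summing \<open>one_step\<close> over the steps before the exit from the strip: \<open>N\<close> steps of length \<open>T / N\<close> with
  errors \<open>C * (T / N)\<^sup>2\<close> accumulate an error of \<open>C * T\<^sup>2 / N\<close>. On the event \<open>E\<close> all steps take place, each
  contributing at least \<open>\<kappa> * T / N\<close>.\<close>
lemma dynkin_grid:
  assumes f: "C2 f f1 f2" and T: "T > 0" "b \<ge> 0" and \<kappa>: "\<kappa> \<ge> 0"
    and harm: "\<And>y i. y \<in> {0..b} \<Longrightarrow> \<kappa> \<le> c $ i * f1 y i + (\<Sum>j\<in>UNIV. A $ i $ j * f y j)"
    and E: "E = {\<omega>\<in>space M. \<phi> 0 \<omega> = i \<and> exit_time b T \<omega> = T}"
  obtains C where "C \<ge> 0" "\<And>N. N > 0 \<Longrightarrow>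
    f 0 i * measure M {\<omega>\<in>space M. \<phi> 0 \<omega> = i} + \<kappa> * T * measure M E - C * T\<^sup>2 / real N \<le>
    (\<integral>\<omega>. indicator {\<omega>\<in>space M. \<phi> 0 \<omega> = i} \<omega> * f (Y (grid_time b T N \<omega>) \<omega>) (\<phi> (grid_time b T N \<omega>) \<omega>) \<partial>M)"
proof -
  have T0: "T \<ge> 0" using T by simp
  define R where "R = norm c * T"
  obtain m where m: "m \<ge> 0" "\<And>y i. y \<in> {-R..R} \<Longrightarrow> \<bar>f y i\<bar> \<le> m" "\<And>y i. y \<in> {-R..R} \<Longrightarrow> \<bar>f1 y i\<bar> \<le> m"
    "\<And>y i. y \<in> {-R..R} \<Longrightarrow> \<bar>f2 y i\<bar> \<le> m"
    by (rule C2_bounds[OF f, of R]) (rule that)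
  obtain C where C: "C \<ge> 0" "\<And>(s::real) (h::real) B. 0 \<le> s \<Longrightarrow> 0 \<le> h \<Longrightarrow> s + h \<le> T \<Longrightarrow> B \<in> sets (past s) \<Longrightarrow>
    \<forall>\<omega>\<in>B. Y s \<omega> \<in> {0..b} \<Longrightarrow>
    \<kappa> * h * measure M B - C * h\<^sup>2 \<le>
      (\<integral>\<omega>. indicator B \<omega> * (f (Y (s + h) \<omega>) (\<phi> (s + h) \<omega>) - f (Y s \<omega>) (\<phi> s \<omega>)) \<partial>M)"
    by (rule one_step[OF f T0 harm, where b = b]) (assumption, rule that)
  let ?I = "{\<omega>\<in>space M. \<phi> 0 \<omega> = i}"
  show ?thesis
  proof (rule that[OF C(1)])
    fix N :: nat assume N: "N > 0"
    define h where "h = T / real N"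
    have h0: "h \<ge> 0" using T by (simp add: h_def)
    define F where "F \<omega> k = f (Y (real k * h) \<omega>) (\<phi> (real k * h) \<omega>)" for \<omega> and k :: nat
    define B where "B k = {\<omega>\<in>space M. \<phi> 0 \<omega> = i \<and> (\<forall>m\<le>k. Y (real m * h) \<omega> \<in> {0..b})}" for k :: nat
    have Bp: "B k \<in> sets (past (real k * h))" for k
    proof -
      have p0: "\<phi> 0 \<in> past (real k * h) \<rightarrow>\<^sub>M count_space UNIV" using h0 by (intro phase_past) auto
      have [measurable]: "Y (real m * h) \<in> borel_measurable (past (real k * h))" if "m \<in> {..k}" for m
        using that h0 by (intro level_past) (auto intro: mult_right_mono)
      have "B k = {\<omega>\<in>space (past (real k * h)). \<phi> 0 \<omega> = i} \<inter> {\<omega>\<in>space (past (real k * h)). \<forall>m\<in>{..k}. Y (real m * h) \<omega> \<in> {0..b}}"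
        by (auto simp: B_def)
      also have "\<dots> \<in> sets (past (real k * h))"
      proof (rule sets.Int)
        show "{\<omega>\<in>space (past (real k * h)). \<phi> 0 \<omega> = i} \<in> sets (past (real k * h))" using p0 by measurable
        show "{\<omega>\<in>space (past (real k * h)). \<forall>m\<in>{..k}. Y (real m * h) \<omega> \<in> {0..b}} \<in> sets (past (real k * h))" by measurable
      qed
      finally show ?thesis .
    qed
    have BM: "B k \<in> sets M" for k using past_sets[OF Bp] .
    have IM: "?I \<in> sets M" by (rule phase_sets) simp
    have rng: "Y (real k * h) \<omega> \<in> {-R..R}" if "\<omega> \<in> space M" "k \<le> N" for \<omega> k
    proof -
      have "real k * h \<le> real N * h" using that h0 by (intro mult_right_mono) auto
      then have "real k * h \<le> T" using N by (simp add: h_def)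
      then show ?thesis using level_range[OF that(1), of "real k * h" T] h0 by (auto simp: R_def abs_le_iff)
    qed
    have Fb: "\<bar>F \<omega> k\<bar> \<le> m" if "\<omega> \<in> space M" "k \<le> N" for \<omega> k
      unfolding F_def by (rule m(2)[OF rng[OF that]])
    have Fm: "(\<lambda>\<omega>. F \<omega> k) \<in> borel_measurable M" for k
      unfolding F_def using h0
      by (intro measurable_state_function[OF C2_continuous(1)[OF f]] level_measurable phase_measurable) auto
    have Bi: "integrable M (\<lambda>\<omega>. indicator (B k) \<omega> * (F \<omega> (Suc k) - F \<omega> k))" if k: "k < N" for k
    proof (rule integrable_bounded[where K = "2 * m"])
      show "(\<lambda>\<omega>. indicator (B k) \<omega> * (F \<omega> (Suc k) - F \<omega> k)) \<in> borel_measurable M"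
        using Fm BM by (intro borel_measurable_times borel_measurable_diff borel_measurable_indicator)
      show "\<bar>indicator (B k) \<omega> * (F \<omega> (Suc k) - F \<omega> k)\<bar> \<le> 2 * m" if "\<omega> \<in> space M" for \<omega>
        using Fb[OF that, of k] Fb[OF that, of "Suc k"] k m(1) by (auto simp: indicator_def)
    qed
    have step: "\<kappa> * h * measure M E - C * h\<^sup>2 \<le> (\<integral>\<omega>. indicator (B k) \<omega> * (F \<omega> (Suc k) - F \<omega> k) \<partial>M)" if k: "k < N" for k
    proof -
      have kh: "real k * h + h = real (Suc k) * h" by (simp add: algebra_simps)
      have "real (Suc k) * h \<le> real N * h" using k h0 by (intro mult_right_mono) auto
      then have le: "real k * h + h \<le> T" using N unfolding kh by (simp add: h_def)
      have "E \<subseteq> B k"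
      proof
        fix \<omega> assume "\<omega> \<in> E"
        then have \<omega>: "\<omega> \<in> space M" "\<phi> 0 \<omega> = i" "exit_time b T \<omega> = T" using E by auto
        have "Y (real j * h) \<omega> \<in> {0..b}" if "j \<le> k" for j
        proof (rule before_exit[OF \<omega>(1) T0 T(2)])
          have "real j * h \<le> real k * h" using that h0 by (intro mult_right_mono) auto
          then show "real j * h \<le> exit_time b T \<omega>" using le h0 \<omega>(3) by simp
        qed (use h0 in simp)
        then show "\<omega> \<in> B k" using \<omega> by (simp add: B_def)
      qed
      then have "measure M E \<le> measure M (B k)" by (intro finite_measure_mono BM)
      then have "\<kappa> * h * measure M E \<le> \<kappa> * h * measure M (B k)" using \<kappa> h0 by (intro mult_left_mono) auto
      also have "\<kappa> * h * measure M (B k) - C * h\<^sup>2 \<le>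
        (\<integral>\<omega>. indicator (B k) \<omega> * (f (Y (real k * h + h) \<omega>) (\<phi> (real k * h + h) \<omega>) - f (Y (real k * h) \<omega>) (\<phi> (real k * h) \<omega>)) \<partial>M)"
      proof (rule C(2)[OF _ h0 le Bp])
        show "\<forall>\<omega>\<in>B k. Y (real k * h) \<omega> \<in> {0..b}" unfolding B_def by blast
      qed (use h0 in simp)
      finally show ?thesis unfolding kh F_def by simp
    qed
    have "(\<integral>\<omega>. indicator ?I \<omega> * f (Y (grid_time b T N \<omega>) \<omega>) (\<phi> (grid_time b T N \<omega>) \<omega>) \<partial>M) =
      (\<integral>\<omega>. indicator ?I \<omega> * f 0 i + (\<Sum>k<N. indicator (B k) \<omega> * (F \<omega> (Suc k) - F \<omega> k)) \<partial>M)"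
    proof (rule Bochner_Integration.integral_cong)
      fix \<omega> assume \<omega>: "\<omega> \<in> space M"
      have F0: "F \<omega> 0 = f 0 (\<phi> 0 \<omega>)" by (simp add: F_def level_zero)
      have "f (Y (grid_time b T N \<omega>) \<omega>) (\<phi> (grid_time b T N \<omega>) \<omega>) = F \<omega> (grid_index b T N \<omega>)"
        by (simp add: F_def grid_time_def h_def)
      also have "\<dots> = F \<omega> 0 + (\<Sum>k<N. (if \<forall>m\<le>k. Y (real m * h) \<omega> \<in> {0..b} then F \<omega> (Suc k) - F \<omega> k else 0))"
        unfolding h_def by (rule grid_telescope[OF N])
      finally have "indicator ?I \<omega> * f (Y (grid_time b T N \<omega>) \<omega>) (\<phi> (grid_time b T N \<omega>) \<omega>) =
        indicator ?I \<omega> * f 0 i + indicator ?I \<omega> * (\<Sum>k<N. (if \<forall>m\<le>k. Y (real m * h) \<omega> \<in> {0..b} then F \<omega> (Suc k) - F \<omega> k else 0))"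
        by (simp add: F0 indicator_def)
      also have "indicator ?I \<omega> * (\<Sum>k<N. (if \<forall>m\<le>k. Y (real m * h) \<omega> \<in> {0..b} then F \<omega> (Suc k) - F \<omega> k else 0)) =
        (\<Sum>k<N. indicator (B k) \<omega> * (F \<omega> (Suc k) - F \<omega> k))"
        unfolding sum_distrib_left using \<omega> by (intro sum.cong) (auto simp: B_def indicator_def)
      finally show "indicator ?I \<omega> * f (Y (grid_time b T N \<omega>) \<omega>) (\<phi> (grid_time b T N \<omega>) \<omega>) =
        indicator ?I \<omega> * f 0 i + (\<Sum>k<N. indicator (B k) \<omega> * (F \<omega> (Suc k) - F \<omega> k))" .
    qed simp
    also have "\<dots> = (\<integral>\<omega>. indicator ?I \<omega> * f 0 i \<partial>M) + (\<integral>\<omega>. (\<Sum>k<N. indicator (B k) \<omega> * (F \<omega> (Suc k) - F \<omega> k)) \<partial>M)"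
      using IM Bi by (intro Bochner_Integration.integral_add Bochner_Integration.integrable_sum) (auto simp: less_top[symmetric])
    also have "(\<integral>\<omega>. indicator ?I \<omega> * f 0 i \<partial>M) = f 0 i * measure M ?I"
      using IM by (simp add: mult.commute)
    also have "(\<integral>\<omega>. (\<Sum>k<N. indicator (B k) \<omega> * (F \<omega> (Suc k) - F \<omega> k)) \<partial>M) = (\<Sum>k<N. (\<integral>\<omega>. indicator (B k) \<omega> * (F \<omega> (Suc k) - F \<omega> k) \<partial>M))"
      by (intro Bochner_Integration.integral_sum Bi) simp
    also have "\<dots> \<ge> (\<Sum>k<N. \<kappa> * h * measure M E - C * h\<^sup>2)"
      by (intro sum_mono step) simp
    moreover have "(\<Sum>k<N. \<kappa> * h * measure M E - C * h\<^sup>2) = \<kappa> * T * measure M E - C * T\<^sup>2 / real N"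
      using N by (simp add: h_def power2_eq_square field_simps)
    ultimately show "f 0 i * measure M ?I + \<kappa> * T * measure M E - C * T\<^sup>2 / real N \<le>
      (\<integral>\<omega>. indicator ?I \<omega> * f (Y (grid_time b T N \<omega>) \<omega>) (\<phi> (grid_time b T N \<omega>) \<omega>) \<partial>M)"
      by linarith
  qed
qed

text \<open>Dynkin's formula as an inequality for subharmonic functions, quantified by \<open>\<kappa>\<close>, which is all that
  exit estimates need.\<close>
lemma dynkin:
  assumes f: "C2 f f1 f2" and T: "T > 0" "b \<ge> 0" and \<kappa>: "\<kappa> \<ge> 0"
    and harm: "\<And>y i. y \<in> {0..b} \<Longrightarrow> \<kappa> \<le> c $ i * f1 y i + (\<Sum>j\<in>UNIV. A $ i $ j * f y j)"
  shows "f 0 i * measure M {\<omega>\<in>space M. \<phi> 0 \<omega> = i} + \<kappa> * T * measure M {\<omega>\<in>space M. \<phi> 0 \<omega> = i \<and> exit_time b T \<omega> = T} \<le>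
    (\<integral>\<omega>. indicator {\<omega>\<in>space M. \<phi> 0 \<omega> = i} \<omega> * f (Y (exit_time b T \<omega>) \<omega>) (\<phi> (exit_time b T \<omega>) \<omega>) \<partial>M)"
proof -
  have T0: "T \<ge> 0" using T by simp
  let ?I = "{\<omega>\<in>space M. \<phi> 0 \<omega> = i}"
  define E where "E = {\<omega>\<in>space M. \<phi> 0 \<omega> = i \<and> exit_time b T \<omega> = T}"
  obtain C where C: "C \<ge> 0" "\<And>N. N > 0 \<Longrightarrow>
    f 0 i * measure M ?I + \<kappa> * T * measure M E - C * T\<^sup>2 / real N \<le>
    (\<integral>\<omega>. indicator ?I \<omega> * f (Y (grid_time b T N \<omega>) \<omega>) (\<phi> (grid_time b T N \<omega>) \<omega>) \<partial>M)"
    by (rule dynkin_grid[OF f T \<kappa> harm E_def]) (assumption, rule that)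
  define R where "R = norm c * T"
  obtain m where m: "m \<ge> 0" "\<And>y i. y \<in> {-R..R} \<Longrightarrow> \<bar>f y i\<bar> \<le> m" "\<And>y i. y \<in> {-R..R} \<Longrightarrow> \<bar>f1 y i\<bar> \<le> m"
    "\<And>y i. y \<in> {-R..R} \<Longrightarrow> \<bar>f2 y i\<bar> \<le> m"
    by (rule C2_bounds[OF f, of R]) (rule that)
  define g where "g n \<omega> = indicator ?I \<omega> * f (Y (grid_time b T (Suc n) \<omega>) \<omega>) (\<phi> (grid_time b T (Suc n) \<omega>) \<omega>)" for n \<omega>
  define G where "G \<omega> = indicator ?I \<omega> * f (Y (exit_time b T \<omega>) \<omega>) (\<phi> (exit_time b T \<omega>) \<omega>)" for \<omega>
  have IM: "?I \<in> sets M" by (rule phase_sets) simp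
  note cont = C2_continuous(1)[OF f]
  have gm: "g n \<in> borel_measurable M" for n
    unfolding g_def[abs_def]
    by (intro borel_measurable_times borel_measurable_indicator IM measurable_state_function[OF cont] grid_state_measurable[OF T0])
  have lim: "(\<lambda>n. g n \<omega>) \<longlonglongrightarrow> G \<omega>" if \<omega>: "\<omega> \<in> space M" for \<omega>
  proof -
    obtain K where K: "\<And>n. n \<ge> K \<Longrightarrow> \<phi> (grid_time b T (Suc n) \<omega>) \<omega> = \<phi> (exit_time b T \<omega>) \<omega>"
      using phase_grid_tendsto[OF \<omega> T] by blast
    have "(\<lambda>n. Y (grid_time b T (Suc n) \<omega>) \<omega>) \<longlonglongrightarrow> Y (exit_time b T \<omega>) \<omega>"
      by (rule continuous_on_tendsto_compose[OF level_continuous[OF \<omega>] grid_time_tendsto[OF \<omega> T]])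
         (use exit_time_bounds(1)[OF T0] grid_time_bounds(1)[OF T0] in auto)
    then have "(\<lambda>n. f (Y (grid_time b T (Suc n) \<omega>) \<omega>) (\<phi> (exit_time b T \<omega>) \<omega>)) \<longlonglongrightarrow> f (Y (exit_time b T \<omega>) \<omega>) (\<phi> (exit_time b T \<omega>) \<omega>)"
      by (rule continuous_on_tendsto_compose[OF cont]) auto
    then have "(\<lambda>n. indicator ?I \<omega> * f (Y (grid_time b T (Suc n) \<omega>) \<omega>) (\<phi> (exit_time b T \<omega>) \<omega>)) \<longlonglongrightarrow> G \<omega>"
      unfolding G_def by (rule tendsto_mult_left)
    then show ?thesis
      by (rule Lim_transform_eventually) (auto simp: eventually_sequentially g_def K intro!: exI[of _ K])
  qed
  have bound: "norm (g n \<omega>) \<le> m" if \<omega>: "\<omega> \<in> space M" for n \<omega>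
  proof -
    have "Y (grid_time b T (Suc n) \<omega>) \<omega> \<in> {-R..R}"
      using level_range[OF \<omega>, of "grid_time b T (Suc n) \<omega>" T] grid_time_bounds[OF T0, of "Suc n" b \<omega>]
      by (auto simp: R_def abs_le_iff)
    from m(2)[OF this] show ?thesis using m(1) by (auto simp: g_def indicator_def)
  qed
  have l1: "(\<lambda>n. \<integral>\<omega>. g n \<omega> \<partial>M) \<longlonglongrightarrow> (\<integral>\<omega>. G \<omega> \<partial>M)"
  proof (rule integral_dominated_convergence[where w = "\<lambda>_. m"])
    show "G \<in> borel_measurable M" by (rule borel_measurable_LIMSEQ_real[OF lim gm])
  qed (use gm lim bound in auto)
  have l2: "(\<lambda>n. f 0 i * measure M ?I + \<kappa> * T * measure M E - C * T\<^sup>2 / real (Suc n)) \<longlonglongrightarrow>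
      f 0 i * measure M ?I + \<kappa> * T * measure M E - 0"
  proof (intro tendsto_diff tendsto_const)
    show "(\<lambda>n. C * T\<^sup>2 / real (Suc n)) \<longlonglongrightarrow> 0"
      using LIMSEQ_Suc[OF lim_const_over_n[of "C * T\<^sup>2"]] by simp
  qed
  have le: "\<exists>N. \<forall>n\<ge>N. f 0 i * measure M ?I + \<kappa> * T * measure M E - C * T\<^sup>2 / real (Suc n) \<le> (\<integral>\<omega>. g n \<omega> \<partial>M)"
    unfolding g_def using C(2)[OF zero_less_Suc] by blast
  have "f 0 i * measure M ?I + \<kappa> * T * measure M E - 0 \<le> (\<integral>\<omega>. G \<omega> \<partial>M)"
    by (rule LIMSEQ_le[OF l2 l1 le])
  then show ?thesis by (simp add: G_def E_def)
qed

end

section \<open>Exit laws and first return probabilities\<close>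

context fluid_process
begin

abbreviation start :: "'s \<Rightarrow> 'w set" where "start i \<equiv> {\<omega>\<in>space M. \<phi> 0 \<omega> = i}"

text \<open>Being at an edge in a phase that moves outwards characterizes the exit by the state at a single
  time, which makes the exit phase comparable for different strips and horizons.\<close>
definition leaves_at :: "real \<Rightarrow> 's \<Rightarrow> 'w \<Rightarrow> real \<Rightarrow> bool" where
  "leaves_at b j \<omega> s \<longleftrightarrow> 0 \<le> s \<and> (\<forall>r\<in>{0..s}. Y r \<omega> \<in> {0..b}) \<and> \<phi> s \<omega> = j \<and>
     (Y s \<omega> = 0 \<and> c $ j < 0 \<or> Y s \<omega> = b \<and> c $ j > 0)"

definition hits :: "real \<Rightarrow> real \<Rightarrow> 's \<Rightarrow> 'w set" where
  "hits b T j = {\<omega>\<in>space M. \<exists>s<T. leaves_at b j \<omega> s}"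

definition hit :: "real \<Rightarrow> 's \<Rightarrow> 'w set" where
  "hit b j = {\<omega>\<in>space M. \<exists>s. leaves_at b j \<omega> s}"

text \<open>The phase at the exit determines the edge.\<close>
definition edge :: "real \<Rightarrow> 's \<Rightarrow> real" where "edge b j = (if c $ j > 0 then b else 0)"

lemma locally_linear:
  assumes \<omega>: "\<omega> \<in> space M" and s: "s \<ge> 0"
  obtains \<delta> where "\<delta> > 0" "\<And>r. s \<le> r \<Longrightarrow> r < s + \<delta> \<Longrightarrow> Y r \<omega> = Y s \<omega> + c $ \<phi> s \<omega> * (r - s)"
proof -
  obtain \<delta> where \<delta>: "\<delta> > 0 \<and> (\<forall>r\<in>{s..<s + \<delta>}. \<phi> r \<omega> = \<phi> s \<omega>)"
    using right_continuous[OF \<omega> s] by (elim exE) (rule that)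
  show ?thesis
  proof (rule that)
    show "\<delta> > 0" using \<delta> by (rule conjunct1)
    fix r assume r: "s \<le> r" "r < s + \<delta>"
    show "Y r \<omega> = Y s \<omega> + c $ \<phi> s \<omega> * (r - s)"
    proof (rule level_linear[OF \<omega> s r(1)])
      fix u assume "u \<in> {s<..r}"
      then have "u \<in> {s..<s + \<delta>}" using r by simp
      then show "\<phi> u \<omega> = \<phi> s \<omega>" using \<delta> by blast
    qed
  qed
qed

text \<open>Just after the exit time the level moves linearly and is outside the strip at times arbitrarily close;
  this is only possible from an edge and outwards.\<close>
lemma exit_state:
  assumes \<omega>: "\<omega> \<in> space M" and T: "T \<ge> 0" "b > 0" and S: "exit_time b T \<omega> < T"
  shows "leaves_at b (\<phi> (exit_time b T \<omega>) \<omega>) \<omega> (exit_time b T \<omega>)"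
proof -
  let ?S = "exit_time b T \<omega>"
  let ?j = "\<phi> ?S \<omega>"
  have b0: "b \<ge> 0" using T by simp
  have S0: "?S \<ge> 0" using exit_time_bounds(1)[OF T(1)] .
  have in_b: "Y r \<omega> \<in> {0..b}" if "0 \<le> r" "r \<le> ?S" for r using before_exit[OF \<omega> T(1) b0 that] .
  obtain \<delta> where \<delta>: "\<delta> > 0" "\<And>r. ?S \<le> r \<Longrightarrow> r < ?S + \<delta> \<Longrightarrow> Y r \<omega> = Y ?S \<omega> + c $ ?j * (r - ?S)"
    by (rule locally_linear[OF \<omega> S0]) (rule that)
  have out: "\<exists>r. ?S < r \<and> r < ?S + d \<and> Y ?S \<omega> + c $ ?j * (r - ?S) \<notin> {0..b}" if d: "d > 0" "d \<le> \<delta>" for d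
  proof -
    obtain r where r: "?S < r" "r < ?S + d" "r \<le> T" "Y r \<omega> \<notin> {0..b}" using after_exit[OF \<omega> T(1) b0 S d(1)] .
    then show ?thesis using \<delta>(2)[of r] d by auto
  qed
  have YS: "Y ?S \<omega> \<in> {0..b}" using in_b[OF S0] by simp
  consider "c $ ?j = 0" | "c $ ?j > 0" | "c $ ?j < 0" by linarith
  then have "Y ?S \<omega> = 0 \<and> c $ ?j < 0 \<or> Y ?S \<omega> = b \<and> c $ ?j > 0"
  proof cases
    case 1
    then show ?thesis using out[OF \<delta>(1)] YS by auto
  next
    case 2
    have "Y ?S \<omega> = b"
    proof (rule ccontr)
      assume "Y ?S \<omega> \<noteq> b"
      then have d: "min \<delta> ((b - Y ?S \<omega>) / c $ ?j) > 0" using \<delta>(1) 2 YS by simp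
      from out[OF d] obtain r where r: "?S < r" "r < ?S + min \<delta> ((b - Y ?S \<omega>) / c $ ?j)" "Y ?S \<omega> + c $ ?j * (r - ?S) \<notin> {0..b}" by auto
      have "r - ?S < (b - Y ?S \<omega>) / c $ ?j" using r(2) by linarith
      then have "c $ ?j * (r - ?S) < b - Y ?S \<omega>" using 2 by (simp add: pos_less_divide_eq mult.commute)
      moreover have "c $ ?j * (r - ?S) \<ge> 0" using 2 r(1) by simp
      ultimately show False using r(3) YS by auto
    qed
    then show ?thesis using 2 by simp
  next
    case 3
    have "Y ?S \<omega> = 0"
    proof (rule ccontr)
      assume "Y ?S \<omega> \<noteq> 0"
      then have d: "min \<delta> (Y ?S \<omega> / - c $ ?j) > 0" using \<delta>(1) 3 YS by (simp add: divide_pos_neg)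
      from out[OF d] obtain r where r: "?S < r" "r < ?S + min \<delta> (Y ?S \<omega> / - c $ ?j)" "Y ?S \<omega> + c $ ?j * (r - ?S) \<notin> {0..b}" by auto
      have "r - ?S < Y ?S \<omega> / - c $ ?j" using r(2) by linarith
      then have "(r - ?S) * - c $ ?j < Y ?S \<omega>" using 3 pos_less_divide_eq[of "- c $ ?j" "r - ?S" "Y ?S \<omega>"] by simp
      moreover have "c $ ?j * (r - ?S) \<le> 0" using 3 r(1) by (simp add: mult_nonpos_nonneg)
      ultimately show False using r(3) YS by (auto simp: mult.commute)
    qed
    then show ?thesis using 3 by simp
  qed
  then show ?thesis unfolding leaves_at_def using S0 in_b by auto
qed

lemma leaves_at_exit_time:
  assumes \<omega>: "\<omega> \<in> space M" and T: "s < T" "b > 0" and s: "leaves_at b j \<omega> s"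
  shows "exit_time b T \<omega> = s"
proof (rule antisym)
  have s0: "s \<ge> 0" and j: "\<phi> s \<omega> = j" and in_b: "\<And>r. 0 \<le> r \<Longrightarrow> r \<le> s \<Longrightarrow> Y r \<omega> \<in> {0..b}"
    and e: "Y s \<omega> = 0 \<and> c $ j < 0 \<or> Y s \<omega> = b \<and> c $ j > 0"
    using s by (auto simp: leaves_at_def)
  show "s \<le> exit_time b T \<omega>" unfolding exit_time_def
  proof (rule cInf_greatest)
    fix x assume "x \<in> insert T {r. 0 \<le> r \<and> r \<le> T \<and> Y r \<omega> \<notin> {0..b}}"
    then show "s \<le> x" using T(1) in_b[of x] by (cases "x \<le> s") auto
  qed simp
  obtain \<delta> where \<delta>: "\<delta> > 0" "\<And>r. s \<le> r \<Longrightarrow> r < s + \<delta> \<Longrightarrow> Y r \<omega> = Y s \<omega> + c $ \<phi> s \<omega> * (r - s)"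
    by (rule locally_linear[OF \<omega> s0]) (rule that)
  note \<delta> = \<delta>[unfolded j]
  show "exit_time b T \<omega> \<le> s"
  proof (rule field_le_epsilon)
    fix e' :: real assume e': "e' > 0"
    define r where "r = s + min (min (\<delta> / 2) e') (T - s)"
    have r: "s < r" "r < s + \<delta>" "r \<le> T" "r \<le> s + e'" using \<delta>(1) e' T(1) by (auto simp: r_def)
    have "Y r \<omega> = Y s \<omega> + c $ j * (r - s)" using \<delta>(2)[of r] r by simp
    moreover have "c $ j < 0 \<Longrightarrow> c $ j * (r - s) < 0" "c $ j > 0 \<Longrightarrow> c $ j * (r - s) > 0"
      using r by (auto simp: mult_neg_pos)
    ultimately have "Y r \<omega> \<notin> {0..b}" using e by auto
    then have "exit_time b T \<omega> \<le> r" using s0 r by (intro exit_time_le) auto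
    then show "exit_time b T \<omega> \<le> s + e'" using r by simp
  qed
qed

lemma hits_eq:
  assumes T: "T > 0" "b > 0"
  shows "hits b T j = {\<omega>\<in>space M. exit_time b T \<omega> < T \<and> \<phi> (exit_time b T \<omega>) \<omega> = j}"
proof (intro set_eqI iffI)
  fix \<omega> assume "\<omega> \<in> hits b T j"
  then obtain s where "\<omega> \<in> space M" "s < T" "leaves_at b j \<omega> s" by (auto simp: hits_def)
  then show "\<omega> \<in> {\<omega>\<in>space M. exit_time b T \<omega> < T \<and> \<phi> (exit_time b T \<omega>) \<omega> = j}"
    using leaves_at_exit_time[of \<omega> s T b j] T by (auto simp: leaves_at_def)
next
  fix \<omega> assume "\<omega> \<in> {\<omega>\<in>space M. exit_time b T \<omega> < T \<and> \<phi> (exit_time b T \<omega>) \<omega> = j}"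
  then show "\<omega> \<in> hits b T j" using exit_state[of \<omega> T b] T by (auto simp: hits_def)
qed

lemma hits_sets:
  assumes T: "T > 0" "b > 0" shows "hits b T j \<in> sets M"
proof -
  have b0: "b \<ge> 0" using T by simp
  note [measurable] = exit_state_measurable[OF T(1) b0]
  show ?thesis unfolding hits_eq[OF T] by measurable
qed

lemma hit_UN: "hit b j = (\<Union>n. hits b (real (Suc n)) j)"
proof (intro set_eqI iffI)
  fix \<omega> assume "\<omega> \<in> hit b j"
  then obtain s where s: "\<omega> \<in> space M" "leaves_at b j \<omega> s" by (auto simp: hit_def)
  obtain n where "s < real n" using reals_Archimedean2 by blast
  then have "s < real (Suc n)" by simp
  then show "\<omega> \<in> (\<Union>n. hits b (real (Suc n)) j)" using s by (auto simp: hits_def)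
qed (auto simp: hits_def hit_def)

lemma hits_incseq: "incseq (\<lambda>n. hits b (real (Suc n)) j)"
proof (rule incseq_SucI)
  fix n
  have "s < real (Suc n) \<Longrightarrow> s < real (Suc (Suc n))" for s by simp
  then show "hits b (real (Suc n)) j \<subseteq> hits b (real (Suc (Suc n))) j" unfolding hits_def by blast
qed

lemma hit_sets: "b > 0 \<Longrightarrow> hit b j \<in> sets M"
  unfolding hit_UN by (intro sets.countable_UN image_subsetI hits_sets) auto

lemma start_sets: "start i \<in> sets M"
  by (rule phase_sets) simp

lemma hits_tendsto:
  assumes "b > 0"
  shows "(\<lambda>n. measure M (hits b (real (Suc n)) j \<inter> start i)) \<longlonglongrightarrow> measure M (hit b j \<inter> start i)"
proof -
  have "(\<lambda>n. measure M (hits b (real (Suc n)) j \<inter> start i)) \<longlonglongrightarrow> measure M (\<Union>n. hits b (real (Suc n)) j \<inter> start i)"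
  proof (rule finite_Lim_measure_incseq)
    show "range (\<lambda>n. hits b (real (Suc n)) j \<inter> start i) \<subseteq> sets M"
      using hits_sets[OF _ assms] start_sets by auto
    show "incseq (\<lambda>n. hits b (real (Suc n)) j \<inter> start i)"
      using hits_incseq[of b j] by (auto simp: incseq_def)
  qed
  also have "(\<Union>n. hits b (real (Suc n)) j \<inter> start i) = hit b j \<inter> start i" unfolding hit_UN by blast
  finally show ?thesis .
qed

lemma leaves_at_unique:
  assumes "\<omega> \<in> space M" "b > 0" "leaves_at b j \<omega> s" "leaves_at b k \<omega> r"
  shows "j = k"
proof -
  have "exit_time b (max s r + 1) \<omega> = s" "exit_time b (max s r + 1) \<omega> = r"
    using leaves_at_exit_time[OF assms(1) _ assms(2,3), of "max s r + 1"]
      leaves_at_exit_time[OF assms(1) _ assms(2,4), of "max s r + 1"] by auto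
  then have "s = r" by simp
  then show ?thesis using assms(3,4) by (simp add: leaves_at_def)
qed

lemma hit_still: "c $ j = 0 \<Longrightarrow> hit b j = {}"
  by (auto simp: hit_def leaves_at_def)

lemma hit_mono:
  assumes "b \<le> b'" "c $ j < 0" shows "hit b j \<subseteq> hit b' j"
proof -
  have "leaves_at b j \<omega> s \<Longrightarrow> leaves_at b' j \<omega> s" for \<omega> s
    using assms unfolding leaves_at_def by auto
  then show ?thesis by (auto simp: hit_def)
qed

lemma sum_hit_le:
  assumes b: "b > 0" shows "(\<Sum>j\<in>UNIV. measure M (hit b j \<inter> start i)) \<le> measure M (start i)"
proof -
  have "(\<Sum>j\<in>UNIV. measure M (hit b j \<inter> start i)) = measure M (\<Union>j\<in>UNIV. hit b j \<inter> start i)"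
  proof (rule finite_measure_finite_Union[symmetric])
    show "disjoint_family_on (\<lambda>j. hit b j \<inter> start i) UNIV"
      using leaves_at_unique[OF _ b] unfolding disjoint_family_on_def hit_def by blast
  qed (use hit_sets[OF b] start_sets in auto)
  also have "\<dots> \<le> measure M (start i)" by (intro finite_measure_mono start_sets) auto
  finally show ?thesis .
qed

lemma exit_level_bounds:
  assumes "\<omega> \<in> space M" "T > 0" "b > 0" shows "Y (exit_time b T \<omega>) \<omega> \<in> {0..b}"
  using before_exit[OF assms(1), of T b "exit_time b T \<omega>"] exit_time_bounds[of T b \<omega>] assms by simp

lemma exit_level_measurable:
  assumes T: "T > 0" "b \<ge> 0"
  shows "(\<lambda>\<omega>. Y (exit_time b T \<omega>) \<omega>) \<in> borel_measurable M"
proof (rule borel_measurable_LIMSEQ_real)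
  have T0: "T \<ge> 0" using T by simp
  show "(\<lambda>n. Y (grid_time b T (Suc n) \<omega>) \<omega>) \<longlonglongrightarrow> Y (exit_time b T \<omega>) \<omega>" if \<omega>: "\<omega> \<in> space M" for \<omega>
    by (rule continuous_on_tendsto_compose[OF level_continuous[OF \<omega>] grid_time_tendsto[OF \<omega> T]])
       (use exit_time_bounds(1)[OF T0] grid_time_bounds(1)[OF T0] in auto)
  show "(\<lambda>\<omega>. Y (grid_time b T (Suc n) \<omega>) \<omega>) \<in> borel_measurable M" for n
    by (rule grid_state_measurable(2)[OF T0])
qed

text \<open>Before the horizon \<open>T\<close> the state at the exit is \<open>(edge b j, j)\<close> on \<open>hits b T j\<close>; paths that stay in the
  strip up to \<open>T\<close> contribute at most \<open>m\<close> each.\<close>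
lemma exit_decomposition:
  assumes f: "C2 f f1 f2" and T: "T > 0" "b > 0" and m: "\<And>y i. y \<in> {-b..b} \<Longrightarrow> \<bar>f y i\<bar> \<le> m"
  shows "(\<integral>\<omega>. indicator (start i) \<omega> * f (Y (exit_time b T \<omega>) \<omega>) (\<phi> (exit_time b T \<omega>) \<omega>) \<partial>M) \<le>
    (\<Sum>j\<in>UNIV. measure M (hits b T j \<inter> start i) * f (edge b j) j) + m * measure M {\<omega>\<in>space M. \<phi> 0 \<omega> = i \<and> exit_time b T \<omega> = T}"
proof -
  have b0: "b \<ge> 0" and T0: "T \<ge> 0" using T by auto
  let ?S = "exit_time b T"
  let ?E = "{\<omega>\<in>space M. \<phi> 0 \<omega> = i \<and> ?S \<omega> = T}"
  have m0: "m \<ge> 0" using m[of 0 i] b0 by (auto intro: order_trans[OF abs_ge_zero])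
  note em [measurable] = exit_state_measurable[OF T(1) b0]
  have p0 [measurable]: "\<phi> 0 \<in> M \<rightarrow>\<^sub>M count_space UNIV" by (rule phase_measurable) simp
  have Em: "?E \<in> sets M" by measurable
  have Hm: "hits b T j \<inter> start i \<in> sets M" for j using hits_sets[OF T] start_sets by auto
  define G where "G \<omega> = (\<Sum>j\<in>UNIV. f (edge b j) j * indicator (hits b T j \<inter> start i) \<omega>) + m * indicator ?E \<omega>" for \<omega>
  have Gi: "integrable M (\<lambda>\<omega>. f (edge b j) j * indicator (hits b T j \<inter> start i) \<omega>)" for j
    using Hm[of j] by (intro integrable_mult_right) (simp add: less_top[symmetric])
  have Ei: "integrable M (\<lambda>\<omega>. m * indicator ?E \<omega>)"
    using Em by (intro integrable_mult_right) (simp add: less_top[symmetric])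
  have "(\<integral>\<omega>. indicator (start i) \<omega> * f (Y (?S \<omega>) \<omega>) (\<phi> (?S \<omega>) \<omega>) \<partial>M) \<le> (\<integral>\<omega>. G \<omega> \<partial>M)"
  proof (rule Bochner_Integration.integral_mono)
    show "integrable M (\<lambda>\<omega>. indicator (start i) \<omega> * f (Y (?S \<omega>) \<omega>) (\<phi> (?S \<omega>) \<omega>))"
    proof (rule integrable_bounded[where K = m])
      show "(\<lambda>\<omega>. indicator (start i) \<omega> * f (Y (?S \<omega>) \<omega>) (\<phi> (?S \<omega>) \<omega>)) \<in> borel_measurable M"
        by (intro borel_measurable_times borel_measurable_indicator start_sets
            measurable_state_function[OF C2_continuous(1)[OF f]] exit_level_measurable[OF T(1) b0] em(1))
      fix \<omega> assume \<omega>: "\<omega> \<in> space M"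
      show "\<bar>indicator (start i) \<omega> * f (Y (?S \<omega>) \<omega>) (\<phi> (?S \<omega>) \<omega>)\<bar> \<le> m"
        using m[of "Y (?S \<omega>) \<omega>" "\<phi> (?S \<omega>) \<omega>"] exit_level_bounds[OF \<omega> T] b0 m0 by (auto simp: indicator_def)
    qed
    show "integrable M G" unfolding G_def
      by (intro Bochner_Integration.integrable_add Bochner_Integration.integrable_sum Gi Ei)
    fix \<omega> assume \<omega>: "\<omega> \<in> space M"
    show "indicator (start i) \<omega> * f (Y (?S \<omega>) \<omega>) (\<phi> (?S \<omega>) \<omega>) \<le> G \<omega>"
    proof (cases "\<phi> 0 \<omega> = i")
      case False
      then show ?thesis using m0 by (simp add: G_def)
    next
      case True
      show ?thesis
      proof (cases "?S \<omega> < T")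
        case lt: True
        let ?j = "\<phi> (?S \<omega>) \<omega>"
        have "(\<Sum>j\<in>UNIV. f (edge b j) j * indicator (hits b T j \<inter> start i) \<omega>) = (\<Sum>j\<in>UNIV. if j = ?j then f (edge b j) j else 0)"
          using \<omega> True lt unfolding hits_eq[OF T] by (intro sum.cong) (auto simp: indicator_def)
        also have "\<dots> = f (edge b ?j) ?j" by simp
        also have "edge b ?j = Y (?S \<omega>) \<omega>"
          using exit_state[OF \<omega> T0 T(2) lt] by (auto simp: leaves_at_def edge_def)
        finally show ?thesis using \<omega> True lt by (simp add: G_def)
      next
        case False
        then have eq: "?S \<omega> = T" using exit_time_bounds(2)[OF T0, of b \<omega>] by simp
        have "(\<Sum>j\<in>UNIV. f (edge b j) j * indicator (hits b T j \<inter> start i) \<omega>) = 0"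
          using eq unfolding hits_eq[OF T] by (intro sum.neutral) (auto simp: indicator_def)
        moreover have "f (Y (?S \<omega>) \<omega>) (\<phi> (?S \<omega>) \<omega>) \<le> m"
          using m[of "Y (?S \<omega>) \<omega>" "\<phi> (?S \<omega>) \<omega>"] exit_level_bounds[OF \<omega> T] b0 by (simp add: abs_le_iff)
        ultimately show ?thesis using \<omega> True eq by (simp add: G_def)
      qed
    qed
  qed
  also have "(\<integral>\<omega>. G \<omega> \<partial>M) = (\<integral>\<omega>. (\<Sum>j\<in>UNIV. f (edge b j) j * indicator (hits b T j \<inter> start i) \<omega>) \<partial>M) + (\<integral>\<omega>. m * indicator ?E \<omega> \<partial>M)"
    unfolding G_def by (intro Bochner_Integration.integral_add Bochner_Integration.integrable_sum Gi Ei)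
  also have "(\<integral>\<omega>. (\<Sum>j\<in>UNIV. f (edge b j) j * indicator (hits b T j \<inter> start i) \<omega>) \<partial>M) =
      (\<Sum>j\<in>UNIV. (\<integral>\<omega>. f (edge b j) j * indicator (hits b T j \<inter> start i) \<omega> \<partial>M))"
    by (intro Bochner_Integration.integral_sum Gi)
  also have "\<dots> = (\<Sum>j\<in>UNIV. measure M (hits b T j \<inter> start i) * f (edge b j) j)"
    by (intro sum.cong refl) (simp only: integral_mult_right_zero Bochner_Integration.integral_indicator
        sets.Int_space_eq2[OF Hm] mult.commute)
  also have "(\<integral>\<omega>. m * indicator ?E \<omega> \<partial>M) = m * measure M ?E"
    by (simp only: integral_mult_right_zero Bochner_Integration.integral_indicator sets.Int_space_eq2[OF Em])
  finally show ?thesis .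
qed

text \<open>A path is bounded on compact time intervals, so a first return below 0 is an exit through the bottom of
  every sufficiently high strip.\<close>
lemma return_eq:
  assumes j: "c $ j < 0"
  shows "{\<omega>\<in>space M. tau_down \<phi> c \<omega> < \<infinity> \<and> \<phi> (real_of_ereal (tau_down \<phi> c \<omega>)) \<omega> = j} = (\<Union>n. hit (real (Suc n)) j)"
proof (intro set_eqI iffI)
  fix \<omega> assume "\<omega> \<in> (\<Union>n. hit (real (Suc n)) j)"
  then obtain n s where \<omega>: "\<omega> \<in> space M" and s: "leaves_at (real (Suc n)) j \<omega> s" by (auto simp: hit_def)
  have s0: "s \<ge> 0" and js: "\<phi> s \<omega> = j" and Y0: "Y s \<omega> = 0" and pos: "\<And>r. 0 \<le> r \<Longrightarrow> r \<le> s \<Longrightarrow> Y r \<omega> \<ge> 0"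
    using s j by (auto simp: leaves_at_def)
  have "tau_down \<phi> c \<omega> = ereal s"
  proof (rule antisym)
    show "ereal s \<le> tau_down \<phi> c \<omega>" unfolding tau_down_def
    proof (rule Inf_greatest)
      fix x assume "x \<in> {ereal t |t. t > 0 \<and> Y t \<omega> < 0}"
      then obtain t where "x = ereal t" "t > 0" "Y t \<omega> < 0" by blast
      then show "ereal s \<le> x" using pos[of t] by (cases "t \<le> s") auto
    qed
    obtain \<delta> where \<delta>: "\<delta> > 0" "\<And>r. s \<le> r \<Longrightarrow> r < s + \<delta> \<Longrightarrow> Y r \<omega> = Y s \<omega> + c $ \<phi> s \<omega> * (r - s)"
      by (rule locally_linear[OF \<omega> s0]) (rule that)
  note \<delta> = \<delta>[unfolded js]
    show "tau_down \<phi> c \<omega> \<le> ereal s"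
    proof (rule ereal_le_epsilon2)
      fix e :: real assume e: "e > 0"
      define r where "r = s + min (\<delta> / 2) e"
      have r: "s < r" "r < s + \<delta>" "r \<le> s + e" using \<delta>(1) e by (auto simp: r_def)
      have "Y r \<omega> = c $ j * (r - s)" using \<delta>(2)[of r] r Y0 by simp
      then have "Y r \<omega> < 0" using j r by (simp add: mult_neg_pos)
      then have "tau_down \<phi> c \<omega> \<le> ereal r" unfolding tau_down_def using r s0 by (intro Inf_lower) auto
      also have "\<dots> \<le> ereal s + ereal e" using r by simp
      finally show "tau_down \<phi> c \<omega> \<le> ereal s + ereal e" .
    qed
  qed
  then show "\<omega> \<in> {\<omega>\<in>space M. tau_down \<phi> c \<omega> < \<infinity> \<and> \<phi> (real_of_ereal (tau_down \<phi> c \<omega>)) \<omega> = j}"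
    using \<omega> js by simp
next
  fix \<omega> assume "\<omega> \<in> {\<omega>\<in>space M. tau_down \<phi> c \<omega> < \<infinity> \<and> \<phi> (real_of_ereal (tau_down \<phi> c \<omega>)) \<omega> = j}"
  then have \<omega>: "\<omega> \<in> space M" and fin: "tau_down \<phi> c \<omega> < \<infinity>" and jt: "\<phi> (real_of_ereal (tau_down \<phi> c \<omega>)) \<omega> = j" by auto
  have "tau_down \<phi> c \<omega> \<ge> 0" unfolding tau_down_def by (intro Inf_greatest) auto
  with fin obtain s where s: "tau_down \<phi> c \<omega> = ereal s" "s \<ge> 0" by (cases "tau_down \<phi> c \<omega>") auto
  have js: "\<phi> s \<omega> = j" using jt s by simp
  have pos': "Y r \<omega> \<ge> 0" if "0 \<le> r" "r < s" for r
  proof (rule ccontr)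
    assume neg: "\<not> Y r \<omega> \<ge> 0"
    then have "r > 0" using that(1) level_zero[of \<omega>] by (cases "r = 0") auto
    then have "tau_down \<phi> c \<omega> \<le> ereal r" unfolding tau_down_def using neg by (intro Inf_lower) auto
    then show False using s that by simp
  qed
  have pos: "Y r \<omega> \<ge> 0" if r: "0 \<le> r" "r \<le> s" for r
  proof (cases "s = 0")
    case True then show ?thesis using r level_zero[of \<omega>] by simp
  next
    case False
    have "closed {r \<in> {0..s}. Y r \<omega> \<in> {0..}}"
      using continuous_closed_preimage[OF continuous_on_subset[OF level_continuous[OF \<omega>], of "{0..s}"], of "{0..}"]
      by (auto simp: vimage_def Int_def)
    moreover have "{0..<s} \<subseteq> {r \<in> {0..s}. Y r \<omega> \<in> {0..}}" using pos' by auto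
    ultimately have "closure {0..<s} \<subseteq> {r \<in> {0..s}. Y r \<omega> \<in> {0..}}" by (intro closure_minimal)
    then show ?thesis using False s r by auto
  qed
  obtain \<delta> where \<delta>: "\<delta> > 0" "\<And>r. s \<le> r \<Longrightarrow> r < s + \<delta> \<Longrightarrow> Y r \<omega> = Y s \<omega> + c $ \<phi> s \<omega> * (r - s)"
    by (rule locally_linear[OF \<omega> s(2)]) (rule that)
  note \<delta> = \<delta>[unfolded js]
  have Y0: "Y s \<omega> = 0"
  proof (rule ccontr)
    assume "Y s \<omega> \<noteq> 0"
    then have Ys: "Y s \<omega> > 0" using pos[of s] s by simp
    define d where "d = min \<delta> (Y s \<omega> / - c $ j)"
    have d: "d > 0" using \<delta>(1) Ys j by (simp add: d_def divide_pos_neg)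
    have "Inf {ereal t |t. t > 0 \<and> Y t \<omega> < 0} < ereal (s + d)"
      using s d by (simp add: tau_down_def[symmetric])
    then obtain t where t: "t < s + d" "t > 0" "Y t \<omega> < 0" unfolding Inf_less_iff by auto
    have ts: "s \<le> t" using pos[of t] t by (cases "t \<le> s") auto
    have "Y t \<omega> = Y s \<omega> + c $ j * (t - s)" using \<delta>(2)[OF ts] t by (simp add: d_def)
    moreover have "t - s < Y s \<omega> / - c $ j" using t(1) by (simp add: d_def)
    then have "(t - s) * - c $ j < Y s \<omega>" using j pos_less_divide_eq[of "- c $ j" "t - s" "Y s \<omega>"] by simp
    ultimately show False using t(3) by (simp add: mult.commute)
  qed
  obtain n where n: "norm c * s < real n" using reals_Archimedean2 by blast
  have "Y r \<omega> \<le> real (Suc n)" if "0 \<le> r" "r \<le> s" for r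
    using level_range[OF \<omega> that] n by (simp add: abs_le_iff)
  then have "leaves_at (real (Suc n)) j \<omega> s"
    unfolding leaves_at_def using s(2) pos js Y0 j by auto
  then show "\<omega> \<in> (\<Union>n. hit (real (Suc n)) j)" using \<omega> unfolding hit_def by blast
qed

text \<open>Columns of negative rate are the law of exits through 0, columns of positive rate that of exits
  through \<open>b\<close>.\<close>
definition exit_law :: "real \<Rightarrow> real^'s^'s" where
  "exit_law b = (\<chi> i j. if i \<in> up c then measure M (hit b j \<inter> start i) / measure M (start i) else 0)"

lemma exit_law_nonneg: "exit_law b $ i $ j \<ge> 0"
  by (simp add: exit_law_def)

lemma exit_law_sum:
  assumes "b > 0" shows "(\<Sum>j\<in>UNIV. exit_law b $ i $ j) \<le> 1"
proof (cases "i \<in> up c \<and> measure M (start i) > 0")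
  case True
  then have "(\<Sum>j\<in>UNIV. exit_law b $ i $ j) = (\<Sum>j\<in>UNIV. measure M (hit b j \<inter> start i)) / measure M (start i)"
    by (simp add: exit_law_def sum_divide_distrib)
  then show ?thesis using sum_hit_le[OF assms, of i] True by simp
next
  case False
  then have "measure M (start i) = 0 \<or> i \<notin> up c" by (auto simp: zero_less_measure_iff)
  then have "exit_law b $ i $ j = 0" for j by (auto simp: exit_law_def)
  then show ?thesis by simp
qed

lemma exit_law_still: "c $ j = 0 \<Longrightarrow> exit_law b $ i $ j = 0"
  by (simp add: exit_law_def hit_still)

lemma exit_law_mono:
  assumes "0 < b" "b \<le> b'" "c $ j < 0" shows "exit_law b $ i $ j \<le> exit_law b' $ i $ j"
  unfolding exit_law_def using hit_mono[OF assms(2,3)] hit_sets[of b' j] start_sets[of i] assms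
  by (auto intro!: divide_right_mono finite_measure_mono)

lemma first_return_entry:
  assumes "i \<in> up c" "j \<in> down c"
  shows "first_return M \<phi> c $ i $ j = measure M ((\<Union>n. hit (real (Suc n)) j) \<inter> start i) / measure M (start i)"
proof -
  have j: "c $ j < 0" using assms by (simp add: down_def)
  have "{\<omega>\<in>space M. (tau_down \<phi> c \<omega> < \<infinity> \<and> \<phi> (real_of_ereal (tau_down \<phi> c \<omega>)) \<omega> = j) \<and> \<phi> 0 \<omega> = i} =
    (\<Union>n. hit (real (Suc n)) j) \<inter> start i"
    unfolding return_eq[OF j, symmetric] by auto
  then show ?thesis using assms by (simp add: first_return_def cond_prob_def)
qed

lemma exit_law_tendsto:
  assumes "i \<in> up c" "j \<in> down c"
  shows "(\<lambda>n. exit_law (real (Suc n)) $ i $ j) \<longlonglongrightarrow> first_return M \<phi> c $ i $ j"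
proof -
  have j: "c $ j < 0" using assms by (simp add: down_def)
  have "(\<lambda>n. measure M (hit (real (Suc n)) j \<inter> start i)) \<longlonglongrightarrow> measure M (\<Union>n. hit (real (Suc n)) j \<inter> start i)"
  proof (rule finite_Lim_measure_incseq)
    show "range (\<lambda>n. hit (real (Suc n)) j \<inter> start i) \<subseteq> sets M"
      using hit_sets start_sets by auto
    show "incseq (\<lambda>n. hit (real (Suc n)) j \<inter> start i)"
    proof (rule incseq_SucI)
      show "hit (real (Suc n)) j \<inter> start i \<subseteq> hit (real (Suc (Suc n))) j \<inter> start i" for n
        using hit_mono[of "real (Suc n)" "real (Suc (Suc n))" j] j by auto
    qed
  qed
  also have "(\<Union>n. hit (real (Suc n)) j \<inter> start i) = (\<Union>n. hit (real (Suc n)) j) \<inter> start i" by blast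
  finally have "(\<lambda>n. measure M (hit (real (Suc n)) j \<inter> start i)) \<longlonglongrightarrow> measure M ((\<Union>n. hit (real (Suc n)) j) \<inter> start i)" .
  from tendsto_divide[OF this tendsto_const[of "measure M (start i)"]] show ?thesis
    using assms unfolding first_return_entry[OF assms] exit_law_def
    by (cases "measure M (start i) = 0") simp_all
qed

end

text \<open>The condition \<open>init\<close> makes the conditional probabilities given the initial phase meaningful.\<close>
locale fluid_model = fluid_process M \<phi> A c + fluid_generator A \<xi> c
  for M :: "'w measure" and \<phi> :: "real \<Rightarrow> 'w \<Rightarrow> 's::finite" and A :: "real^'s^'s" and \<xi> c :: "real^'s" +
  assumes init: "\<And>i. i \<in> up c \<Longrightarrow> measure M {\<omega>\<in>space M. \<phi> 0 \<omega> = i} > 0"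
begin

text \<open>Dynkin's inequality for a function on which the generator is 1: the horizon times the probability of
  not having left is bounded by the oscillation of that function on the strip.\<close>
lemma no_exit_tendsto_0:
  assumes b: "b > 0"
  shows "(\<lambda>n. measure M {\<omega>\<in>space M. \<phi> 0 \<omega> = i \<and> exit_time b (real (Suc n)) \<omega> = real (Suc n)}) \<longlonglongrightarrow> 0"
proof -
  have b0: "b \<ge> 0" using b by simp
  obtain f f1 f2 :: "real \<Rightarrow> 's \<Rightarrow> real" where f:
    "\<And>i y. ((\<lambda>y. f y i) has_real_derivative f1 y i) (at y)"
    "\<And>i y. ((\<lambda>y. f1 y i) has_real_derivative f2 y i) (at y)"
    "\<And>i. continuous_on UNIV (\<lambda>y. f2 y i)"
    "\<And>i y. c $ i * f1 y i + (\<Sum>j\<in>UNIV. A $ i $ j * f y j) = 1"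
    by (rule lyapunov_function) (rule that)
  have C2: "C2 f f1 f2" unfolding C2_def using f(1-3) by simp
  obtain m where m: "m \<ge> 0" "\<And>y i. y \<in> {-b..b} \<Longrightarrow> \<bar>f y i\<bar> \<le> m" "\<And>y i. y \<in> {-b..b} \<Longrightarrow> \<bar>f1 y i\<bar> \<le> m"
    "\<And>y i. y \<in> {-b..b} \<Longrightarrow> \<bar>f2 y i\<bar> \<le> m"
    by (rule C2_bounds[OF C2, of b]) (rule that)
  let ?P = "\<lambda>n. measure M {\<omega>\<in>space M. \<phi> 0 \<omega> = i \<and> exit_time b (real (Suc n)) \<omega> = real (Suc n)}"
  have le: "?P n \<le> (2 * m) / real (Suc n)" for n
  proof -
    let ?T = "real (Suc n)"
    have T: "?T > 0" by simp
    have "f 0 i * measure M (start i) + 1 * ?T * ?P n \<le>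
      (\<integral>\<omega>. indicator (start i) \<omega> * f (Y (exit_time b ?T \<omega>) \<omega>) (\<phi> (exit_time b ?T \<omega>) \<omega>) \<partial>M)"
      by (rule dynkin[OF C2 T b0]) (use f(4) in simp_all)
    also have "\<dots> \<le> (\<integral>\<omega>. m \<partial>M)"
    proof (rule integral_mono')
      fix \<omega> assume \<omega>: "\<omega> \<in> space M"
      have "Y (exit_time b ?T \<omega>) \<omega> \<in> {-b..b}" using exit_level_bounds[OF \<omega> T b] b0 by auto
      from m(2)[OF this, of "\<phi> (exit_time b ?T \<omega>) \<omega>"]
      show "indicator (start i) \<omega> * f (Y (exit_time b ?T \<omega>) \<omega>) (\<phi> (exit_time b ?T \<omega>) \<omega>) \<le> m"
        using m(1) by (simp add: indicator_def abs_le_iff)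
    qed (use m(1) in auto)
    finally have "?T * ?P n \<le> m - f 0 i * measure M (start i)" by (simp add: prob_space)
    also have "\<dots> \<le> m + m * 1"
    proof -
      have "- f 0 i \<le> m" using m(2)[of 0 i] b0 by (simp add: abs_le_iff)
      then have "- f 0 i * measure M (start i) \<le> m * measure M (start i)" by (rule mult_right_mono) simp
      also have "\<dots> \<le> m * 1" using m(1) by (intro mult_left_mono) auto
      finally show ?thesis by simp
    qed
    finally show ?thesis using T by (simp add: pos_le_divide_eq mult.commute)
  qed
  have "(\<lambda>n. (2 * m) / real (Suc n)) \<longlonglongrightarrow> 0"
    using LIMSEQ_Suc[OF lim_const_over_n[of "2 * m"]] by simp
  from tendsto_sandwich[OF _ _ tendsto_const this, of ?P] le show ?thesis by (simp add: eventually_sequentially)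
qed

lemma exit_inequality:
  assumes f: "C2 f f1 f2" and b: "b > 0" and i: "i \<in> up c"
    and harm: "\<And>y i. y \<in> {0..b} \<Longrightarrow> 0 \<le> c $ i * f1 y i + (\<Sum>j\<in>UNIV. A $ i $ j * f y j)"
  shows "f 0 i \<le> (\<Sum>j\<in>UNIV. exit_law b $ i $ j * f (edge b j) j)"
proof -
  have b0: "b \<ge> 0" using b by simp
  obtain m where m: "m \<ge> 0" "\<And>y i. y \<in> {-b..b} \<Longrightarrow> \<bar>f y i\<bar> \<le> m" "\<And>y i. y \<in> {-b..b} \<Longrightarrow> \<bar>f1 y i\<bar> \<le> m"
    "\<And>y i. y \<in> {-b..b} \<Longrightarrow> \<bar>f2 y i\<bar> \<le> m"
    by (rule C2_bounds[OF f, of b]) (rule that)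
  define R where "R n = (\<Sum>j\<in>UNIV. measure M (hits b (real (Suc n)) j \<inter> start i) * f (edge b j) j) +
      m * measure M {\<omega>\<in>space M. \<phi> 0 \<omega> = i \<and> exit_time b (real (Suc n)) \<omega> = real (Suc n)}" for n
  have le: "f 0 i * measure M (start i) \<le> R n" for n
  proof -
    let ?T = "real (Suc n)"
    have T: "?T > 0" by simp
    have "f 0 i * measure M (start i) + 0 * ?T * measure M {\<omega>\<in>space M. \<phi> 0 \<omega> = i \<and> exit_time b ?T \<omega> = ?T} \<le>
      (\<integral>\<omega>. indicator (start i) \<omega> * f (Y (exit_time b ?T \<omega>) \<omega>) (\<phi> (exit_time b ?T \<omega>) \<omega>) \<partial>M)"
      by (rule dynkin[OF f T b0]) (use harm in simp_all)
    also have "\<dots> \<le> R n" unfolding R_def by (rule exit_decomposition[OF f T b m(2)])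
    finally show ?thesis by simp
  qed
  have "R \<longlonglongrightarrow> (\<Sum>j\<in>UNIV. measure M (hit b j \<inter> start i) * f (edge b j) j) + m * 0"
    unfolding R_def by (intro tendsto_intros hits_tendsto[OF b] no_exit_tendsto_0[OF b])
  then have "f 0 i * measure M (start i) \<le> (\<Sum>j\<in>UNIV. measure M (hit b j \<inter> start i) * f (edge b j) j) + m * 0"
    by (rule LIMSEQ_le_const) (use le in blast)
  moreover have "(\<Sum>j\<in>UNIV. exit_law b $ i $ j * f (edge b j) j) =
      (\<Sum>j\<in>UNIV. measure M (hit b j \<inter> start i) * f (edge b j) j) / measure M (start i)"
    using i by (simp add: exit_law_def sum_divide_distrib)
  ultimately show ?thesis using init[OF i] by (simp add: pos_le_divide_eq)
qed

end

section \<open>The Riccati equation and minimality\<close>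

lemma matrix_tendsto:
  fixes X :: "real^'n^'n"
  assumes "\<And>i j. ((\<lambda>n. F n $ i $ j) \<longlongrightarrow> X $ i $ j) net"
  shows "(F \<longlongrightarrow> X) net"
  by (intro vec_tendstoI assms)

lemma proj_disjoint_up_down: "proj (up c) ** proj (down c) = 0" "proj (down c) ** proj (up c) = 0"
  by (auto intro!: proj_disjoint simp: up_def down_def)

lemma mat_1_split: "mat 1 = proj (up c) + proj (down c) + proj (still c)" for c :: "real^'s::finite"
  by (auto simp: vec_eq_iff up_def down_def still_def mat_def not_less)

lemma inv_up_entry: "inv_up c $ i $ j = (if i = j \<and> i \<in> up c then 1 / c $ i else 0)"
  and inv_down_entry: "abs_inv_down c $ i $ j = (if i = j \<and> i \<in> down c then - 1 / c $ i else 0)"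
  for c :: "real^'s::finite"
proof -
  have *: "block_inv S (diag c) = (\<chi> i j. if i = j \<and> i \<in> S then 1 / c $ i else 0)" (is "_ = ?X")
    if S: "\<And>i. i \<in> S \<Longrightarrow> c $ i \<noteq> 0" for S
  proof (rule block_inv_eqI)
    show "block S S ?X = ?X" by (auto simp: vec_eq_iff)
    have "(block S S (diag c) ** ?X) $ i $ j = (\<Sum>k\<in>UNIV. if k = j then (if i = j \<and> i \<in> S then 1 else 0) else 0)" for i j
      unfolding matrix_entry using S by (intro sum.cong) (auto simp: diag_def)
    then show "block S S (diag c) ** ?X = proj S" by (auto simp: vec_eq_iff mat_def)
    have "(?X ** block S S (diag c)) $ i $ j = (\<Sum>k\<in>UNIV. if k = i then (if i = j \<and> i \<in> S then 1 else 0) else 0)" for i j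
      unfolding matrix_entry using S by (intro sum.cong) (auto simp: diag_def)
    then show "?X ** block S S (diag c) = proj S" by (auto simp: vec_eq_iff mat_def)
  qed
  show "inv_up c $ i $ j = (if i = j \<and> i \<in> up c then 1 / c $ i else 0)"
    unfolding inv_up_def by (subst *) (auto simp: up_def)
  show "abs_inv_down c $ i $ j = (if i = j \<and> i \<in> down c then - 1 / c $ i else 0)"
    unfolding abs_inv_down_def by (subst *) (auto simp: down_def abs_vec_def divide_nonneg_neg)
qed

text \<open>The hypothesis \<open>id\<close> makes \<open>r\<close> a left inverse of \<open>P ** E ** P\<close> on the range of \<open>P\<close>. In finite dimension it is
  also a right inverse, and \<open>P ** E = P ** E ** r ** E\<close> where \<open>r ** E = P - p\<close>.\<close>
lemma block_inverse_identity:
  fixes P p r E :: "real^'n^'n"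
  assumes PP: "P ** P = P" and id: "P = p + r ** E" and pP: "p ** P = 0" and rP: "r ** P = r" and Pr: "P ** r = r"
  shows "P ** E = P ** E ** (P - p)"
proof -
  have rE: "r ** E = P - p" using id by (simp add: algebra_simps)
  have rEP: "r ** E ** P = P" unfolding rE by (simp add: matmul.diff_left PP pP)
  \<comment> \<open>Completing by \<open>mat 1 - P\<close> turns the one-sided inverses on the range of \<open>P\<close> into genuine ones.\<close>
  define X where "X = r + (mat 1 - P)"
  define Z where "Z = P ** E ** P + (mat 1 - P)"
  have "X ** Z = r ** P ** E ** P + (r - r ** P) + (P - P ** P) ** E ** P + (mat 1 - P - P + P ** P)"
    unfolding X_def Z_def by (simp add: matmul.add_left matmul.add_right matmul.diff_left matmul.diff_right matrix_mul_assoc)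
  then have "X ** Z = mat 1" by (simp add: rP PP rEP)
  then have "Z ** X = mat 1" using matrix_left_right_inverse by blast
  moreover have "Z ** X = P ** E ** (P ** r) + (P ** E ** P - P ** E ** (P ** P)) + (r - P ** r) + (mat 1 - P - P + P ** P)"
    unfolding X_def Z_def by (simp add: matmul.add_left matmul.add_right matmul.diff_left matmul.diff_right matrix_mul_assoc)
  ultimately have "P ** E ** r = P" by (simp add: Pr PP)
  then have "P ** E = P ** E ** r ** E" by simp
  also have "\<dots> = P ** E ** (P - p)" unfolding rE[symmetric] by (simp add: matrix_mul_assoc)
  finally show ?thesis .
qed

context fluid_generator
begin

abbreviation Pu :: "real^'s^'s" where "Pu \<equiv> proj (up c)"
abbreviation Pd :: "real^'s^'s" where "Pd \<equiv> proj (down c)"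

lemma H_still_col: "j \<in> still c \<Longrightarrow> H $ i $ j = 0"
  by (simp add: H_def Q_still_col)

lemma H_still: "H ** proj (still c) = 0"
  by (auto simp: vec_eq_iff proj_right H_still_col)

lemma inv_up_Q: "inv_up c ** block (up c) T Q = - (Pu ** H ** proj T)"
proof -
  have "(inv_up c ** block (up c) T Q) $ i $ j = (\<Sum>k\<in>UNIV. if k = i then (if i \<in> up c \<and> j \<in> T then Q $ i $ j / c $ i else 0) else 0)" for i j
    unfolding matrix_entry by (intro sum.cong) (auto simp: inv_up_entry)
  then show ?thesis by (auto simp: vec_eq_iff proj_left proj_right H_def)
qed

lemma inv_down_Q: "abs_inv_down c ** block (down c) T Q = Pd ** H ** proj T"
proof -
  have "(abs_inv_down c ** block (down c) T Q) $ i $ j = (\<Sum>k\<in>UNIV. if k = i then (if i \<in> down c \<and> j \<in> T then - Q $ i $ j / c $ i else 0) else 0)" for i j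
    unfolding matrix_entry by (intro sum.cong) (auto simp: inv_down_entry)
  then show ?thesis by (auto simp: vec_eq_iff proj_left proj_right H_def)
qed

lemma U_eq:
  assumes X: "block (up c) (down c) X = X"
  shows "U_matrix A c X = Pd ** H ** (X + Pd)"
proof -
  have "U_matrix A c X = Pd ** H ** Pd + Pd ** H ** (Pu ** X)"
    unfolding U_matrix_def Q_block_eq inv_down_Q by (simp add: matrix_mul_assoc)
  also have "Pu ** X = X" by (rule block_block_eq(1)[OF X])
  finally show ?thesis by (simp add: matmul.add_right add.commute)
qed

lemma K_eq:
  assumes X: "block (up c) (down c) X = X"
  shows "K_matrix A c X = - ((Pu - X) ** H ** Pu)"
proof -
  have XP: "X ** Pd = X" by (rule block_block_eq(2)[OF X])
  have "K_matrix A c X = - (Pu ** H ** Pu) + X ** (abs_inv_down c ** block (down c) (up c) Q)"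
    unfolding K_matrix_def Q_block_eq inv_up_Q by (simp add: matrix_mul_assoc)
  also have "X ** (abs_inv_down c ** block (down c) (up c) Q) = (X ** Pd) ** H ** Pu"
    unfolding inv_down_Q by (simp add: matrix_mul_assoc)
  finally show ?thesis unfolding XP by (simp add: matmul.diff_left)
qed

text \<open>The factorization says that \<open>X\<close> solves the Riccati equation iff the range of \<open>X + Pd\<close>, a graph over the
  phases of negative rate, is mapped by \<open>H\<close> into the kernel of \<open>Pu - X\<close>, that is, into itself up to still phases.\<close>
lemma riccati_eq:
  assumes X: "block (up c) (down c) X = X"
  shows "riccati A c X = - ((Pu - X) ** H ** (X + Pd))"
proof -
  have XP: "X ** Pd = X" "Pu ** X = X" using block_block_eq[OF X] by auto
  have 1: "X ** abs_inv_down c ** block (down c) T Q = X ** H ** proj T" for T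
  proof -
    have "X ** abs_inv_down c ** block (down c) T Q = (X ** Pd) ** H ** proj T"
      unfolding matrix_mul_assoc[symmetric] inv_down_Q ..
    then show ?thesis by (simp add: XP)
  qed
  have "riccati A c X = - (Pu ** H ** Pd) - Pu ** H ** (Pu ** X) + X ** H ** Pd + X ** H ** (Pu ** X)"
    unfolding riccati_def Q_block_eq inv_up_Q 1 by (simp add: matmul.minus_left matrix_mul_assoc)
  then show ?thesis unfolding XP by (simp add: matmul.diff_left matmul.add_right)
qed

end

context fluid_model
begin

abbreviation E :: "real \<Rightarrow> real^'s^'s" where "E y \<equiv> mat_exp (y *\<^sub>R H)"

text \<open>The columns of \<open>N ** E y\<close> are annihilated by the generator, so Dynkin's inequality holds for them and for
  their negatives. At level 0 they reduce, on the non-still phases, to the columns of the identity.\<close>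
lemma exit_identity:
  assumes b: "b > 0"
  shows "Pu = exit_law b ** Pd + exit_law b ** Pu ** E b"
proof -
  have main: "(if i = k then 1 else 0) = (\<Sum>j\<in>UNIV. exit_law b $ i $ j * (if j \<in> up c then E b $ j $ k else if j \<in> down c \<and> j = k then 1 else 0))"
    if i: "i \<in> up c" for i k
  proof -
    define f where "f y j = (N ** E y) $ j $ k" for y j
    define f1 where "f1 y j = (N ** (H ** E y)) $ j $ k" for y j
    define f2 where "f2 y j = (N ** (H ** (H ** E y))) $ j $ k" for y j
    define f3 where "f3 y j = (N ** (H ** (H ** (H ** E y)))) $ j $ k" for y j
    have d: "mat_deriv (\<lambda>y. X ** E y) (X ** (H ** E y)) y" for X y
      using mat_deriv_mult[OF mat_deriv_const[of X y] mat_deriv_mat_exp[of H y]] by simp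
    have d1: "((\<lambda>y. f y j) has_real_derivative f1 y j) (at y)" for y j
      using d[of N y] unfolding f_def f1_def mat_deriv_def by blast
    have d2: "((\<lambda>y. f1 y j) has_real_derivative f2 y j) (at y)" for y j
      using d[of "N ** H" y] unfolding f1_def f2_def mat_deriv_def by (simp add: matrix_mul_assoc)
    have d3: "((\<lambda>y. f2 y j) has_real_derivative f3 y j) (at y)" for y j
      using d[of "N ** H ** H" y] unfolding f2_def f3_def mat_deriv_def by (simp add: matrix_mul_assoc)
    have cont: "continuous_on UNIV (\<lambda>y. f2 y j)" for j
      by (rule DERIV_continuous_on[where D = "\<lambda>y. f3 y j"]) (rule d3)
    have C2: "C2 f f1 f2" unfolding C2_def using d1 d2 cont by blast
    have C2': "C2 (\<lambda>y j. - f y j) (\<lambda>y j. - f1 y j) (\<lambda>y j. - f2 y j)"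
      unfolding C2_def using d1 d2 cont by (auto intro!: DERIV_minus continuous_on_minus)
    have L: "c $ i * f1 y i + (\<Sum>j\<in>UNIV. A $ i $ j * f y j) = 0" for y i
      using harmonic[of i "E y" k] by (simp add: f_def f1_def matrix_entry[of A])
    have "f 0 i \<le> (\<Sum>j\<in>UNIV. exit_law b $ i $ j * f (edge b j) j)"
      by (rule exit_inequality[OF C2 b i]) (simp add: L)
    moreover have "- f 0 i \<le> (\<Sum>j\<in>UNIV. exit_law b $ i $ j * - f (edge b j) j)"
    proof (rule exit_inequality[OF C2' b i])
      fix y i
      have "c $ i * - f1 y i + (\<Sum>j\<in>UNIV. A $ i $ j * - f y j) = - (c $ i * f1 y i + (\<Sum>j\<in>UNIV. A $ i $ j * f y j))"
        by (simp add: sum_negf)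
      then show "0 \<le> c $ i * - f1 y i + (\<Sum>j\<in>UNIV. A $ i $ j * - f y j)" unfolding L by simp
    qed
    ultimately have eq: "f 0 i = (\<Sum>j\<in>UNIV. exit_law b $ i $ j * f (edge b j) j)" by (simp add: sum_negf)
    have f0: "f 0 j = (if j = k then 1 else 0)" if "j \<notin> still c" for j
      unfolding f_def using N_nonstill[OF that, of "mat 1" k] by (simp add: mat_exp_zero) (simp add: mat_def)
    have fb: "f b j = E b $ j $ k" if "j \<notin> still c" for j
      unfolding f_def using N_nonstill[OF that] .
    have "(\<Sum>j\<in>UNIV. exit_law b $ i $ j * f (edge b j) j) =
      (\<Sum>j\<in>UNIV. exit_law b $ i $ j * (if j \<in> up c then E b $ j $ k else if j \<in> down c \<and> j = k then 1 else 0))"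
    proof (rule sum.cong)
      fix j
      consider "j \<in> up c" | "j \<in> down c" | "c $ j = 0" by (auto simp: up_def down_def) linarith
      then show "exit_law b $ i $ j * f (edge b j) j = exit_law b $ i $ j * (if j \<in> up c then E b $ j $ k else if j \<in> down c \<and> j = k then 1 else 0)"
      proof cases
        case 1 then show ?thesis using fb[of j] by (simp add: edge_def up_def still_def)
      next
        case 2 then show ?thesis using f0[of j] by (simp add: edge_def up_def down_def still_def)
      next
        case 3 then show ?thesis by (simp add: exit_law_still)
      qed
    qed simp
    moreover have "f 0 i = (if i = k then 1 else 0)" using f0[of i] i by (simp add: still_def up_def)
    ultimately show ?thesis using eq by simp
  qed
  have "Pu $ i $ k = (exit_law b ** Pd + exit_law b ** Pu ** E b) $ i $ k" for i k
  proof (cases "i \<in> up c")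
    case True
    have "(exit_law b ** Pd) $ i $ k = (\<Sum>j\<in>UNIV. if j = k then (if k \<in> down c then exit_law b $ i $ k else 0) else 0)"
      by (simp add: proj_right)
    also have "\<dots> = (\<Sum>j\<in>UNIV. exit_law b $ i $ j * (if j \<in> down c \<and> j = k then 1 else 0))"
      by (intro sum.cong) auto
    finally have 1: "(exit_law b ** Pd) $ i $ k = (\<Sum>j\<in>UNIV. exit_law b $ i $ j * (if j \<in> down c \<and> j = k then 1 else 0))" .
    have 2: "(exit_law b ** Pu ** E b) $ i $ k = (\<Sum>j\<in>UNIV. exit_law b $ i $ j * (if j \<in> up c then E b $ j $ k else 0))"
      unfolding matrix_entry[of "exit_law b ** Pu"] proj_right by (intro sum.cong) auto
    have "(exit_law b ** Pd + exit_law b ** Pu ** E b) $ i $ k =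
      (\<Sum>j\<in>UNIV. exit_law b $ i $ j * (if j \<in> up c then E b $ j $ k else if j \<in> down c \<and> j = k then 1 else 0))"
      unfolding vector_add_component 1 2 sum.distrib[symmetric]
      by (intro sum.cong) (auto simp: up_def down_def)
    moreover have "Pu $ i $ k = (if i = k then 1 else 0)" using True by (auto simp: mat_def)
    ultimately show ?thesis using main[OF True, of k] by (simp only:)
  next
    case False
    then have "exit_law b $ i $ j = 0" for j by (simp add: exit_law_def)
    then have "(exit_law b ** X) $ i $ k = 0" for X :: "real^'s^'s" and k by (simp add: matrix_entry)
    then show ?thesis using False by (simp add: matrix_mul_assoc[symmetric])
  qed
  then show ?thesis by (simp add: vec_eq_iff)
qed

definition \<Psi> :: "real^'s^'s" where "\<Psi> = first_return M \<phi> c"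

lemma Psi_block: "block (up c) (down c) \<Psi> = \<Psi>"
  by (simp add: \<Psi>_def first_return_def vec_eq_iff)

lemma exit_law_rows: "Pu ** exit_law b = exit_law b"
  by (auto simp: vec_eq_iff proj_left exit_law_def)

text \<open>By \<open>exit_identity\<close> this is also \<open>exit_law b ** Pu ** E b\<close>; it tends to \<open>Pu - \<Psi>\<close>.\<close>
definition J :: "real \<Rightarrow> real^'s^'s" where "J b = Pu - exit_law b ** Pd"

text \<open>Both sides are \<open>exit_law a\<close> times \<open>Pu ** E (a + s)\<close>, and \<open>block_inverse_identity\<close> absorbs
  \<open>J (a + s)\<close> into the latter.\<close>
lemma J_semigroup:
  assumes a: "a > 0" and s: "s > 0"
  shows "J a ** E s = J a ** E s ** J (a + s)"
proof -
  have Ja: "J a = exit_law a ** Pu ** E a" using exit_identity[OF a] by (simp add: J_def algebra_simps)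
  have b: "a + s > 0" using a s by simp
  have *: "Pu ** E (a + s) = Pu ** E (a + s) ** J (a + s)"
    unfolding J_def
  proof (rule block_inverse_identity[where r = "exit_law (a + s) ** Pu"])
    show "Pu = exit_law (a + s) ** Pd + exit_law (a + s) ** Pu ** E (a + s)" by (rule exit_identity[OF b])
    show "exit_law (a + s) ** Pd ** Pu = 0" unfolding matrix_mul_assoc[symmetric] proj_disjoint_up_down by simp
    show "exit_law (a + s) ** Pu ** Pu = exit_law (a + s) ** Pu" unfolding matrix_mul_assoc[symmetric] proj_idem ..
    show "Pu ** (exit_law (a + s) ** Pu) = exit_law (a + s) ** Pu" unfolding matrix_mul_assoc exit_law_rows ..
  qed (rule proj_idem)
  have "J a ** E s = exit_law a ** (Pu ** E (a + s))"
    unfolding Ja mat_exp_add by (simp add: matrix_mul_assoc)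
  also have "\<dots> = exit_law a ** (Pu ** E (a + s)) ** J (a + s)"
    by (subst *) (simp add: matrix_mul_assoc)
  also have "exit_law a ** (Pu ** E (a + s)) = J a ** E s"
    unfolding Ja mat_exp_add by (simp add: matrix_mul_assoc)
  finally show ?thesis .
qed

lemma exit_law_le_Psi:
  assumes b: "b > 0" and ij: "i \<in> up c" "j \<in> down c"
  shows "exit_law b $ i $ j \<le> \<Psi> $ i $ j"
proof (rule LIMSEQ_le_const)
  show "(\<lambda>n. exit_law (real (Suc n)) $ i $ j) \<longlonglongrightarrow> \<Psi> $ i $ j" unfolding \<Psi>_def by (rule exit_law_tendsto[OF ij])
  obtain n0 where n0: "b < real n0" using reals_Archimedean2 by blast
  have "exit_law b $ i $ j \<le> exit_law (real (Suc n)) $ i $ j" if "n \<ge> n0" for n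
    using that n0 b ij by (intro exit_law_mono) (auto simp: down_def)
  then show "\<exists>N. \<forall>n\<ge>N. exit_law b $ i $ j \<le> exit_law (real (Suc n)) $ i $ j" by blast
qed

lemma J_tendsto:
  assumes s: "s \<ge> 0"
  shows "(\<lambda>n. J (real (Suc n) + s)) \<longlonglongrightarrow> Pu - \<Psi>"
proof (rule matrix_tendsto)
  fix i j
  have "(\<lambda>n. (exit_law (real (Suc n) + s) ** Pd) $ i $ j) \<longlonglongrightarrow> \<Psi> $ i $ j"
  proof (cases "i \<in> up c \<and> j \<in> down c")
    case True
    then have j: "c $ j < 0" by (simp add: down_def)
    have "(\<lambda>n. exit_law (real (Suc n) + s) $ i $ j) \<longlonglongrightarrow> \<Psi> $ i $ j"
      unfolding \<Psi>_def
    proof (rule tendsto_sandwich[OF _ _ exit_law_tendsto[of i j] tendsto_const])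
      show "\<forall>\<^sub>F n in sequentially. exit_law (real (Suc n)) $ i $ j \<le> exit_law (real (Suc n) + s) $ i $ j"
        using s j by (intro always_eventually allI exit_law_mono) auto
      show "\<forall>\<^sub>F n in sequentially. exit_law (real (Suc n) + s) $ i $ j \<le> first_return M \<phi> c $ i $ j"
        using exit_law_le_Psi[of _ i j] True s unfolding \<Psi>_def by (intro always_eventually allI) (simp add: add_pos_nonneg)
    qed (use True in \<open>auto simp: \<Psi>_def\<close>)
    then show ?thesis using True by (simp add: proj_right)
  next
    case False
    then have "\<Psi> $ i $ j = 0" unfolding \<Psi>_def first_return_def by auto
    moreover have "(exit_law (real (Suc n) + s) ** Pd) $ i $ j = 0" for n
      using False by (auto simp: proj_right exit_law_def)
    ultimately show ?thesis by simp
  qed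
  then show "(\<lambda>n. J (real (Suc n) + s) $ i $ j) \<longlonglongrightarrow> (Pu - \<Psi>) $ i $ j"
    unfolding J_def vector_minus_component by (intro tendsto_diff tendsto_const)
qed

lemma Psi_semigroup:
  assumes s: "s > 0"
  shows "(Pu - \<Psi>) ** E s = (Pu - \<Psi>) ** E s ** (Pu - \<Psi>)"
proof (rule LIMSEQ_unique)
  have 1: "(\<lambda>n. J (real (Suc n))) \<longlonglongrightarrow> Pu - \<Psi>" using J_tendsto[of 0] by simp
  show "(\<lambda>n. J (real (Suc n)) ** E s) \<longlonglongrightarrow> (Pu - \<Psi>) ** E s"
    by (intro matmul.tendsto 1 tendsto_const)
  have "(\<lambda>n. J (real (Suc n)) ** E s ** J (real (Suc n) + s)) \<longlonglongrightarrow> (Pu - \<Psi>) ** E s ** (Pu - \<Psi>)"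
    using s by (intro matmul.tendsto 1 tendsto_const J_tendsto) simp
  then show "(\<lambda>n. J (real (Suc n)) ** E s) \<longlonglongrightarrow> (Pu - \<Psi>) ** E s ** (Pu - \<Psi>)"
    using J_semigroup[OF _ s] by simp
qed

lemma Psi_proj: "Pu ** \<Psi> = \<Psi>" "\<Psi> ** Pd = \<Psi>" "\<Psi> ** Pu = 0"
proof -
  show 1: "Pu ** \<Psi> = \<Psi>" and 2: "\<Psi> ** Pd = \<Psi>" using block_block_eq[OF Psi_block] by auto
  have "\<Psi> ** Pu = \<Psi> ** Pd ** Pu" by (simp add: 2)
  then show "\<Psi> ** Pu = 0" unfolding matrix_mul_assoc[symmetric] proj_disjoint_up_down by simp
qed

text \<open>The derivative at \<open>s = 0\<close> of \<open>V ** E s ** (mat 1 - V) = 0\<close>, where \<open>V = Pu - \<Psi>\<close>. Since \<open>mat 1 - V\<close> is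
  \<open>\<Psi> + Pd\<close> plus the projection on the still phases, which \<open>H\<close> annihilates, the claim follows.\<close>
lemma Psi_invariant: "(Pu - \<Psi>) ** H ** (\<Psi> + Pd) = 0"
proof -
  define V where "V = Pu - \<Psi>"
  have z: "V ** E s ** (mat 1 - V) = 0" if "s > 0" for s
    using Psi_semigroup[OF that] unfolding V_def[symmetric] by (simp add: matmul.diff_right)
  have z0: "V ** E 0 ** (mat 1 - V) = 0"
  proof -
    have "\<Psi> ** \<Psi> = \<Psi> ** (Pu ** \<Psi>)" unfolding Psi_proj(1) ..
    also have "\<dots> = \<Psi> ** Pu ** \<Psi>" by (rule matrix_mul_assoc)
    finally have "\<Psi> ** \<Psi> = 0" unfolding Psi_proj(3) by simp
    then have "V ** V = V" by (simp add: V_def matmul.diff_left matmul.diff_right proj_idem Psi_proj)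
    then show ?thesis by (simp add: mat_exp_zero matmul.diff_right)
  qed
  have "(V ** H ** (mat 1 - V)) $ i $ j = 0" for i j
  proof -
    define g where "g s = (V ** E s ** (mat 1 - V)) $ i $ j" for s
    have "mat_deriv (\<lambda>s. V ** E s ** (mat 1 - V)) (V ** H ** (mat 1 - V)) 0"
      using mat_deriv_mult[OF mat_deriv_mult[OF mat_deriv_const[of V 0] mat_deriv_mat_exp[of H 0]] mat_deriv_const[of "mat 1 - V" 0]]
      by (simp add: mat_exp_zero)
    then have "(g has_real_derivative (V ** H ** (mat 1 - V)) $ i $ j) (at 0)" by (simp add: mat_deriv_def g_def[abs_def])
    then have "((\<lambda>y. (g y - g 0) / (y - 0)) \<longlongrightarrow> (V ** H ** (mat 1 - V)) $ i $ j) (at 0)"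
      by (simp add: has_field_derivative_iff)
    moreover have "filterlim (\<lambda>n. inverse (real (Suc n))) (at 0) sequentially"
      by (rule filterlim_atI[OF LIMSEQ_inverse_real_of_nat]) simp
    ultimately have "(\<lambda>n. (g (inverse (real (Suc n))) - g 0) / (inverse (real (Suc n)) - 0)) \<longlonglongrightarrow> (V ** H ** (mat 1 - V)) $ i $ j"
      by (rule filterlim_compose)
    moreover have "g (inverse (real (Suc n))) = 0" for n using z[of "inverse (real (Suc n))"] by (simp add: g_def)
    moreover have "g 0 = 0" using z0 by (simp add: g_def)
    ultimately have "(\<lambda>n::nat. 0) \<longlonglongrightarrow> (V ** H ** (mat 1 - V)) $ i $ j" by simp
    then show ?thesis using LIMSEQ_unique tendsto_const by blast
  qed
  then have "V ** H ** (mat 1 - V) = 0" by (simp add: vec_eq_iff)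
  moreover have "mat 1 - V = (\<Psi> + Pd) + proj (still c)" using mat_1_split[of c] by (simp add: V_def algebra_simps)
  ultimately have "V ** H ** (\<Psi> + Pd) + V ** (H ** proj (still c)) = 0" by (simp add: matmul.add_right matrix_mul_assoc)
  then show ?thesis by (simp add: H_still V_def)
qed

lemma Psi_riccati: "riccati A c \<Psi> = 0"
  unfolding riccati_eq[OF Psi_block] Psi_invariant by simp

lemma Psi_nonneg: "\<Psi> $ i $ j \<ge> 0"
  unfolding \<Psi>_def first_return_def by (simp add: cond_prob_def)

lemma U_offdiag:
  assumes X: "block (up c) (down c) X = X" and X0: "\<And>i j. X $ i $ j \<ge> 0" and ij: "i \<noteq> j"
  shows "U_matrix A c X $ i $ j \<ge> 0"
proof -
  have Q0: "block (down c) T Q $ i $ j \<ge> 0" if "i \<noteq> j" for T i j using Q_offdiag[OF that] by simp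
  have QX: "(block (down c) (up c) Q ** X) $ k $ j \<ge> 0" for k
  proof -
    have "block (down c) (up c) Q $ k $ l \<ge> 0" for l using Q0[of k l "up c"] by (cases "k = l") (auto simp: up_def down_def)
    then show ?thesis unfolding matrix_entry using X0 by (intro sum_nonneg) simp
  qed
  have D: "(abs_inv_down c ** Z) $ i $ j = (if i \<in> down c then - Z $ i $ j / c $ i else 0)" for Z :: "real^'s^'s"
  proof -
    have "(abs_inv_down c ** Z) $ i $ j = (\<Sum>k\<in>UNIV. if k = i then (if i \<in> down c then - Z $ i $ j / c $ i else 0) else 0)"
      unfolding matrix_entry by (intro sum.cong) (auto simp: inv_down_entry)
    then show ?thesis by simp
  qed
  have "U_matrix A c X = abs_inv_down c ** (block (down c) (down c) Q + block (down c) (up c) Q ** X)"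
    unfolding U_matrix_def Q_block_eq by (simp add: matmul.add_right matrix_mul_assoc)
  then show ?thesis using Q0[OF ij, of "down c"] QX[of i]
    unfolding D by (auto simp: D down_def intro!: divide_nonpos_neg simp del: block_entry)
qed

text \<open>With \<open>G = Z + Pd\<close>, the Riccati equation says \<open>H ** G = G ** U\<close>, which passes to exponentials. Multiplying
  \<open>exit_identity\<close> by \<open>G\<close> therefore bounds \<open>Z\<close> below by the probabilities to leave a strip through its bottom.\<close>
lemma Psi_minimal:
  assumes Z: "nonneg_solution A c Z"
  shows "\<Psi> \<le> Z"
proof -
  have Zb: "block (up c) (down c) Z = Z" and Z0: "\<And>i j. Z $ i $ j \<ge> 0" and Zr: "riccati A c Z = 0"
    using Z by (auto simp: nonneg_solution_def less_eq_vec_def)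
  have ZP: "Pu ** Z = Z" "Z ** Pd = Z" using block_block_eq[OF Zb] by auto
  define U where "U = U_matrix A c Z"
  define G where "G = Z + Pd"
  have U: "U = Pd ** H ** G" unfolding U_def G_def by (rule U_eq[OF Zb])
  have PdG: "Pd ** G = Pd"
  proof -
    have "Pd ** Z = Pd ** (Pu ** Z)" by (simp add: ZP)
    also have "\<dots> = 0" unfolding matrix_mul_assoc proj_disjoint_up_down by simp
    finally show ?thesis by (simp add: G_def matmul.add_right proj_idem)
  qed
  have PuG: "Pu ** G = Z" by (simp add: G_def matmul.add_right ZP proj_disjoint_up_down)
  have HG: "H ** G = G ** U"
  proof -
    have "(Pu - Z) ** H ** G = 0" using Zr unfolding riccati_eq[OF Zb] G_def by simp
    then have 1: "Pu ** H ** G = Z ** H ** G" by (simp add: matmul.diff_left)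
    have 2: "proj (still c) ** H = 0"
      by (auto simp: vec_eq_iff proj_left H_def Q_still_row)
    have "H ** G = (Pu + Pd + proj (still c)) ** H ** G" unfolding mat_1_split[symmetric] by simp
    also have "\<dots> = Z ** H ** G + Pd ** H ** G" by (simp add: matmul.add_left 1 2)
    also have "Z ** H ** G = Z ** U" unfolding U by (simp add: matrix_mul_assoc ZP)
    also have "Pd ** H ** G = Pd ** U" unfolding U by (simp add: matrix_mul_assoc proj_idem)
    finally show ?thesis by (simp add: G_def matmul.add_left)
  qed
  have bound: "exit_law b $ i $ j \<le> Z $ i $ j" if b: "b > 0" and ij: "i \<in> up c" "j \<in> down c" for b i j
  proof -
    have "Z = (exit_law b ** Pd + exit_law b ** Pu ** E b) ** G"
      unfolding exit_identity[OF b, symmetric] by (simp add: PuG)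
    also have "\<dots> = exit_law b ** (Pd ** G) + exit_law b ** (Pu ** (E b ** G))"
      by (simp add: matmul.add_left matrix_mul_assoc)
    also have "E b ** G = G ** mat_exp (b *\<^sub>R U)" by (rule mat_exp_intertwine[OF HG])
    also have "Pu ** (G ** mat_exp (b *\<^sub>R U)) = Z ** mat_exp (b *\<^sub>R U)" by (simp add: matrix_mul_assoc PuG)
    finally have eq: "Z = exit_law b ** Pd + exit_law b ** (Z ** mat_exp (b *\<^sub>R U))" by (simp add: PdG)
    have "(Z ** mat_exp (b *\<^sub>R U)) $ k $ j \<ge> 0" for k
      unfolding matrix_entry using Z0 b
      by (intro sum_nonneg mult_nonneg_nonneg mat_exp_nonneg) (auto simp: U_def intro: U_offdiag[OF Zb Z0])
    then have "(exit_law b ** (Z ** mat_exp (b *\<^sub>R U))) $ i $ j \<ge> 0"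
      unfolding matrix_entry[of "exit_law b"] by (intro sum_nonneg mult_nonneg_nonneg exit_law_nonneg)
    moreover have "Z $ i $ j = (exit_law b ** Pd) $ i $ j + (exit_law b ** (Z ** mat_exp (b *\<^sub>R U))) $ i $ j"
      using arg_cong[OF eq, of "\<lambda>X. X $ i $ j"] by simp
    ultimately show ?thesis using ij by (simp add: proj_right)
  qed
  have "\<Psi> $ i $ j \<le> Z $ i $ j" for i j
  proof (cases "i \<in> up c \<and> j \<in> down c")
    case True
    show ?thesis unfolding \<Psi>_def
      by (rule LIMSEQ_le_const2[OF exit_law_tendsto]) (use True bound in auto)
  next
    case False
    then have "\<Psi> $ i $ j = 0" unfolding \<Psi>_def first_return_def by auto
    then show ?thesis using Z0 by simp
  qed
  then show ?thesis by (simp add: less_eq_vec_def)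
qed

lemma first_return_minimal: "minimal_nonneg_solution A c (first_return M \<phi> c)"
  unfolding minimal_nonneg_solution_def nonneg_solution_def \<Psi>_def[symmetric]
proof (intro conjI allI impI)
  show "0 \<le> \<Psi>" by (simp add: less_eq_vec_def Psi_nonneg)
  fix Z assume "block (up c) (down c) Z = Z \<and> 0 \<le> Z \<and> riccati A c Z = 0"
  then show "\<Psi> \<le> Z" by (intro Psi_minimal) (simp add: nonneg_solution_def)
qed (fact Psi_block Psi_riccati)+

lemma Psi_rowsum_le: "(\<Sum>j\<in>UNIV. \<Psi> $ i $ j) \<le> 1"
proof (cases "i \<in> up c")
  case True
  have eq: "(\<Sum>j\<in>UNIV. \<Psi> $ i $ j) = (\<Sum>j\<in>down c. \<Psi> $ i $ j)"
    by (rule sum.mono_neutral_right) (auto simp: \<Psi>_def first_return_def)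
  have "(\<lambda>n. \<Sum>j\<in>down c. exit_law (real (Suc n)) $ i $ j) \<longlonglongrightarrow> (\<Sum>j\<in>down c. \<Psi> $ i $ j)"
    unfolding \<Psi>_def using True by (intro tendsto_sum exit_law_tendsto)
  then show ?thesis unfolding eq
  proof (rule LIMSEQ_le_const2)
    have "(\<Sum>j\<in>down c. exit_law (real (Suc n)) $ i $ j) \<le> 1" for n
    proof -
      have "(\<Sum>j\<in>down c. exit_law (real (Suc n)) $ i $ j) \<le> (\<Sum>j\<in>UNIV. exit_law (real (Suc n)) $ i $ j)"
        by (intro sum_mono2) (auto simp: exit_law_nonneg)
      also have "\<dots> \<le> 1" by (rule exit_law_sum) simp
      finally show ?thesis .
    qed
    then show "\<exists>N. \<forall>n\<ge>N. (\<Sum>j\<in>down c. exit_law (real (Suc n)) $ i $ j) \<le> 1" by blast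
  qed
next
  case False
  then have "\<Psi> $ i $ j = 0" for j by (simp add: \<Psi>_def first_return_def)
  then show ?thesis by simp
qed

end

section \<open>The Sylvester operator under negative drift\<close>

lemma (in fluid_generator) B_c: "(B *v c) = 0"
proof -
  have "B $ i $ j * c $ j = 0" for i j by (cases "j \<in> still c") (auto simp: B_zero, simp add: still_def)
  then have "(B *v c) $ i = 0" for i unfolding mv_entry by (rule sum.neutral[OF ballI])
  then show ?thesis by (simp add: vec_eq_iff)
qed

text \<open>For the function \<open>u\<close> of the drift equation, \<open>Q *v u = \<mu> w - c\<close>, where \<open>w\<close> is 1 plus the expected time in
  still phases weighted by the rates of entering them; the term \<open>B *v c\<close> vanishes because \<open>c\<close> does so on still phases.\<close>
lemma (in fluid_generator) H_drift:
  assumes u: "\<And>i. c $ i + (\<Sum>j\<in>UNIV. A $ i $ j * u $ j) = \<mu>"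
  obtains w where "\<And>i. i \<notin> still c \<Longrightarrow> (H *v u) $ i = 1 - \<mu> * w i / c $ i" "\<And>i. i \<notin> still c \<Longrightarrow> w i \<ge> 1"
proof -
  define w where "w i = 1 + (A *v (B *v 1)) $ i" for i
  have Au: "A *v u = \<mu> *\<^sub>R 1 - c"
    using u by (simp add: vec_eq_iff mv_entry algebra_simps)
  have Bu: "B *v (A *v u) = \<mu> *\<^sub>R (B *v 1)"
    unfolding Au by (simp add: matrix_vector_mult_diff_distrib B_c matrix_vector_mult_scaleR)
  have "Q *v u = A *v u + A *v (B *v (A *v u))"
    by (simp add: Q_def matrix_vector_mult_add_rdistrib matrix_vector_mul_assoc matrix_mul_assoc)
  also have "\<dots> = \<mu> *\<^sub>R 1 - c + \<mu> *\<^sub>R (A *v (B *v 1))"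
    unfolding Bu unfolding Au by (simp add: matrix_vector_mult_scaleR)
  finally have eq: "Q *v u = \<mu> *\<^sub>R 1 - c + \<mu> *\<^sub>R (A *v (B *v 1))" .
  have Qu: "(Q *v u) $ i = \<mu> * w i - c $ i" for i unfolding eq by (simp add: w_def algebra_simps)
  show ?thesis
  proof (rule that[of w])
    fix i assume i: "i \<notin> still c"
    have "(H *v u) $ i = - (Q *v u) $ i / c $ i"
      by (simp add: mv_entry H_def sum_negf sum_divide_distrib)
    then show "(H *v u) $ i = 1 - \<mu> * w i / c $ i"
      unfolding Qu using i by (simp add: still_def diff_divide_distrib)
    have B1: "(B *v 1) $ k \<ge> 0" for k unfolding mv_entry using B_nonneg by (intro sum_nonneg) auto
    have B10: "(B *v 1) $ k = 0" if "k \<notin> still c" for k unfolding mv_entry using that by (intro sum.neutral) (auto simp: B_zero)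
    have "A $ i $ k * (B *v 1) $ k \<ge> 0" for k
    proof (cases "k \<in> still c")
      case True
      then have "A $ i $ k \<ge> 0" using i by (intro A_offdiag) auto
      then show ?thesis using B1 by (rule mult_nonneg_nonneg)
    qed (simp add: B10)
    then have "(A *v (B *v 1)) $ i \<ge> 0" unfolding mv_entry[of A] by (intro sum_nonneg)
    then show "w i \<ge> 1" by (simp add: w_def)
  qed
qed

context fluid_model
begin

text \<open>Exit is certain: Dynkin's inequality for the constant function 1.\<close>
lemma exit_law_sum_1:
  assumes b: "b > 0" and i: "i \<in> up c"
  shows "(\<Sum>j\<in>UNIV. exit_law b $ i $ j) = 1"
proof (rule antisym)
  show "(\<Sum>j\<in>UNIV. exit_law b $ i $ j) \<le> 1" by (rule exit_law_sum[OF b])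
  have "C2 (\<lambda>y j. 1) (\<lambda>y j. 0) (\<lambda>y (j::'s). 0)" by (auto simp: C2_def)
  from exit_inequality[OF this b i] show "1 \<le> (\<Sum>j\<in>UNIV. exit_law b $ i $ j)"
    by (simp add: A_rowsum)
qed

text \<open>Dynkin's inequality for \<open>- (y + u $ j)\<close>, whose image under the generator is the positive constant \<open>- \<mu>\<close>.\<close>
lemma exit_law_drift:
  assumes \<mu>: "\<mu> < 0" and u: "\<And>i. c $ i + (\<Sum>j\<in>UNIV. A $ i $ j * u $ j) = \<mu>"
    and b: "b > 0" and i: "i \<in> up c"
  shows "(\<Sum>j\<in>UNIV. exit_law b $ i $ j * (edge b j + u $ j)) \<le> u $ i"
proof -
  have C: "C2 (\<lambda>y j. - (y + u $ j)) (\<lambda>y j. - 1) (\<lambda>y j. 0)"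
    unfolding C2_def by (auto intro!: derivative_eq_intros)
  have "- (0 + u $ i) \<le> (\<Sum>j\<in>UNIV. exit_law b $ i $ j * - (edge b j + u $ j))"
  proof (rule exit_inequality[OF C b i])
    fix y i
    have "(\<Sum>j\<in>UNIV. A $ i $ j * - (y + u $ j)) = - ((\<Sum>j\<in>UNIV. A $ i $ j) * y + (\<Sum>j\<in>UNIV. A $ i $ j * u $ j))"
    proof -
      have "A $ i $ j * - (y + u $ j) = - (A $ i $ j * y + A $ i $ j * u $ j)" for j by (simp add: algebra_simps)
      then show ?thesis by (simp only: sum_negf sum.distrib sum_distrib_right)
    qed
    then show "0 \<le> c $ i * - 1 + (\<Sum>j\<in>UNIV. A $ i $ j * - (y + u $ j))"
      using u[of i] \<mu> by (simp add: A_rowsum)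
  qed
  then show ?thesis by (simp only: mult_minus_right sum_negf add_0 neg_le_iff_le)
qed

lemma drift_level:
  obtains u :: "real^'s" where "\<And>i. c $ i + (\<Sum>j\<in>UNIV. A $ i $ j * u $ j) = \<mu>"
proof -
  obtain u where "\<And>i. c $ i + (\<Sum>j\<in>UNIV. A $ i $ j * u j) = \<mu>" using drift_equation by blast
  then show ?thesis using that[of "\<chi> i. u i"] by simp
qed

lemma sum_up_down:
  fixes g :: "'s \<Rightarrow> real"
  assumes "\<And>j. c $ j = 0 \<Longrightarrow> g j = 0"
  shows "(\<Sum>j\<in>UNIV. g j) = (\<Sum>j\<in>up c. g j) + (\<Sum>j\<in>down c. g j)"
proof -
  have "(\<Sum>j\<in>UNIV. g j) = (\<Sum>j\<in>up c \<union> down c. g j)"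
    by (rule sum.mono_neutral_right) (auto simp: up_def down_def not_less intro!: assms antisym)
  also have "\<dots> = (\<Sum>j\<in>up c. g j) + (\<Sum>j\<in>down c. g j)"
    by (rule sum.union_disjoint) (auto simp: up_def down_def)
  finally show ?thesis .
qed

lemma Psi_sum_tendsto:
  assumes i: "i \<in> up c"
  shows "(\<lambda>n. \<Sum>j\<in>down c. exit_law (real (Suc n)) $ i $ j * g j) \<longlonglongrightarrow> (\<Sum>j\<in>UNIV. \<Psi> $ i $ j * g j)"
proof -
  have eq: "(\<Sum>j\<in>UNIV. \<Psi> $ i $ j * g j) = (\<Sum>j\<in>down c. \<Psi> $ i $ j * g j)"
    by (rule sum.mono_neutral_right) (auto simp: \<Psi>_def first_return_def)
  show ?thesis unfolding eq
    unfolding \<Psi>_def using i by (intro tendsto_sum tendsto_mult tendsto_const exit_law_tendsto)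
qed

text \<open>By \<open>exit_law_drift\<close>, \<open>b\<close> times the probability of leaving \<open>{0..b}\<close> through the top stays bounded.\<close>
lemma Psi_rowsum:
  assumes \<mu>: "\<mu> < 0" and i: "i \<in> up c"
  shows "(\<Sum>j\<in>UNIV. \<Psi> $ i $ j) = 1"
proof (rule antisym[OF Psi_rowsum_le])
  obtain u :: "real^'s" where u: "\<And>i. c $ i + (\<Sum>j\<in>UNIV. A $ i $ j * u $ j) = \<mu>" by (rule drift_level) (rule that)
  define m where "m = (\<Sum>j\<in>UNIV. \<bar>u $ j\<bar>)"
  have m: "\<bar>u $ j\<bar> \<le> m" for j unfolding m_def by (intro member_le_sum) auto
  have le: "1 - 2 * m / real (Suc n) \<le> (\<Sum>j\<in>down c. exit_law (real (Suc n)) $ i $ j * 1)" for n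
  proof -
    let ?b = "real (Suc n)"
    have b: "?b > 0" by simp
    let ?W = "\<lambda>j. exit_law ?b $ i $ j"
    have "(\<Sum>j\<in>UNIV. ?W j * (edge ?b j + u $ j)) = (\<Sum>j\<in>UNIV. ?W j * edge ?b j) + (\<Sum>j\<in>UNIV. ?W j * u $ j)"
      by (simp add: distrib_left sum.distrib)
    also have "(\<Sum>j\<in>UNIV. ?W j * edge ?b j) = (\<Sum>j\<in>up c. ?W j) * ?b"
      unfolding sum_distrib_right by (rule sum.mono_neutral_cong_right) (auto simp: edge_def up_def)
    finally have "(\<Sum>j\<in>up c. ?W j) * ?b \<le> u $ i - (\<Sum>j\<in>UNIV. ?W j * u $ j)"
      using exit_law_drift[OF \<mu> u b i] by linarith
    also have "\<dots> \<le> m + m"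
    proof -
      have "- (\<Sum>j\<in>UNIV. ?W j * u $ j) \<le> (\<Sum>j\<in>UNIV. ?W j * m)"
        unfolding sum_negf[symmetric]
      proof (rule sum_mono)
        fix j
        have "- u $ j \<le> m" using m[of j] by (simp add: abs_le_iff)
        then have "?W j * (- u $ j) \<le> ?W j * m" by (intro mult_left_mono exit_law_nonneg)
        then show "- (?W j * u $ j) \<le> ?W j * m" by simp
      qed
      also have "\<dots> = m" unfolding sum_distrib_right[symmetric] exit_law_sum_1[OF b i] by simp
      finally show ?thesis using m[of i] by (simp add: abs_le_iff)
    qed
    finally have "(\<Sum>j\<in>up c. ?W j) \<le> 2 * m / ?b" using b by (simp add: pos_le_divide_eq)
    moreover have "(\<Sum>j\<in>up c. ?W j) + (\<Sum>j\<in>down c. ?W j) = 1"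
      using sum_up_down[of ?W] exit_law_sum_1[OF b i] exit_law_still by simp
    ultimately show ?thesis by simp
  qed
  have "(\<lambda>n. 1 - 2 * m / real (Suc n)) \<longlonglongrightarrow> 1 - 0"
    using LIMSEQ_Suc[OF lim_const_over_n[of "2 * m"]] by (intro tendsto_diff tendsto_const) simp
  from LIMSEQ_le[OF this Psi_sum_tendsto[OF i, of "\<lambda>_. 1"]] le
  show "1 \<le> (\<Sum>j\<in>UNIV. \<Psi> $ i $ j)" by simp
qed

lemma K_block: "block (up c) (up c) (K_matrix A c \<Psi>) = K_matrix A c \<Psi>"
proof -
  have "Pu ** (K_matrix A c \<Psi>) ** Pu = K_matrix A c \<Psi>"
    unfolding K_eq[OF Psi_block] by (simp add: matmul.minus_left matmul.minus_right matmul.diff_left matmul.diff_right matrix_mul_assoc proj_idem Psi_proj)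
       (simp add: matrix_mul_assoc[symmetric] proj_idem)
  then show ?thesis unfolding block_eq_proj[of "up c" "up c" "K_matrix A c \<Psi>"] .
qed

lemma K_offdiag:
  assumes ij: "i \<noteq> j" shows "K_matrix A c \<Psi> $ i $ j \<ge> 0"
proof -
  have 1: "(inv_up c ** block (up c) (up c) Q) $ i $ j \<ge> 0"
    unfolding matrix_entry using ij
    by (intro sum_nonneg) (auto simp: inv_up_entry up_def intro!: divide_nonneg_pos Q_offdiag)
  have 2: "(abs_inv_down c ** block (down c) (up c) Q) $ k $ j \<ge> 0" for k
    unfolding matrix_entry
  proof (rule sum_nonneg)
    fix l
    show "0 \<le> abs_inv_down c $ k $ l * block (down c) (up c) Q $ l $ j"
    proof (cases "l \<in> down c \<and> j \<in> up c \<and> k = l")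
      case True
      then have "Q $ l $ j \<ge> 0" by (intro Q_offdiag) (auto simp: up_def down_def)
      then show ?thesis using True by (auto simp: inv_down_entry down_def divide_nonneg_neg)
    qed (auto simp: inv_down_entry)
  qed
  have "(\<Psi> ** (abs_inv_down c ** block (down c) (up c) Q)) $ i $ j \<ge> 0"
    unfolding matrix_entry[of \<Psi>] by (intro sum_nonneg mult_nonneg_nonneg Psi_nonneg 2)
  then show ?thesis using 1 unfolding K_matrix_def Q_block_eq by (simp add: matrix_mul_assoc)
qed

text \<open>The vector is \<open>v = (Pu - \<Psi>) *v u\<close>: the amount by which \<open>u\<close> drops on average between the start and the first
  return. It is non-negative by \<open>exit_law_drift\<close>, and \<open>K *v v = - (Pu - \<Psi>) *v (H *v u)\<close>, which
  \<open>H_drift\<close> shows to be negative; off-diagonal non-negativity of \<open>K\<close> then excludes zeros of \<open>v\<close>.\<close>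
lemma K_stable:
  assumes \<mu>: "\<mu> < 0"
  obtains v :: "real^'s" where "\<And>i. i \<in> up c \<Longrightarrow> v $ i > 0" "\<And>i. i \<notin> up c \<Longrightarrow> v $ i = 0"
    "\<And>i. i \<in> up c \<Longrightarrow> (K_matrix A c \<Psi> *v v) $ i < 0"
proof -
  obtain u :: "real^'s" where u: "\<And>i. c $ i + (\<Sum>j\<in>UNIV. A $ i $ j * u $ j) = \<mu>" by (rule drift_level) (rule that)
  define V where "V = Pu - \<Psi>"
  define v where "v = V *v u"
  obtain w where w: "\<And>i. i \<notin> still c \<Longrightarrow> (H *v u) $ i = 1 - \<mu> * w i / c $ i" "\<And>i. i \<notin> still c \<Longrightarrow> w i \<ge> 1"
    by (rule H_drift[OF u]) (rule that)
  have V_mult: "(V *v x) $ i = (if i \<in> up c then x $ i else 0) - (\<Sum>j\<in>UNIV. \<Psi> $ i $ j * x $ j)" for x i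
  proof -
    have "(Pu *v x) $ i = (\<Sum>j\<in>UNIV. if j = i then (if i \<in> up c then x $ i else 0) else 0)"
      unfolding mv_entry by (intro sum.cong) (auto simp: mat_def)
    then show ?thesis by (simp add: V_def matrix_vector_mult_diff_rdistrib mv_entry[of \<Psi>])
  qed
  have v0: "v $ i = 0" if "i \<notin> up c" for i
    using that by (simp add: v_def V_mult \<Psi>_def first_return_def)
  have v_nonneg: "v $ i \<ge> 0" if i: "i \<in> up c" for i
  proof -
    define m where "m = (\<Sum>j\<in>UNIV. \<bar>u $ j\<bar>)"
    have m: "\<bar>u $ j\<bar> \<le> m" for j unfolding m_def by (intro member_le_sum) auto
    obtain n0 where n0: "m < real n0" using reals_Archimedean2 by blast
    have "(\<Sum>j\<in>down c. exit_law (real (Suc n)) $ i $ j * u $ j) \<le> u $ i" if n: "n \<ge> n0" for n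
    proof -
      let ?b = "real (Suc n)"
      have b: "?b > 0" by simp
      let ?g = "\<lambda>j. exit_law ?b $ i $ j * (edge ?b j + u $ j)"
      have "(\<Sum>j\<in>up c. ?g j) + (\<Sum>j\<in>down c. ?g j) \<le> u $ i"
        using exit_law_drift[OF \<mu> u b i] sum_up_down[of ?g] exit_law_still by simp
      moreover have "(\<Sum>j\<in>up c. ?g j) \<ge> 0"
      proof (intro sum_nonneg mult_nonneg_nonneg exit_law_nonneg)
        fix j assume "j \<in> up c"
        then show "0 \<le> edge ?b j + u $ j" using m[of j] n n0 by (simp add: edge_def up_def abs_le_iff)
      qed
      moreover have "(\<Sum>j\<in>down c. ?g j) = (\<Sum>j\<in>down c. exit_law ?b $ i $ j * u $ j)"
        by (intro sum.cong) (auto simp: edge_def down_def)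
      ultimately show ?thesis by linarith
    qed
    then have "(\<Sum>j\<in>UNIV. \<Psi> $ i $ j * u $ j) \<le> u $ i"
      by (intro LIMSEQ_le_const2[OF Psi_sum_tendsto[OF i]]) blast
    then show ?thesis using i by (simp add: v_def V_mult)
  qed
  have Kv: "K_matrix A c \<Psi> *v v = - (V *v (H *v u))"
  proof -
    have PuV: "Pu ** V = V" by (simp add: V_def matmul.diff_right proj_idem Psi_proj)
    have eq: "mat 1 = V + ((\<Psi> + Pd) + proj (still c))" using mat_1_split[of c] by (simp add: V_def algebra_simps)
    have "V ** H = V ** H ** (V + ((\<Psi> + Pd) + proj (still c)))" unfolding eq[symmetric] by simp
    also have "\<dots> = V ** H ** V + V ** H ** (\<Psi> + Pd) + V ** (H ** proj (still c))"
      by (simp only: matmul.add_right matrix_mul_assoc add.assoc)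
    also have "\<dots> = V ** H ** V" using Psi_invariant by (simp add: V_def[symmetric] H_still)
    finally have VHV: "V ** H ** V = V ** H" by simp
    have "K_matrix A c \<Psi> ** V = - (V ** H ** (Pu ** V))"
      unfolding K_eq[OF Psi_block] V_def[symmetric] by (simp add: matmul.minus_left matrix_mul_assoc)
    also have "\<dots> = - (V ** H)" by (simp add: PuV VHV)
    finally have KV: "K_matrix A c \<Psi> ** V = - (V ** H)" .
    have "K_matrix A c \<Psi> *v v = (- (V ** H)) *v u" unfolding v_def matrix_vector_mul_assoc KV ..
    then show ?thesis by (simp add: matrix_vector_mul_assoc vec_eq_iff mv_entry sum_negf)
  qed
  have Kneg: "(K_matrix A c \<Psi> *v v) $ i < 0" if i: "i \<in> up c" for i
  proof -
    have "(H *v u) $ i > 1"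
    proof -
      have "\<mu> * w i / c $ i < 0" using w(2)[of i] i \<mu> by (intro divide_neg_pos mult_neg_pos) (auto simp: still_def up_def)
      then show ?thesis using w(1)[of i] i by (simp add: still_def up_def)
    qed
    moreover have "(\<Sum>j\<in>UNIV. \<Psi> $ i $ j * (H *v u) $ j) \<le> (\<Sum>j\<in>UNIV. \<Psi> $ i $ j * 1)"
    proof (rule sum_mono)
      fix j
      show "\<Psi> $ i $ j * (H *v u) $ j \<le> \<Psi> $ i $ j * 1"
      proof (cases "j \<in> down c")
        case True
        have "\<mu> * w j \<le> 0" using w(2)[of j] True \<mu> by (intro mult_nonpos_nonneg) (auto simp: still_def down_def)
        then have "\<mu> * w j / c $ j \<ge> 0" using True by (intro divide_nonpos_neg) (auto simp: down_def)
        then have "(H *v u) $ j \<le> 1" using w(1)[of j] True by (simp add: still_def down_def)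
        then show ?thesis by (intro mult_left_mono Psi_nonneg)
      qed (simp add: \<Psi>_def first_return_def)
    qed
    ultimately show ?thesis using Psi_rowsum_le[of i] i unfolding Kv by (simp add: V_mult)
  qed
  have vpos: "v $ i > 0" if i: "i \<in> up c" for i
  proof (rule ccontr)
    assume "\<not> v $ i > 0"
    then have "v $ i = 0" using v_nonneg[OF i] by simp
    then have "K_matrix A c \<Psi> $ i $ k * v $ k \<ge> 0" for k
      using K_offdiag[of i k] v_nonneg[of k] v0[of k] by (cases "k = i"; cases "k \<in> up c") auto
    then have "(K_matrix A c \<Psi> *v v) $ i \<ge> 0" unfolding mv_entry by (intro sum_nonneg)
    then show False using Kneg[OF i] by simp
  qed
  show ?thesis by (rule that[OF vpos v0 Kneg])
qed

text \<open>The rows of \<open>Pd ** H\<close> sum to 0 and are non-negative off the diagonal; multiplication by \<open>\<Psi> + Pd\<close> instead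
  of the identity can only lower the row sums.\<close>
lemma U_rowsum_le: "(\<Sum>j\<in>UNIV. U_matrix A c \<Psi> $ i $ j) \<le> 0"
proof -
  let ?r = "\<lambda>k. \<Sum>j\<in>UNIV. (\<Psi> + Pd) $ k $ j"
  have r: "?r k \<le> 1" "k \<in> down c \<Longrightarrow> ?r k = 1" for k
  proof -
    have "(\<Sum>j\<in>UNIV. Pd $ k $ j) = (\<Sum>j\<in>UNIV. if j = k then (if k \<in> down c then 1 else 0) else 0)"
      by (intro sum.cong) (auto simp: mat_def)
    then have *: "?r k = (\<Sum>j\<in>UNIV. \<Psi> $ k $ j) + (if k \<in> down c then 1 else 0)" by (simp add: sum.distrib)
    have z: "k \<in> down c \<Longrightarrow> (\<Sum>j\<in>UNIV. \<Psi> $ k $ j) = 0"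
      by (intro sum.neutral) (auto simp: \<Psi>_def first_return_def up_def down_def)
    show "?r k \<le> 1" "k \<in> down c \<Longrightarrow> ?r k = 1"
      using z Psi_rowsum_le[of k] unfolding * by auto
  qed
  have "(\<Sum>j\<in>UNIV. U_matrix A c \<Psi> $ i $ j) = (\<Sum>k\<in>UNIV. (Pd ** H) $ i $ k * ?r k)"
    unfolding U_eq[OF Psi_block] matrix_entry[of "Pd ** H"] sum_distrib_left by (rule sum.swap)
  also have "\<dots> \<le> (\<Sum>k\<in>UNIV. (Pd ** H) $ i $ k * 1)"
  proof (rule sum_mono)
    fix k
    show "(Pd ** H) $ i $ k * ?r k \<le> (Pd ** H) $ i $ k * 1"
    proof (cases "i \<in> down c")
      case True
      show ?thesis
      proof (cases "k = i")
        case True then show ?thesis using r(2) \<open>i \<in> down c\<close> by simp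
      next
        case False
        then have "H $ i $ k \<ge> 0" using Q_offdiag[of i k] True by (simp add: H_def down_def divide_nonneg_neg)
        then show ?thesis using r(1)[of k] True unfolding proj_left by (simp only: if_True) (rule mult_left_mono)
      qed
    next
      case False then show ?thesis by (simp add: proj_left)
    qed
  qed
  also have "\<dots> = 0"
  proof -
    have "(\<Sum>k\<in>UNIV. H $ i $ k) = 0"
      using Q_rowsum[of i] by (simp add: H_def sum_divide_distrib[symmetric] sum_negf)
    then show ?thesis by (cases "i \<in> down c") (simp_all add: proj_left)
  qed
  finally show ?thesis .
qed

text \<open>Let \<open>n i\<close> be the row sums of \<open>\<bar>X\<bar>\<close>. Multiplying the equation by the signs of \<open>X\<close> and summing over a row
  gives \<open>K *v n \<ge> 0\<close>, because the contribution of \<open>U\<close> is at most 0. In the row where \<open>n i / v $ i\<close> is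
  maximal, with \<open>v\<close> from \<open>K_stable\<close>, this contradicts \<open>K *v v < 0\<close> unless \<open>n\<close> vanishes.\<close>
lemma sylvester_injective:
  assumes \<mu>: "\<mu> < 0" and X: "block (up c) (down c) X = X"
    and eq: "K_matrix A c \<Psi> ** X + X ** U_matrix A c \<Psi> = 0"
  shows "X = 0"
proof -
  define K where "K = K_matrix A c \<Psi>"
  define U where "U = U_matrix A c \<Psi>"
  obtain v :: "real^'s" where v: "\<And>i. i \<in> up c \<Longrightarrow> v $ i > 0" "\<And>i. i \<notin> up c \<Longrightarrow> v $ i = 0"
    "\<And>i. i \<in> up c \<Longrightarrow> (K *v v) $ i < 0" by (rule K_stable[OF \<mu>, folded K_def]) (rule that)
  define n where "n i = (\<Sum>j\<in>UNIV. \<bar>X $ i $ j\<bar>)" for i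
  have n0: "n i \<ge> 0" for i unfolding n_def by (intro sum_nonneg) auto
  have Xup: "X $ i $ j = 0" if "i \<notin> up c" for i j using arg_cong[OF X, of "\<lambda>M. M $ i $ j"] that by simp
  have nup: "n i = 0" if "i \<notin> up c" for i unfolding n_def using Xup[OF that] by simp
  have Koff: "K $ i $ j \<ge> 0" if "i \<noteq> j" for i j unfolding K_def using K_offdiag[OF that] .
  have Uoff: "U $ i $ j \<ge> 0" if "i \<noteq> j" for i j
    unfolding U_def by (rule U_offdiag[OF Psi_block Psi_nonneg that])
  have key: "(\<Sum>k\<in>UNIV. K $ i $ k * n k) \<ge> 0" for i
  proof -
    define s where "s j = sgn (X $ i $ j)" for j
    have s1: "\<bar>s j\<bar> \<le> 1" for j by (simp add: s_def abs_sgn_eq)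
    have Xs: "X $ i $ j * s j = \<bar>X $ i $ j\<bar>" for j by (simp add: s_def mult_sgn_abs abs_sgn)
    have 1: "(\<Sum>j\<in>UNIV. s j * (K ** X) $ i $ j) \<le> (\<Sum>k\<in>UNIV. K $ i $ k * n k)"
    proof -
      have "(\<Sum>j\<in>UNIV. s j * (K ** X) $ i $ j) = (\<Sum>j\<in>UNIV. \<Sum>k\<in>UNIV. K $ i $ k * (X $ k $ j * s j))"
        by (simp add: matrix_entry sum_distrib_left mult_ac)
      also have "\<dots> = (\<Sum>k\<in>UNIV. K $ i $ k * (\<Sum>j\<in>UNIV. X $ k $ j * s j))"
        by (subst sum.swap) (simp add: sum_distrib_left)
      also have "\<dots> \<le> (\<Sum>k\<in>UNIV. K $ i $ k * n k)"
      proof (rule sum_mono)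
        fix k
        show "K $ i $ k * (\<Sum>j\<in>UNIV. X $ k $ j * s j) \<le> K $ i $ k * n k"
        proof (cases "k = i")
          case True then show ?thesis by (simp add: n_def Xs)
        next
          case False
          have "X $ k $ j * s j \<le> \<bar>X $ k $ j\<bar>" for j
          proof -
            have "X $ k $ j * s j \<le> \<bar>X $ k $ j\<bar> * \<bar>s j\<bar>" by (simp add: abs_mult[symmetric])
            also have "\<dots> \<le> \<bar>X $ k $ j\<bar> * 1" by (intro mult_left_mono s1) simp
            finally show ?thesis by simp
          qed
          then have "(\<Sum>j\<in>UNIV. X $ k $ j * s j) \<le> n k" unfolding n_def by (intro sum_mono)
          then show ?thesis using Koff[of i k] False by (intro mult_left_mono) auto
        qed
      qed
      finally show ?thesis .
    qed
    have 2: "(\<Sum>j\<in>UNIV. s j * (X ** U) $ i $ j) \<le> 0"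
    proof -
      have "(\<Sum>j\<in>UNIV. s j * (X ** U) $ i $ j) = (\<Sum>j\<in>UNIV. \<Sum>k\<in>UNIV. X $ i $ k * (U $ k $ j * s j))"
        by (simp add: matrix_entry sum_distrib_left mult_ac)
      also have "\<dots> = (\<Sum>k\<in>UNIV. \<Sum>j\<in>UNIV. X $ i $ k * (U $ k $ j * s j))" by (rule sum.swap)
      also have "\<dots> \<le> (\<Sum>k\<in>UNIV. \<Sum>j\<in>UNIV. \<bar>X $ i $ k\<bar> * U $ k $ j)"
      proof (intro sum_mono)
        fix k j
        show "X $ i $ k * (U $ k $ j * s j) \<le> \<bar>X $ i $ k\<bar> * U $ k $ j"
        proof (cases "j = k")
          case True
          have "X $ i $ k * (U $ k $ k * s k) = (X $ i $ k * s k) * U $ k $ k" by simp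
          then have "X $ i $ k * (U $ k $ k * s k) = \<bar>X $ i $ k\<bar> * U $ k $ k" unfolding Xs .
          then show ?thesis unfolding True by (rule eq_refl)
        next
          case False
          have u: "U $ k $ j \<ge> 0" using Uoff[of k j] False by auto
          have "X $ i $ k * (U $ k $ j * s j) \<le> \<bar>X $ i $ k\<bar> * (U $ k $ j * \<bar>s j\<bar>)"
            using u abs_ge_self[of "X $ i $ k * (U $ k $ j * s j)"] by (simp add: abs_mult)
          also have "\<dots> \<le> \<bar>X $ i $ k\<bar> * (U $ k $ j * 1)" using u by (intro mult_left_mono s1) auto
          finally show ?thesis by simp
        qed
      qed
      also have "\<dots> = (\<Sum>k\<in>UNIV. \<bar>X $ i $ k\<bar> * (\<Sum>j\<in>UNIV. U $ k $ j))" by (simp add: sum_distrib_left)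
      also have "\<dots> \<le> 0" unfolding U_def by (intro sum_nonpos mult_nonneg_nonpos U_rowsum_le) auto
      finally show ?thesis .
    qed
    have "(\<Sum>j\<in>UNIV. s j * (K ** X) $ i $ j) + (\<Sum>j\<in>UNIV. s j * (X ** U) $ i $ j) = (\<Sum>j\<in>UNIV. s j * (K ** X + X ** U) $ i $ j)"
      by (simp add: distrib_left sum.distrib)
    also have "\<dots> = 0" using eq by (simp add: K_def U_def)
    finally show ?thesis using 1 2 by linarith
  qed
  have nz: "n i = 0" if i: "i \<in> up c" for i
  proof -
    define t where "t = Max ((\<lambda>i. n i / v $ i) ` up c)"
    have "t \<in> (\<lambda>i. n i / v $ i) ` up c" unfolding t_def using i by (intro Max_in) auto
    then obtain k where k: "k \<in> up c" "n k / v $ k = t" by auto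
    have tmax: "n j \<le> t * v $ j" for j
    proof (cases "j \<in> up c")
      case True
      then have "n j / v $ j \<le> t" unfolding t_def by (intro Max_ge) auto
      then show ?thesis using v(1)[OF True] by (simp add: pos_divide_le_eq)
    next
      case False then show ?thesis using nup v(2) by simp
    qed
    have nk: "n k = t * v $ k" using k v(1)[OF k(1)] by (auto simp: field_simps)
    have t0: "t \<ge> 0" using n0[of k] nk v(1)[OF k(1)] by (simp add: zero_le_mult_iff)
    have "0 \<le> (\<Sum>j\<in>UNIV. K $ k $ j * n j)" by (rule key)
    also have "\<dots> \<le> (\<Sum>j\<in>UNIV. K $ k $ j * (t * v $ j))"
    proof (rule sum_mono)
      fix j show "K $ k $ j * n j \<le> K $ k $ j * (t * v $ j)"
        using nk Koff[of k j] tmax[of j] by (cases "j = k") (auto intro: mult_left_mono)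
    qed
    also have "\<dots> = t * (K *v v) $ k" by (simp add: mv_entry sum_distrib_left mult_ac)
    finally have "t * (K *v v) $ k \<ge> 0" .
    then have "t = 0" using t0 v(3)[OF k(1)] by (auto simp: zero_le_mult_iff)
    then show ?thesis using tmax[of i] n0[of i] by simp
  qed
  have "X $ i $ j = 0" for i j
  proof -
    have "n i = 0" using nz nup by blast
    then show ?thesis unfolding n_def by (subst (asm) sum_nonneg_eq_0_iff) auto
  qed
  then show ?thesis by (simp add: vec_eq_iff)
qed

end

section \<open>Analytic solutions of perturbed Riccati equations\<close>

definition hol_mat :: "(complex \<Rightarrow> complex^'n^'m) \<Rightarrow> complex set \<Rightarrow> bool" where
  "hol_mat F S \<longleftrightarrow> (\<forall>i j. (\<lambda>z. F z $ i $ j) holomorphic_on S)"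

lemma hol_mat_const: "hol_mat (\<lambda>_. X) S"
  by (simp add: hol_mat_def)

lemma hol_mat_add: "hol_mat F S \<Longrightarrow> hol_mat G S \<Longrightarrow> hol_mat (\<lambda>z. F z + G z) S"
  by (simp add: hol_mat_def holomorphic_intros)

lemma hol_mat_diff: "hol_mat F S \<Longrightarrow> hol_mat G S \<Longrightarrow> hol_mat (\<lambda>z. F z - G z) S"
  by (simp add: hol_mat_def holomorphic_intros)

lemma hol_mat_mult:
  fixes F :: "complex \<Rightarrow> complex^'n^'m" and G :: "complex \<Rightarrow> complex^'p^'n"
  shows "hol_mat F S \<Longrightarrow> hol_mat G S \<Longrightarrow> hol_mat (\<lambda>z. F z ** G z) S"
  by (simp add: hol_mat_def matrix_matrix_mult_def holomorphic_intros)

text \<open>The fixed points of a contraction depending holomorphically on a parameter are locally uniform limits of the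
  iterates starting from the constant 0, and these are holomorphic.\<close>
lemma analytic_fixed_point:
  fixes \<Phi> :: "complex \<Rightarrow> complex^'n^'m \<Rightarrow> complex^'n^'m"
  assumes r: "r > 0" "\<rho> > 0"
    and self: "\<And>z X. z \<in> ball 0 r \<Longrightarrow> X \<in> cball 0 \<rho> \<Longrightarrow> \<Phi> z X \<in> cball 0 \<rho>"
    and contr: "\<And>z X Y. z \<in> ball 0 r \<Longrightarrow> X \<in> cball 0 \<rho> \<Longrightarrow> Y \<in> cball 0 \<rho> \<Longrightarrow>
      dist (\<Phi> z X) (\<Phi> z Y) \<le> (1/2) * dist X Y"
    and hol: "\<And>F. hol_mat F (ball 0 r) \<Longrightarrow> hol_mat (\<lambda>z. \<Phi> z (F z)) (ball 0 r)"
  obtains F where "hol_mat F (ball 0 r)"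
    "\<And>z X. z \<in> ball 0 r \<Longrightarrow> X \<in> cball 0 \<rho> \<Longrightarrow> \<Phi> z X = X \<Longrightarrow> F z = X"
proof -
  have ex: "\<exists>!X\<in>cball 0 \<rho>. \<Phi> z X = X" if z: "z \<in> ball 0 r" for z
  proof -
    show ?thesis
      by (rule Banach_fix[where c = "1/2"]) (use self[OF z] contr[OF z] r in \<open>auto simp: complete_eq_closed\<close>)
  qed
  then obtain F where F: "\<And>z. z \<in> ball 0 r \<Longrightarrow> F z \<in> cball 0 \<rho> \<and> \<Phi> z (F z) = F z" by metis
  define X where "X n z = ((\<Phi> z) ^^ n) 0" for n z
  have XSuc: "X (Suc n) z = \<Phi> z (X n z)" for n z by (simp add: X_def)
  have Xin: "X n z \<in> cball 0 \<rho>" if z: "z \<in> ball 0 r" for n z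
    by (induction n) (use r self[OF z] in \<open>auto simp: X_def\<close>)
  have Xhol: "hol_mat (X n) (ball 0 r)" for n
  proof (induction n)
    case 0 show ?case by (simp add: X_def hol_mat_const)
  next
    case (Suc n) then show ?case unfolding XSuc by (rule hol)
  qed
  have Xdist: "dist (X n z) (F z) \<le> (1/2) ^ n * \<rho>" if z: "z \<in> ball 0 r" for n z
  proof (induction n)
    case 0 show ?case using F[OF z] by (simp add: X_def)
  next
    case (Suc n)
    have "dist (X (Suc n) z) (F z) = dist (\<Phi> z (X n z)) (\<Phi> z (F z))" using F[OF z] by (simp add: XSuc)
    also have "\<dots> \<le> (1/2) * dist (X n z) (F z)" using F[OF z] Xin[OF z] by (intro contr[OF z]) auto
    also have "\<dots> \<le> (1/2) * ((1/2) ^ n * \<rho>)" using Suc by (intro mult_left_mono) auto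
    finally show ?case by simp
  qed
  have "hol_mat F (ball 0 r)" unfolding hol_mat_def
  proof (intro allI)
    fix i j
    show "(\<lambda>z. F z $ i $ j) holomorphic_on ball 0 r"
    proof (rule holomorphic_uniform_sequence[where f = "\<lambda>n z. X n z $ i $ j"])
      show "(\<lambda>z. X n z $ i $ j) holomorphic_on ball 0 r" for n using Xhol[of n] by (simp add: hol_mat_def)
      fix w :: complex assume w: "w \<in> ball 0 r"
      then obtain d where d: "d > 0" "cball w d \<subseteq> ball 0 r" by (metis open_ball open_contains_cball)
      have "uniform_limit (cball w d) (\<lambda>n z. X n z $ i $ j) (\<lambda>z. F z $ i $ j) sequentially"
      proof (rule uniform_limitI)
        fix e :: real assume e: "e > 0"
        have "(\<lambda>n. (1/2) ^ n * \<rho>) \<longlonglongrightarrow> 0 * \<rho>" by (intro tendsto_mult LIMSEQ_power_zero tendsto_const) simp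
        then have "\<forall>\<^sub>F n in sequentially. (1/2) ^ n * \<rho> < e" using e by (auto dest: order_tendstoD(2))
        then show "\<forall>\<^sub>F n in sequentially. \<forall>z\<in>cball w d. dist (X n z $ i $ j) (F z $ i $ j) < e"
        proof eventually_elim
          case (elim n)
          show ?case
          proof
            fix z assume "z \<in> cball w d"
            then have z: "z \<in> ball 0 r" using d by auto
            have "dist (X n z $ i $ j) (F z $ i $ j) \<le> dist (X n z) (F z)"
              by (rule order_trans[OF dist_vec_nth_le dist_vec_nth_le])
            then show "dist (X n z $ i $ j) (F z $ i $ j) < e" using Xdist[OF z, of n] elim by simp
          qed
        qed
      qed
      then show "\<exists>d>0. cball w d \<subseteq> ball 0 r \<and> uniform_limit (cball w d) (\<lambda>n z. X n z $ i $ j) (\<lambda>z. F z $ i $ j) sequentially"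
        using d by blast
    qed simp
  qed
  then show ?thesis
  proof (rule that)
    fix z X assume "z \<in> ball 0 r" "X \<in> cball 0 \<rho>" "\<Phi> z X = X"
    then show "F z = X" using ex F by blast
  qed
qed

definition cmat :: "real^'n^'m \<Rightarrow> complex^'n^'m" where "cmat X = (\<chi> i j. of_real (X $ i $ j))"

lemma cmat_entry [simp]: "cmat X $ i $ j = of_real (X $ i $ j)" by (simp add: cmat_def)
lemma cmat_add: "cmat (X + Z) = cmat X + cmat Z" by (simp add: vec_eq_iff)
lemma cmat_diff: "cmat (X - Z) = cmat X - cmat Z" by (simp add: vec_eq_iff)
lemma cmat_mult: "cmat (X ** Z) = cmat X ** cmat Z" for X :: "real^'n^'m" and Z :: "real^'p^'n"
  by (simp add: vec_eq_iff matrix_matrix_mult_def)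

lemma norm_cmat: "norm (cmat X) = norm X"
  by (simp add: norm_vec_def)

lemma bounded_bilinear_cmatrix_mult:
  "bounded_bilinear ((**) :: complex^'n^'n \<Rightarrow> complex^'n^'n \<Rightarrow> complex^'n^'n)"
  unfolding bilinear_conv_bounded_bilinear[symmetric] bilinear_def linear_iff
  by (auto simp: vec_eq_iff matrix_matrix_mult_def algebra_simps sum.distrib scaleR_sum_right)

interpretation cmatmul: bounded_bilinear "(**) :: complex^'n^'n \<Rightarrow> complex^'n^'n \<Rightarrow> complex^'n^'n"
  by (rule bounded_bilinear_cmatrix_mult)

definition unit_mat :: "'m \<Rightarrow> 'n \<Rightarrow> real^'n^'m" where
  "unit_mat k l = (\<chi> i j. if i = k \<and> j = l then 1 else 0)"

text \<open>The complex-linear extension of a real-linear map, through its values on matrix units.\<close>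
definition complexify :: "(real^'n^'m \<Rightarrow> real^'n^'m) \<Rightarrow> complex^'n^'m \<Rightarrow> complex^'n^'m" where
  "complexify S X = (\<chi> i j. \<Sum>k\<in>UNIV. \<Sum>l\<in>UNIV. of_real (S (unit_mat k l) $ i $ j) * X $ k $ l)"

lemma linear_complexify: "linear (complexify S)"
  by (auto simp: linear_iff vec_eq_iff complexify_def algebra_simps sum.distrib scaleR_sum_right)

lemma complexify_cmat:
  fixes S :: "real^'n^'m \<Rightarrow> real^'n^'m"
  assumes "linear S" shows "complexify S (cmat X) = cmat (S X)"
proof -
  have "X = (\<Sum>k\<in>UNIV. \<Sum>l\<in>UNIV. X $ k $ l *\<^sub>R unit_mat k l)"
  proof -
    have "(\<Sum>k\<in>UNIV. \<Sum>l\<in>UNIV. X $ k $ l *\<^sub>R unit_mat k l) $ i $ j = X $ i $ j" for i j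
    proof -
      have "(\<Sum>k\<in>UNIV. \<Sum>l\<in>UNIV. X $ k $ l *\<^sub>R unit_mat k l) $ i $ j = (\<Sum>k\<in>UNIV. \<Sum>l\<in>UNIV. if l = j then (if k = i then X $ k $ l else 0) else 0)"
        unfolding sum_component vector_scaleR_component by (intro sum.cong) (auto simp: unit_mat_def)
      then show ?thesis by simp
    qed
    then show ?thesis by (simp add: vec_eq_iff)
  qed
  then have "S X = S (\<Sum>k\<in>UNIV. \<Sum>l\<in>UNIV. X $ k $ l *\<^sub>R unit_mat k l)" by simp
  also have "\<dots> = (\<Sum>k\<in>UNIV. \<Sum>l\<in>UNIV. X $ k $ l *\<^sub>R S (unit_mat k l))"
    by (simp only: linear_sum[OF assms] linear_scale[OF assms])
  finally have SX: "S X = (\<Sum>k\<in>UNIV. \<Sum>l\<in>UNIV. X $ k $ l *\<^sub>R S (unit_mat k l))" .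
  show ?thesis unfolding SX by (simp add: vec_eq_iff complexify_def mult.commute)
qed

lemma hol_mat_complexify: "hol_mat F S' \<Longrightarrow> hol_mat (\<lambda>z. complexify S (F z)) S'"
  unfolding hol_mat_def complexify_def by (auto intro!: holomorphic_intros)

text \<open>The diagonal matrix by which the coefficient matrix \<open>- C\<^sup>-\<^sup>1 Q\<close> changes when \<open>c\<close> is replaced by \<open>c + z c'\<close>.
  It is polymorphic because the parameter is real in the model and complex for analyticity.\<close>
definition tilt :: "'a::real_normed_field^'n \<Rightarrow> 'a^'n \<Rightarrow> 'a \<Rightarrow> 'a^'n^'n" where
  "tilt c c' z = (\<chi> i j. if i = j then (if c $ i = 0 then 1 else c $ i / (c $ i + z * c' $ i)) else 0)"

text \<open>The subtracted term is the linear part in \<open>X\<close>, at \<open>X = 0\<close> and \<open>D = mat 1\<close>, of the first one. Where the first term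
  vanishes, the value is \<open>X ** H ** G - J ** H ** X\<close>, the image of \<open>X\<close> under a Sylvester operator.\<close>
definition perturbed_form :: "'a::real_normed_field^'n^'n \<Rightarrow> 'a^'n^'n \<Rightarrow> 'a^'n^'n \<Rightarrow> 'a^'n^'n \<Rightarrow> 'a^'n^'n \<Rightarrow> 'a^'n^'n" where
  "perturbed_form J H G D X = (J - X) ** (D ** (H ** (G + X))) - (J ** (H ** X) - X ** (H ** G))"

text \<open>Every term is linear in \<open>X - Z\<close> with a coefficient that is small when \<open>D\<close> is close to the identity and
  \<open>X\<close>, \<open>Z\<close> are close to 0.\<close>
lemma perturbed_form_diff:
  fixes J :: "complex^'n^'n"
  shows "perturbed_form J H G D X - perturbed_form J H G D Z =
    (J - X) ** ((D - mat 1) ** (H ** (X - Z))) - X ** (H ** (X - Z)) -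
    (X - Z) ** ((D - mat 1) ** (H ** (G + Z))) - (X - Z) ** (H ** Z)"
  unfolding perturbed_form_def
  by (simp add: cmatmul.add_left cmatmul.add_right cmatmul.diff_left cmatmul.diff_right algebra_simps)

text \<open>On a small ball, uniformly for small complex parameters, \<open>X \<mapsto> S (perturbed_form J H G (tilt c c' z) X)\<close> is a
  contraction of that ball. Its holomorphic fixed point agrees with \<open>Z\<close> at small real parameters, because
  \<open>Z\<close> tends to 0 and hence lies in the ball, where fixed points are unique.\<close>
lemma analytic_branch:
  fixes J H G :: "real^'n^'n" and c c' :: "real^'n" and S :: "real^'n^'n \<Rightarrow> real^'n^'n" and Z :: "real \<Rightarrow> real^'n^'n"
  assumes S: "linear S" and JHG: "J ** (H ** G) = 0"
    and Z: "(Z \<longlongrightarrow> 0) (at 0)" "Z 0 = 0"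
    and fix_pt: "\<forall>\<^sub>F e in at 0. Z e = S (perturbed_form J H G (tilt c c' e) (Z e))"
  shows "real_analytic_at Z 0"
proof -
  define Jc Hc Gc where "Jc = cmat J" and "Hc = cmat H" and "Gc = cmat G"
  define D where "D z = tilt (\<chi> i. of_real (c $ i)) (\<chi> i. of_real (c' $ i)) z" for z :: complex
  define \<Phi> where "\<Phi> z X = complexify S (perturbed_form Jc Hc Gc (D z) X)" for z X
  obtain \<kappa> where "\<kappa> > 0 \<and> (\<forall>(X::complex^'n^'n) (Z::complex^'n^'n). norm (X ** Z) \<le> norm X * norm Z * \<kappa>)"
    using cmatmul.pos_bounded[where ?'n = 'n] by (elim exE) (rule that)
  then have \<kappa>: "\<kappa> > 0" "\<And>(X::complex^'n^'n) (Z::complex^'n^'n). norm (X ** Z) \<le> norm X * norm Z * \<kappa>" by simp_all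
  obtain \<sigma> where "\<sigma> > 0 \<and> (\<forall>X. norm (complexify S X) \<le> norm X * \<sigma>)"
    using bounded_linear.pos_bounded[OF linear_conv_bounded_linear[THEN iffD1, OF linear_complexify[of S]]]
    by (elim exE) (rule that)
  then have \<sigma>: "\<sigma> > 0" "\<And>X. norm (complexify S X) \<le> norm X * \<sigma>" by simp_all
  have m3: "norm (X ** (Y ** (V ** W))) \<le> norm X * (norm Y * (norm V * norm W)) * \<kappa> ^ 3" for X Y V W :: "complex^'n^'n"
  proof -
    have "norm (X ** (Y ** (V ** W))) \<le> norm X * norm (Y ** (V ** W)) * \<kappa>" by (rule \<kappa>)
    also have "\<dots> \<le> norm X * (norm Y * norm (V ** W) * \<kappa>) * \<kappa>" using \<kappa> by (intro mult_right_mono mult_left_mono) auto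
    also have "\<dots> \<le> norm X * (norm Y * (norm V * norm W * \<kappa>) * \<kappa>) * \<kappa>" using \<kappa> by (intro mult_right_mono mult_left_mono) auto
    finally show ?thesis by (simp add: power3_eq_cube mult_ac)
  qed
  have m2: "norm (X ** (Y ** V)) \<le> norm X * (norm Y * norm V) * \<kappa> ^ 2" for X Y V :: "complex^'n^'n"
  proof -
    have "norm (X ** (Y ** V)) \<le> norm X * norm (Y ** V) * \<kappa>" by (rule \<kappa>)
    also have "\<dots> \<le> norm X * (norm Y * norm V * \<kappa>) * \<kappa>" using \<kappa> by (intro mult_right_mono mult_left_mono) auto
    finally show ?thesis by (simp add: power2_eq_square mult_ac)
  qed
  \<comment> \<open>The constants make \<open>C * (\<eta> + \<rho>)\<close> a Lipschitz bound for \<open>perturbed_form\<close> on the ball of radius \<open>\<rho>\<close> when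
     \<open>norm (D z - mat 1) \<le> \<eta>\<close>, and \<open>C * \<sigma> * (\<eta> + \<rho>) \<le> 1/2\<close> for its composition with \<open>complexify S\<close>.\<close>
  define a where "a = norm Jc + norm Gc + 1"
  define C where "C = 2 * a * norm Hc * \<kappa> ^ 3 + 2 * norm Hc * \<kappa>\<^sup>2 + norm Jc * norm Hc * norm Gc * \<kappa> ^ 3 + 1"
  have a1: "a \<ge> 1" by (simp add: a_def)
  have C0: "C > 0"
  proof -
    have "2 * a * norm Hc * \<kappa> ^ 3 + 2 * norm Hc * \<kappa>\<^sup>2 + norm Jc * norm Hc * norm Gc * \<kappa> ^ 3 \<ge> 0" using \<kappa> a1 by auto
    then show ?thesis by (simp add: C_def)
  qed
  define \<rho> where "\<rho> = min 1 (1 / (4 * C * \<sigma>))"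
  have \<rho>: "\<rho> > 0" "\<rho> \<le> 1" "C * \<sigma> * \<rho> \<le> 1/4" using C0 \<sigma> by (auto simp: \<rho>_def min_def field_simps)
  define \<eta> where "\<eta> = \<rho> / (4 * C * \<sigma>) "
  have \<eta>: "\<eta> > 0" "C * \<sigma> * \<eta> = \<rho> / 4" using C0 \<sigma> \<rho> by (auto simp: \<eta>_def)
  have D0: "D 0 = mat 1" by (simp add: D_def tilt_def vec_eq_iff mat_def)
  obtain r0 where r0: "r0 > 0" "\<And>(z::complex) i. z \<in> ball 0 r0 \<Longrightarrow> c $ i \<noteq> 0 \<Longrightarrow> of_real (c $ i) + z * of_real (c' $ i) \<noteq> 0"
  proof -
    have "\<exists>r>0. \<forall>z\<in>ball 0 r. c $ i \<noteq> 0 \<longrightarrow> complex_of_real (c $ i) + z * of_real (c' $ i) \<noteq> 0" for i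
    proof (cases "c $ i = 0")
      case True then show ?thesis by (intro exI[of _ 1]) auto
    next
      case False
      have "((\<lambda>z. complex_of_real (c $ i) + z * of_real (c' $ i)) \<longlongrightarrow> of_real (c $ i) + 0 * of_real (c' $ i)) (nhds 0)"
        by (intro tendsto_intros filterlim_ident)
      then have "\<forall>\<^sub>F z in nhds 0. complex_of_real (c $ i) + z * of_real (c' $ i) \<noteq> 0"
        using False by (intro tendsto_imp_eventually_ne) auto
      then show ?thesis by (auto simp: eventually_nhds_metric dist_commute)
    qed
    then obtain rr where rr: "\<And>i. rr i > 0" "\<And>i z. z \<in> ball 0 (rr i) \<Longrightarrow> c $ i \<noteq> 0 \<Longrightarrow> complex_of_real (c $ i) + z * of_real (c' $ i) \<noteq> 0" by metis
    show ?thesis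
    proof (rule that[of "Min (range rr)"])
      show "Min (range rr) > 0" using rr(1) by (subst Min_gr_iff) auto
      fix z i assume z: "z \<in> ball (0::complex) (Min (range rr))"
      have "Min (range rr) \<le> rr i" by (intro Min_le) auto
      then have "z \<in> ball 0 (rr i)" using z by auto
      then show "c $ i \<noteq> 0 \<Longrightarrow> of_real (c $ i) + z * of_real (c' $ i) \<noteq> 0" using rr(2) by blast
    qed
  qed
  have Dhol: "hol_mat D (ball 0 r0)"
    unfolding hol_mat_def
  proof (intro allI)
    fix i j
    show "(\<lambda>z. D z $ i $ j) holomorphic_on ball 0 r0"
    proof (cases "i = j \<and> c $ i \<noteq> 0")
      case True
      then have "(\<lambda>z. D z $ i $ j) = (\<lambda>z. of_real (c $ i) / (of_real (c $ i) + z * of_real (c' $ i)))" by (auto simp: D_def tilt_def)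
      then show ?thesis using r0(2) True by (auto intro!: holomorphic_intros)
    next
      case False
      then have "(\<lambda>z. D z $ i $ j) = (\<lambda>z. if i = j then 1 else 0)" by (auto simp: D_def tilt_def)
      then show ?thesis by simp
    qed
  qed
  obtain r where r: "r > 0" "r \<le> r0" "\<And>z. z \<in> ball 0 r \<Longrightarrow> norm (D z - mat 1) \<le> \<eta>"
  proof -
    have "(D \<longlongrightarrow> D 0) (at 0)"
    proof (intro vec_tendstoI)
      fix i j
      have "continuous_on (ball 0 r0) (\<lambda>z. D z $ i $ j)" using Dhol by (auto simp: hol_mat_def intro: holomorphic_on_imp_continuous_on)
      then have "isCont (\<lambda>z. D z $ i $ j) 0" using r0(1) by (simp add: continuous_on_eq_continuous_at)
      then show "((\<lambda>z. D z $ i $ j) \<longlongrightarrow> D 0 $ i $ j) (at 0)" by (simp add: isCont_def)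
    qed
    from tendstoD[OF this \<eta>(1)] obtain d where d: "d > 0" "\<And>z. z \<noteq> 0 \<Longrightarrow> dist z 0 < d \<Longrightarrow> dist (D z) (D 0) < \<eta>"
      by (auto simp: eventually_at)
    show ?thesis
    proof (rule that[of "min d r0"])
      fix z :: complex assume "z \<in> ball 0 (min d r0)"
      then show "norm (D z - mat 1) \<le> \<eta>" using d(2)[of z] \<eta>(1) by (cases "z = 0") (auto simp: D0 dist_norm)
    qed (use d r0 in auto)
  qed
  have diff_bound: "norm (perturbed_form Jc Hc Gc (D z) X - perturbed_form Jc Hc Gc (D z) W) \<le> C * (\<eta> + \<rho>) * norm (X - W)"
    if z: "z \<in> ball 0 r" and X: "norm X \<le> \<rho>" and W: "norm W \<le> \<rho>" for z X W
  proof -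
    let ?\<delta> = "norm (D z - mat 1)" and ?\<Delta> = "norm (X - W)"
    have \<delta>: "?\<delta> \<le> \<eta>" using r(3)[OF z] .
    have JX: "norm (Jc - X) \<le> a" using norm_triangle_ineq4[of Jc X] X \<rho>(2) norm_ge_zero[of Gc] unfolding a_def by linarith
    have GW: "norm (Gc + W) \<le> a" using norm_triangle_ineq[of Gc W] W \<rho>(2) norm_ge_zero[of Jc] unfolding a_def by linarith
    have t1: "norm ((Jc - X) ** ((D z - mat 1) ** (Hc ** (X - W)))) \<le> a * (\<eta> * (norm Hc * ?\<Delta>)) * \<kappa> ^ 3"
      using JX \<delta> \<kappa>(1) a1 \<eta>(1) by (intro order_trans[OF m3] mult_right_mono mult_mono) auto
    have t2: "norm (X ** (Hc ** (X - W))) \<le> \<rho> * (norm Hc * ?\<Delta>) * \<kappa>\<^sup>2"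
      using X \<kappa>(1) by (intro order_trans[OF m2] mult_right_mono) auto
    have t3: "norm ((X - W) ** ((D z - mat 1) ** (Hc ** (Gc + W)))) \<le> ?\<Delta> * (\<eta> * (norm Hc * a)) * \<kappa> ^ 3"
      using GW \<delta> \<kappa>(1) a1 \<eta>(1) by (intro order_trans[OF m3] mult_right_mono mult_left_mono mult_mono) auto
    have t4: "norm ((X - W) ** (Hc ** W)) \<le> ?\<Delta> * (norm Hc * \<rho>) * \<kappa>\<^sup>2"
      using W \<kappa>(1) by (intro order_trans[OF m2] mult_right_mono mult_left_mono) auto
    have "norm (perturbed_form Jc Hc Gc (D z) X - perturbed_form Jc Hc Gc (D z) W) \<le>
      norm ((Jc - X) ** ((D z - mat 1) ** (Hc ** (X - W)))) + norm (X ** (Hc ** (X - W))) +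
      norm ((X - W) ** ((D z - mat 1) ** (Hc ** (Gc + W)))) + norm ((X - W) ** (Hc ** W))"
      unfolding perturbed_form_diff by (intro order_trans[OF norm_triangle_ineq4] add_mono order_refl)
    also have "\<dots> \<le> (2 * a * norm Hc * \<kappa> ^ 3) * \<eta> * ?\<Delta> + (2 * norm Hc * \<kappa>\<^sup>2) * \<rho> * ?\<Delta>"
      using t1 t2 t3 t4 by (simp add: mult_ac)
    also have "\<dots> \<le> C * \<eta> * ?\<Delta> + C * \<rho> * ?\<Delta>"
    proof -
      have "2 * norm Hc * \<kappa>\<^sup>2 \<ge> 0" "2 * a * norm Hc * \<kappa> ^ 3 \<ge> 0" "norm Jc * norm Hc * norm Gc * \<kappa> ^ 3 \<ge> 0" using \<kappa>(1) a1 by auto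
      then have "2 * a * norm Hc * \<kappa> ^ 3 \<le> C" "2 * norm Hc * \<kappa>\<^sup>2 \<le> C" unfolding C_def by linarith+
      then show ?thesis using \<eta>(1) \<rho>(1) by (intro add_mono mult_right_mono) auto
    qed
    finally show ?thesis by (simp add: algebra_simps)
  qed
  have half: "C * \<sigma> * (\<eta> + \<rho>) \<le> 1/2"
  proof -
    have "C * \<sigma> * \<eta> \<le> 1/4" using \<eta>(2) \<rho>(2) by simp
    then show ?thesis using \<rho>(3) by (simp add: distrib_left)
  qed
  have contr: "dist (\<Phi> z X) (\<Phi> z W) \<le> (1/2) * dist X W"
    if z: "z \<in> ball 0 r" and X: "X \<in> cball 0 \<rho>" and W: "W \<in> cball 0 \<rho>" for z X W
  proof -
    have "dist (\<Phi> z X) (\<Phi> z W) = norm (complexify S (perturbed_form Jc Hc Gc (D z) X - perturbed_form Jc Hc Gc (D z) W))"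
      unfolding \<Phi>_def dist_norm by (simp add: linear_diff[OF linear_complexify])
    also have "\<dots> \<le> norm (perturbed_form Jc Hc Gc (D z) X - perturbed_form Jc Hc Gc (D z) W) * \<sigma>" by (rule \<sigma>)
    also have "\<dots> \<le> (C * (\<eta> + \<rho>) * norm (X - W)) * \<sigma>"
      using diff_bound[OF z, of X W] X W \<sigma>(1) by (intro mult_right_mono) auto
    also have "\<dots> = (C * \<sigma> * (\<eta> + \<rho>)) * norm (X - W)" by simp
    also have "\<dots> \<le> (1/2) * norm (X - W)" by (intro mult_right_mono half) simp
    finally show ?thesis by (simp add: dist_norm)
  qed
  have base: "norm (\<Phi> z 0) \<le> \<rho> / 4" if z: "z \<in> ball 0 r" for z
  proof -
    have JHGc: "Jc ** (Hc ** Gc) = 0" using arg_cong[OF JHG, of cmat] by (simp add: Jc_def Hc_def Gc_def cmat_mult) (simp add: vec_eq_iff cmat_def)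
    have "perturbed_form Jc Hc Gc (D z) 0 = Jc ** ((D z - mat 1) ** (Hc ** Gc))"
      unfolding perturbed_form_def by (simp add: cmatmul.diff_left cmatmul.diff_right JHGc)
    then have "norm (perturbed_form Jc Hc Gc (D z) 0) \<le> norm Jc * (norm (D z - mat 1) * (norm Hc * norm Gc)) * \<kappa> ^ 3"
      using m3 by simp
    also have "\<dots> \<le> norm Jc * (\<eta> * (norm Hc * norm Gc)) * \<kappa> ^ 3"
      using r(3)[OF z] \<kappa>(1) by (intro mult_right_mono mult_left_mono) auto
    also have "\<dots> = (norm Jc * norm Hc * norm Gc * \<kappa> ^ 3) * \<eta>" by simp
    also have "\<dots> \<le> C * \<eta>"
    proof -
      have "2 * norm Hc * \<kappa>\<^sup>2 \<ge> 0" "2 * a * norm Hc * \<kappa> ^ 3 \<ge> 0" using \<kappa>(1) a1 by auto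
      then show ?thesis using \<eta>(1) unfolding C_def by (intro mult_right_mono) auto
    qed
    finally have "norm (perturbed_form Jc Hc Gc (D z) 0) * \<sigma> \<le> C * \<eta> * \<sigma>" using \<sigma>(1) by (intro mult_right_mono) auto
    then have "norm (\<Phi> z 0) \<le> C * \<eta> * \<sigma>" unfolding \<Phi>_def using \<sigma>(2) order_trans by blast
    then show ?thesis using \<eta>(2) by (simp add: mult_ac)
  qed
  have self: "\<Phi> z X \<in> cball 0 \<rho>" if z: "z \<in> ball 0 r" and X: "X \<in> cball 0 \<rho>" for z X
  proof -
    have "norm (\<Phi> z X) \<le> dist (\<Phi> z X) (\<Phi> z 0) + norm (\<Phi> z 0)"
      unfolding dist_norm by (rule order_trans[OF _ norm_triangle_ineq]) simp
    also have "\<dots> \<le> (1/2) * \<rho> + \<rho> / 4"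
      using contr[OF z X, of 0] base[OF z] X \<rho>(1) by (auto simp: dist_norm)
    also have "\<dots> \<le> \<rho>" using \<rho>(1) by simp
    finally show ?thesis by simp
  qed
  have hol: "hol_mat (\<lambda>z. \<Phi> z (F z)) (ball 0 r)" if F: "hol_mat F (ball 0 r)" for F
  proof -
    have "ball (0::complex) r \<subseteq> ball 0 r0" using r(2) by auto
    then have D: "hol_mat D (ball 0 r)" using Dhol unfolding hol_mat_def by (blast intro: holomorphic_on_subset)
    show ?thesis unfolding \<Phi>_def perturbed_form_def
      by (intro hol_mat_complexify hol_mat_diff hol_mat_mult hol_mat_add hol_mat_const D F)
  qed
  obtain F where F: "hol_mat F (ball 0 r)"
    "\<And>z X. z \<in> ball 0 r \<Longrightarrow> X \<in> cball 0 \<rho> \<Longrightarrow> \<Phi> z X = X \<Longrightarrow> F z = X"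
    by (rule analytic_fixed_point[of r \<rho> \<Phi>]) (use r(1) \<rho>(1) self contr hol in auto)
  have real_fix: "\<Phi> (of_real e) (cmat X) = cmat (S (perturbed_form J H G (tilt c c' e) X))" for e X
  proof -
    have "D (of_real e) = cmat (tilt c c' e)" by (auto simp: D_def tilt_def vec_eq_iff)
    then show ?thesis unfolding \<Phi>_def complexify_cmat[OF S, symmetric]
      by (simp add: perturbed_form_def cmat_diff cmat_add cmat_mult Jc_def Hc_def Gc_def)
  qed
  have "\<forall>\<^sub>F e in at 0. norm (Z e) < \<rho>" using tendstoD[OF Z(1) \<rho>(1)] by simp
  with fix_pt have "\<forall>\<^sub>F e in at 0. norm (Z e) < \<rho> \<and> Z e = S (perturbed_form J H G (tilt c c' e) (Z e))"
    by eventually_elim simp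
  then obtain d where d: "d > 0" "\<And>e. e \<noteq> 0 \<Longrightarrow> \<bar>e\<bar> < d \<Longrightarrow> norm (Z e) < \<rho> \<and> Z e = S (perturbed_form J H G (tilt c c' e) (Z e))"
    by (auto simp: eventually_at dist_real_def)
  have FZ: "F (of_real e) = cmat (Z e)" if e: "\<bar>e\<bar> < min d r" for e
  proof (rule F(2))
    show "of_real e \<in> ball (0::complex) r" using e by simp
    show "cmat (Z e) \<in> cball 0 \<rho>" using d(2)[of e] e \<rho>(1) Z(2) by (cases "e = 0") (auto simp: norm_cmat)
    have "Z e = S (perturbed_form J H G (tilt c c' e) (Z e))"
    proof (cases "e = 0")
      case True
      have "tilt c c' 0 = mat 1" by (simp add: tilt_def vec_eq_iff mat_def)
      then show ?thesis using True Z(2) JHG by (simp add: perturbed_form_def linear_0[OF S])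
    qed (use d(2)[of e] e in simp)
    then show "\<Phi> (of_real e) (cmat (Z e)) = cmat (Z e)" unfolding real_fix by simp
  qed
  \<comment> \<open>The coefficients are the real parts of the complex Taylor coefficients, as \<open>F\<close> is real on the real axis.\<close>
  define co where "co n = (\<chi> i j. Re ((deriv ^^ n) (\<lambda>z. F z $ i $ j) 0 / fact n))" for n
  show ?thesis unfolding real_analytic_at_def
  proof (intro exI conjI allI impI)
    show "min d r > 0" using d(1) r(1) by simp
    fix h :: real assume h: "\<bar>h\<bar> < min d r"
    have "(\<lambda>n. (h ^ n *\<^sub>R co n) $ i $ j) sums Z h $ i $ j" for i j
    proof -
      have "(\<lambda>n. (deriv ^^ n) (\<lambda>z. F z $ i $ j) 0 / fact n * (of_real h - 0) ^ n) sums (F (of_real h) $ i $ j)"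
        by (rule holomorphic_power_series[where r = r]) (use F(1) h in \<open>auto simp: hol_mat_def\<close>)
      then have "(\<lambda>n. Re ((deriv ^^ n) (\<lambda>z. F z $ i $ j) 0 / fact n * (of_real h - 0) ^ n)) sums Re (F (of_real h) $ i $ j)"
        by (rule sums_Re)
      moreover have eq: "Re (w * (of_real h - 0) ^ n) = h ^ n * Re w" for w n
      proof -
        have "w * (of_real h - 0) ^ n = of_real (h ^ n) * w" by simp
        then show ?thesis by (simp del: of_real_power)
      qed
      ultimately have "(\<lambda>n. h ^ n * Re ((deriv ^^ n) (\<lambda>z. F z $ i $ j) 0 / fact n)) sums Re (F (of_real h) $ i $ j)"
        by (simp only: eq)
      then show ?thesis unfolding FZ[OF h] by (simp add: co_def)
    qed
    then have "(\<lambda>n. \<Sum>k<n. h ^ k *\<^sub>R co k) \<longlonglongrightarrow> Z h"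
      by (intro vec_tendstoI) (simp add: sums_def)
    then show "(\<lambda>n. h ^ n *\<^sub>R co n) sums Z (0 + h)" by (simp add: sums_def)
  qed
qed

section \<open>Perturbation of the rates\<close>

lemma analytic_second_order:
  fixes f :: "real \<Rightarrow> 'a::banach"
  assumes "real_analytic_at f 0"
  obtains a r C where "r > 0" "C \<ge> 0" "\<And>h. \<bar>h\<bar> < r \<Longrightarrow> norm (f h - (f 0 + h *\<^sub>R a)) \<le> C * h\<^sup>2"
proof -
  obtain r0 a where r0: "r0 > 0" and a: "\<And>h. \<bar>h\<bar> < r0 \<Longrightarrow> (\<lambda>n. h ^ n *\<^sub>R a n) sums f (0 + h)"
    using assms unfolding real_analytic_at_def by blast
  define \<rho> where "\<rho> = r0 / 2"
  have \<rho>: "\<rho> > 0" using r0 by (simp add: \<rho>_def)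
  have "(\<lambda>n. \<rho> ^ n *\<^sub>R a n) \<longlonglongrightarrow> 0"
    using a[of \<rho>] r0 by (intro summable_LIMSEQ_zero sums_summable) (auto simp: \<rho>_def)
  then have "Bseq (\<lambda>n. \<rho> ^ n *\<^sub>R a n)" by (intro convergent_imp_Bseq convergentI)
  then obtain m where m: "m > 0" "\<And>n. norm (\<rho> ^ n *\<^sub>R a n) \<le> m" unfolding Bseq_def by blast
  have a0: "a 0 = f 0"
  proof -
    have "(\<lambda>n. (0::real) ^ n *\<^sub>R a n) = (\<lambda>n. if n = 0 then a n else 0)" by auto
    then have "(\<lambda>n. (0::real) ^ n *\<^sub>R a n) sums a 0" using sums_single[of 0 a] by simp
    then show ?thesis using a[of 0] r0 sums_unique2 by fastforce
  qed
  show ?thesis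
  proof (rule that[of "\<rho> / 2" "2 * m / \<rho>\<^sup>2" "a 1"])
    show "\<rho> / 2 > 0" "2 * m / \<rho>\<^sup>2 \<ge> 0" using \<rho> m by auto
    fix h :: real assume h: "\<bar>h\<bar> < \<rho> / 2"
    then have hr: "\<bar>h\<bar> < r0" using r0 by (simp add: \<rho>_def)
    define g where "g n = h ^ (n + 2) *\<^sub>R a (n + 2)" for n
    have "g sums (f (0 + h) - (\<Sum>n<2. h ^ n *\<^sub>R a n))"
      unfolding g_def by (rule sums_split_initial_segment[OF a[OF hr]])
    then have gs: "g sums (f h - (f 0 + h *\<^sub>R a 1))" by (simp add: numeral_2_eq_2 a0)
    have gb: "norm (g n) \<le> (m * h\<^sup>2 / \<rho>\<^sup>2) * (1/2) ^ n" for n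
    proof -
      have "norm (g n) = \<bar>h\<bar> ^ (n + 2) * norm (a (n + 2))"
        by (simp only: g_def norm_scaleR power_abs)
      also have "\<dots> = (\<bar>h\<bar> / \<rho>) ^ (n + 2) * (\<rho> ^ (n + 2) * norm (a (n + 2)))"
        using \<rho> by (simp only: power_divide) simp
      also have "\<dots> = (\<bar>h\<bar> / \<rho>) ^ (n + 2) * norm (\<rho> ^ (n + 2) *\<^sub>R a (n + 2))"
        using \<rho> by simp
      finally have e: "norm (g n) = (\<bar>h\<bar> / \<rho>) ^ (n + 2) * norm (\<rho> ^ (n + 2) *\<^sub>R a (n + 2))" .
      have "norm (g n) \<le> (\<bar>h\<bar> / \<rho>) ^ (n + 2) * m"
        unfolding e using \<rho> by (intro mult_left_mono m(2)) auto
      also have "\<dots> = (m * h\<^sup>2 / \<rho>\<^sup>2) * (\<bar>h\<bar> / \<rho>) ^ n"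
        unfolding power_add power_divide power2_abs by (simp add: mult_ac)
      also have "\<dots> \<le> (m * h\<^sup>2 / \<rho>\<^sup>2) * (1/2) ^ n"
        using h \<rho> m(1) by (intro mult_left_mono power_mono) (auto simp: pos_divide_le_eq)
      finally show ?thesis .
    qed
    have "norm (suminf g) \<le> (\<Sum>n. (m * h\<^sup>2 / \<rho>\<^sup>2) * (1/2) ^ n)"
      by (rule norm_suminf_le[OF gb]) (intro summable_mult summable_geometric, simp)
    also have "\<dots> = (m * h\<^sup>2 / \<rho>\<^sup>2) * 2" by (subst suminf_mult) (auto simp: suminf_geometric summable_geometric)
    finally show "norm (f h - (f 0 + h *\<^sub>R a 1)) \<le> 2 * m / \<rho>\<^sup>2 * h\<^sup>2"
      using sums_unique[OF gs] by (simp add: mult_ac)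
  qed
qed

lemma derivative_of_second_order:
  fixes g :: "real \<Rightarrow> real"
  assumes r: "r > 0" and g: "\<And>h. \<bar>h\<bar> < r \<Longrightarrow> \<bar>g h - (g 0 + h * a)\<bar> \<le> C * h\<^sup>2"
  shows "(g has_real_derivative a) (at 0)"
proof -
  have "((\<lambda>h. (g h - g 0) / (h - 0) - a) \<longlongrightarrow> 0) (at 0)"
  proof (rule Lim_null_comparison)
    show "\<forall>\<^sub>F h in at 0. norm ((g h - g 0) / (h - 0) - a) \<le> \<bar>C\<bar> * \<bar>h\<bar>"
      unfolding eventually_at
    proof (intro exI conjI ballI impI)
      fix h :: real assume "h \<noteq> 0 \<and> dist h 0 < r"
      then have h: "h \<noteq> 0" "\<bar>h\<bar> < r" by auto
      have "\<bar>(g h - g 0) / h - a\<bar> * \<bar>h\<bar> = \<bar>g h - (g 0 + h * a)\<bar>"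
        using h(1) by (simp add: abs_mult[symmetric] field_simps)
      also have "\<dots> \<le> C * h\<^sup>2" by (rule g[OF h(2)])
      also have "\<dots> \<le> (\<bar>C\<bar> * \<bar>h\<bar>) * \<bar>h\<bar>" by (simp add: power2_eq_square mult_right_mono abs_mult[symmetric])
      finally show "norm ((g h - g 0) / (h - 0) - a) \<le> \<bar>C\<bar> * \<bar>h\<bar>" using h(1) by simp
    qed (rule r)
    show "((\<lambda>h. \<bar>C\<bar> * \<bar>h\<bar>) \<longlongrightarrow> 0) (at 0)" by (auto intro!: tendsto_eq_intros)
  qed
  then show ?thesis unfolding has_field_derivative_iff by (simp add: LIM_zero_iff)
qed

lemma real_analytic_add_const:
  assumes "real_analytic_at f 0" shows "real_analytic_at (\<lambda>x. f x + k) 0"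
proof -
  obtain r a where r: "r > 0" and a: "\<And>h. \<bar>h\<bar> < r \<Longrightarrow> (\<lambda>n. h ^ n *\<^sub>R a n) sums f (0 + h)"
    using assms unfolding real_analytic_at_def by blast
  have "(\<lambda>n. h ^ n *\<^sub>R (a n + (if n = 0 then k else 0))) sums (f (0 + h) + k)" if "\<bar>h\<bar> < r" for h
  proof -
    have "(\<lambda>n. if n = 0 then k else 0) sums k" using sums_single[of 0 "\<lambda>_. k"] by simp
    have e: "(\<lambda>n. h ^ n *\<^sub>R (a n + (if n = 0 then k else 0))) = (\<lambda>n. h ^ n *\<^sub>R a n + (if n = 0 then k else 0))"
      by (auto simp: scaleR_add_right)
    show ?thesis unfolding e by (rule sums_add[OF a[OF that] \<open>_ sums k\<close>])
  qed
  with r show ?thesis unfolding real_analytic_at_def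
    by (intro exI[of _ r] conjI exI[of _ "\<lambda>n. a n + (if n = 0 then k else 0)"] allI impI)
qed

lemma tilt_tendsto: "(tilt c c' \<longlongrightarrow> mat 1) (at (0::real))" for c c' :: "real^'n"
proof (intro vec_tendstoI)
  fix i j :: 'n
  show "((\<lambda>e. tilt c c' e $ i $ j) \<longlongrightarrow> mat 1 $ i $ j) (at 0)"
  proof (cases "i = j \<and> c $ i \<noteq> 0")
    case True
    then have ij: "i = j" and ne: "c $ i \<noteq> 0" by auto
    have "((\<lambda>e. c $ i / (c $ i + e * c' $ i)) \<longlongrightarrow> c $ i / (c $ i + 0 * c' $ i)) (at 0)"
      using ne by (intro tendsto_intros) auto
    then show ?thesis using ne by (simp add: tilt_def mat_def flip: ij)
  next
    case False
    then have "(\<lambda>e. tilt c c' e $ i $ j) = (\<lambda>e. mat 1 $ i $ j)" by (auto simp: tilt_def mat_def)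
    then show ?thesis by simp
  qed
qed

lemma tilt_deriv: "mat_deriv (tilt c c') (\<chi> i j. if i = j \<and> c $ i \<noteq> 0 then - c' $ i / c $ i else 0) 0"
  for c c' :: "real^'n"
  unfolding mat_deriv_def
proof (intro allI)
  fix i j :: 'n
  show "((\<lambda>e. tilt c c' e $ i $ j) has_real_derivative (\<chi> i j. if i = j \<and> c $ i \<noteq> 0 then - c' $ i / c $ i else 0) $ i $ j) (at 0)"
  proof (cases "i = j \<and> c $ i \<noteq> 0")
    case True
    then have "((\<lambda>e. c $ i / (c $ i + e * c' $ i)) has_real_derivative - c' $ i / c $ i) (at 0)"
      by (auto intro!: derivative_eq_intros simp: power2_eq_square)
    then show ?thesis using True by (simp add: tilt_def)
  next
    case False
    then have "(\<lambda>e. tilt c c' e $ i $ j) = (\<lambda>e. if i = j then 1 else 0)" by (auto simp: tilt_def)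
    then show ?thesis using False by auto
  qed
qed

lemma tilt_0: "tilt c c' 0 = (mat 1 :: real^'n^'n)"
  by (simp add: tilt_def vec_eq_iff mat_def)

locale perturbed_fluid_model = fluid_model M \<phi> A \<xi> c
  for M :: "'w measure" and \<phi> :: "real \<Rightarrow> 'w \<Rightarrow> 's::finite" and A :: "real^'s^'s" and \<xi> c :: "real^'s" +
  fixes c' :: "real^'s"
  assumes still_c': "\<And>i. i \<in> still c \<Longrightarrow> c' $ i = 0" and drift: "\<mu> < 0"
begin

definition ceps :: "real \<Rightarrow> real^'s" where "ceps e = c + e *\<^sub>R c'"
definition Psi_eps :: "real \<Rightarrow> real^'s^'s" where "Psi_eps e = first_return M \<phi> (ceps e)"

lemma admissible_sets:
  assumes "admissible c c' e"
  shows "up (ceps e) = up c" "down (ceps e) = down c" "still (ceps e) = still c"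
proof -
  have 1: "c $ i > 0 \<Longrightarrow> ceps e $ i > 0" "c $ i < 0 \<Longrightarrow> ceps e $ i < 0" "c $ i = 0 \<Longrightarrow> ceps e $ i = 0" for i
    using assms still_c' by (auto simp: admissible_def ceps_def up_def down_def still_def)
  have "ceps e $ i > 0 \<longleftrightarrow> c $ i > 0" "ceps e $ i < 0 \<longleftrightarrow> c $ i < 0" "ceps e $ i = 0 \<longleftrightarrow> c $ i = 0" for i
    using 1[of i] by (metis linorder_cases order.asym less_irrefl)+
  then show "up (ceps e) = up c" "down (ceps e) = down c" "still (ceps e) = still c"
    by (auto simp: up_def down_def still_def)
qed

lemma admissible_model:
  assumes e: "admissible c c' e"
  shows "fluid_model M \<phi> A \<xi> (ceps e)"
proof (unfold_locales)
  show "generator A" by (rule gen)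
  show "stationary A \<xi>" by (rule stat)
  show "\<exists>k. \<xi> $ k \<noteq> 0 \<and> ceps e $ k \<noteq> 0"
    using active admissible_sets(3)[OF e] unfolding still_def by blast
  show "measure M {\<omega>\<in>space M. \<phi> 0 \<omega> = i} > 0" if "i \<in> up (ceps e)" for i
    using that init admissible_sets(1)[OF e] by simp
qed

lemma eventually_admissible: "\<forall>\<^sub>F e in nhds 0. admissible c c' e"
proof -
  have t: "((\<lambda>e. (c + e *\<^sub>R c') $ i) \<longlongrightarrow> c $ i) (nhds 0)" for i
  proof -
    have "((\<lambda>e. c $ i + e * c' $ i) \<longlongrightarrow> c $ i + 0 * c' $ i) (nhds 0)" by (intro tendsto_intros filterlim_ident)
    then show ?thesis by simp
  qed
  have "\<forall>\<^sub>F e in nhds 0. (i \<in> up c \<longrightarrow> (c + e *\<^sub>R c') $ i > 0) \<and> (i \<in> down c \<longrightarrow> (c + e *\<^sub>R c') $ i < 0)" for i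
  proof -
    consider "c $ i > 0" | "c $ i < 0" | "c $ i = 0" by linarith
    then show ?thesis
    proof cases
      case 1
      then show ?thesis using order_tendstoD(1)[OF t 1] by (auto simp: up_def down_def elim: eventually_mono)
    next
      case 2
      then show ?thesis using order_tendstoD(2)[OF t 2] by (auto simp: up_def down_def elim: eventually_mono)
    qed (auto simp: up_def down_def)
  qed
  then have "\<forall>\<^sub>F e in nhds 0. \<forall>i. (i \<in> up c \<longrightarrow> (c + e *\<^sub>R c') $ i > 0) \<and> (i \<in> down c \<longrightarrow> (c + e *\<^sub>R c') $ i < 0)"
    by (simp add: eventually_all_finite)
  then show ?thesis by eventually_elim (auto simp: admissible_def)
qed

lemma H_eps:
  assumes e: "admissible c c' e"
  shows "fluid_generator.H A (ceps e) = tilt c c' e ** H"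
proof -
  interpret m: fluid_model M \<phi> A \<xi> "ceps e" by (rule admissible_model[OF e])
  have "m.Q = Q" unfolding m.Q_def Q_def m.B_def B_def admissible_sets(3)[OF e] ..
  have "(tilt c c' e ** H) $ i $ j = (\<Sum>k\<in>UNIV. if k = i then tilt c c' e $ i $ i * H $ i $ j else 0)" for i j
    unfolding matrix_entry by (intro sum.cong) (auto simp: tilt_def)
  then have 1: "(tilt c c' e ** H) $ i $ j = tilt c c' e $ i $ i * H $ i $ j" for i j by simp
  have "m.H $ i $ j = - Q $ i $ j / ceps e $ i" for i j unfolding m.H_def by (simp add: \<open>m.Q = Q\<close>)
  moreover have "- Q $ i $ j / ceps e $ i = tilt c c' e $ i $ i * H $ i $ j" for i j
  proof (cases "c $ i = 0")
    case True
    then have "i \<in> still c" by (simp add: still_def)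
    then show ?thesis by (simp add: H_def Q_still_row)
  qed (simp add: H_def tilt_def ceps_def)
  ultimately have "m.H $ i $ j = tilt c c' e $ i $ i * H $ i $ j" for i j by simp
  then show ?thesis by (simp add: vec_eq_iff 1)
qed

text \<open>All perturbed models share the phase process and the sign pattern of the rates, so the results on the
  first return matrix hold for each of them; the last item is the Riccati equation in factored form.\<close>
lemma Psi_eps_facts:
  assumes e: "admissible c c' e"
  shows "minimal_nonneg_solution A (ceps e) (Psi_eps e)"
    and "block (up c) (down c) (Psi_eps e) = Psi_eps e"
    and "Psi_eps e $ i $ j \<ge> 0" and "(\<Sum>j\<in>UNIV. Psi_eps e $ i $ j) \<le> 1"
    and "(Pu - Psi_eps e) ** (tilt c c' e ** (H ** (Psi_eps e + Pd))) = 0"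
proof -
  interpret m: fluid_model M \<phi> A \<xi> "ceps e" by (rule admissible_model[OF e])
  have eq: "m.\<Psi> = Psi_eps e" by (simp add: m.\<Psi>_def Psi_eps_def)
  note s = admissible_sets[OF e]
  show "minimal_nonneg_solution A (ceps e) (Psi_eps e)"
    unfolding Psi_eps_def by (rule m.first_return_minimal)
  show "block (up c) (down c) (Psi_eps e) = Psi_eps e" using m.Psi_block unfolding eq s .
  show "Psi_eps e $ i $ j \<ge> 0" using m.Psi_nonneg unfolding eq .
  show "(\<Sum>j\<in>UNIV. Psi_eps e $ i $ j) \<le> 1" using m.Psi_rowsum_le unfolding eq .
  show "(Pu - Psi_eps e) ** (tilt c c' e ** (H ** (Psi_eps e + Pd))) = 0"
    using m.Psi_invariant unfolding eq s H_eps[OF e] by (simp add: matrix_mul_assoc)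
qed

lemma Psi_eps_0: "Psi_eps 0 = \<Psi>"
  by (simp add: Psi_eps_def \<Psi>_def ceps_def)

text \<open>By compactness it is enough to identify a limit point \<open>L\<close>. It is a non-negative solution of the
  unperturbed equation, so \<open>\<Psi> \<le> L\<close>; but the row sums of \<open>L\<close> are at most 1 and those of \<open>\<Psi>\<close> equal 1.\<close>
lemma Psi_eps_tendsto: "(Psi_eps \<longlongrightarrow> \<Psi>) (at 0)"
proof (rule ccontr)
  assume "\<not> (Psi_eps \<longlongrightarrow> \<Psi>) (at 0)"
  then obtain \<delta> where \<delta>: "\<delta> > 0" and nev: "\<not> (\<forall>\<^sub>F e in at 0. dist (Psi_eps e) \<Psi> < \<delta>)"
    by (auto simp: tendsto_iff)
  obtain r0 where r0: "r0 > 0" "\<And>e. \<bar>e\<bar> < r0 \<Longrightarrow> admissible c c' e"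
    using eventually_admissible by (auto simp: eventually_nhds_metric dist_real_def)
  have "\<exists>e. e \<noteq> 0 \<and> \<bar>e\<bar> < min r0 (inverse (real (Suc n))) \<and> dist (Psi_eps e) \<Psi> \<ge> \<delta>" for n
  proof -
    have pos: "min r0 (inverse (real (Suc n))) > 0" using r0(1) by simp
    show ?thesis
    proof (rule ccontr)
      assume no: "\<not> ?thesis"
      have "\<forall>\<^sub>F e in at 0. dist (Psi_eps e) \<Psi> < \<delta>"
        unfolding eventually_at
      proof (intro exI conjI ballI impI)
        show "min r0 (inverse (real (Suc n))) > 0" by (rule pos)
        fix e :: real assume "e \<noteq> 0 \<and> dist e 0 < min r0 (inverse (real (Suc n)))"
        then have "e \<noteq> 0" "\<bar>e\<bar> < min r0 (inverse (real (Suc n)))" by (simp_all add: dist_real_def)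
        then show "dist (Psi_eps e) \<Psi> < \<delta>" using no by (meson not_le)
      qed
      then show False using nev by simp
    qed
  qed
  then obtain e where e: "\<And>n. e n \<noteq> 0" "\<And>n. \<bar>e n\<bar> < min r0 (inverse (real (Suc n)))" "\<And>n. dist (Psi_eps (e n)) \<Psi> \<ge> \<delta>" by metis
  have adm: "admissible c c' (e n)" for n using r0(2) e(2)[of n] by simp
  have e0: "e \<longlonglongrightarrow> 0"
    by (rule Lim_null_comparison[OF _ LIMSEQ_inverse_real_of_nat]) (use e(2) in \<open>auto intro!: always_eventually less_imp_le\<close>)
  have le1: "\<bar>Psi_eps (e n) $ i $ j\<bar> \<le> 1" for n i j
  proof -
    have "Psi_eps (e n) $ i $ j \<le> (\<Sum>j\<in>UNIV. Psi_eps (e n) $ i $ j)"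
      by (intro member_le_sum) (auto simp: Psi_eps_facts(3)[OF adm])
    then show ?thesis using Psi_eps_facts(3)[OF adm, of n i j] Psi_eps_facts(4)[OF adm, of n i] by simp
  qed
  have "bounded (range (\<lambda>n. Psi_eps (e n)))"
  proof (rule boundedI)
    fix X assume "X \<in> range (\<lambda>n. Psi_eps (e n))"
    then obtain n where X: "X = Psi_eps (e n)" by blast
    have "norm X \<le> (\<Sum>i\<in>UNIV. norm (X $ i))" unfolding norm_vec_def by (rule L2_set_le_sum) simp
    also have "\<dots> \<le> (\<Sum>i\<in>(UNIV::'s set). \<Sum>j\<in>(UNIV::'s set). 1)"
    proof (rule sum_mono)
      fix i
      have "norm (X $ i) \<le> (\<Sum>j\<in>UNIV. norm (X $ i $ j))" unfolding norm_vec_def by (rule L2_set_le_sum) simp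
      also have "\<dots> \<le> (\<Sum>j\<in>(UNIV::'s set). 1)" unfolding X by (intro sum_mono) (simp add: le1)
      finally show "norm (X $ i) \<le> (\<Sum>j\<in>(UNIV::'s set). 1)" .
    qed
    finally show "norm X \<le> (\<Sum>i\<in>(UNIV::'s set). \<Sum>j\<in>(UNIV::'s set). 1)" .
  qed
  then obtain L r where r: "strict_mono r" and L: "((\<lambda>n. Psi_eps (e n)) \<circ> r) \<longlonglongrightarrow> L"
    using bounded_imp_convergent_subsequence by blast
  define x where "x n = Psi_eps (e (r n))" for n
  have xL: "x \<longlonglongrightarrow> L" using L by (simp add: x_def[abs_def] o_def)
  have xij: "(\<lambda>n. x n $ i $ j) \<longlonglongrightarrow> L $ i $ j" for i j by (intro tendsto_vec_nth xL)
  have er0: "(\<lambda>n. e (r n)) \<longlonglongrightarrow> 0" using LIMSEQ_subseq_LIMSEQ[OF e0 r] by (simp add: o_def)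
  have t1: "(\<lambda>n. tilt c c' (e (r n))) \<longlonglongrightarrow> mat 1"
    by (rule filterlim_compose[OF tilt_tendsto filterlim_atI[OF er0]]) (simp add: e(1))
  have "(\<lambda>n. (Pu - x n) ** (tilt c c' (e (r n)) ** (H ** (x n + Pd)))) \<longlonglongrightarrow> (Pu - L) ** (mat 1 ** (H ** (L + Pd)))"
    by (intro matmul.tendsto tendsto_intros xL t1)
  moreover have "(Pu - x n) ** (tilt c c' (e (r n)) ** (H ** (x n + Pd))) = 0" for n
    unfolding x_def by (rule Psi_eps_facts(5)[OF adm])
  ultimately have "(\<lambda>n::nat. 0) \<longlonglongrightarrow> (Pu - L) ** (mat 1 ** (H ** (L + Pd)))" by simp
  then have "0 = (Pu - L) ** (mat 1 ** (H ** (L + Pd)))" by (rule LIMSEQ_unique[OF tendsto_const])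
  then have R: "(Pu - L) ** H ** (L + Pd) = 0" by (simp add: matrix_mul_assoc)
  have L0: "L $ i $ j \<ge> 0" for i j
    by (rule LIMSEQ_le_const[OF xij]) (auto simp: x_def Psi_eps_facts(3)[OF adm])
  have Lb: "block (up c) (down c) L = L"
  proof -
    have "(\<lambda>n. block (up c) (down c) (x n) $ i $ j) \<longlonglongrightarrow> block (up c) (down c) L $ i $ j" for i j
      using xij[of i j] by (cases "i \<in> up c \<and> j \<in> down c") auto
    moreover have "block (up c) (down c) (x n) = x n" for n unfolding x_def by (rule Psi_eps_facts(2)[OF adm])
    ultimately have "(\<lambda>n. x n $ i $ j) \<longlonglongrightarrow> block (up c) (down c) L $ i $ j" for i j
      by (simp only:)
    then have "block (up c) (down c) L $ i $ j = L $ i $ j" for i j by (rule LIMSEQ_unique[OF _ xij])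
    then show ?thesis by (simp add: vec_eq_iff)
  qed
  have "nonneg_solution A c L"
    unfolding nonneg_solution_def riccati_eq[OF Lb] R using Lb L0 by (simp add: less_eq_vec_def)
  then have le: "\<Psi> $ i $ j \<le> L $ i $ j" for i j using Psi_minimal by (simp add: less_eq_vec_def)
  have "L $ i $ j = \<Psi> $ i $ j" for i j
  proof (cases "i \<in> up c")
    case True
    have "(\<lambda>n. \<Sum>j\<in>UNIV. x n $ i $ j) \<longlonglongrightarrow> (\<Sum>j\<in>UNIV. L $ i $ j)" by (intro tendsto_sum xij)
    then have "(\<Sum>j\<in>UNIV. L $ i $ j) \<le> 1"
      by (rule LIMSEQ_le_const2) (auto simp: x_def Psi_eps_facts(4)[OF adm])
    then have "(\<Sum>j\<in>UNIV. L $ i $ j - \<Psi> $ i $ j) \<le> 0" using Psi_rowsum[OF drift True] by (simp add: sum_subtractf)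
    moreover have "(\<Sum>j\<in>UNIV. L $ i $ j - \<Psi> $ i $ j) \<ge> 0" by (intro sum_nonneg) (simp add: le)
    ultimately have "(\<Sum>j\<in>UNIV. L $ i $ j - \<Psi> $ i $ j) = 0" by simp
    then show ?thesis by (subst (asm) sum_nonneg_eq_0_iff) (auto simp: le)
  next
    case False
    have "L $ i $ j = block (up c) (down c) L $ i $ j" by (simp add: Lb)
    moreover have "\<Psi> $ i $ j = block (up c) (down c) \<Psi> $ i $ j" by (simp add: Psi_block)
    ultimately show ?thesis using False by simp
  qed
  then have "L = \<Psi>" by (simp add: vec_eq_iff)
  with xL have "(\<lambda>n. dist (x n) \<Psi>) \<longlonglongrightarrow> 0" by (simp add: tendsto_dist_iff[symmetric])
  then have "\<delta> \<le> 0" by (rule LIMSEQ_le_const) (auto simp: x_def e(3))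
  then show False using \<delta> by simp
qed

definition G :: "real^'s^'s" where "G = \<Psi> + Pd"
definition V :: "real^'s^'s" where "V = Pu - \<Psi>"
definition K :: "real^'s^'s" where "K = K_matrix A c \<Psi>"
definition U :: "real^'s^'s" where "U = U_matrix A c \<Psi>"

lemma VHG: "V ** (H ** G) = 0"
  using Psi_invariant by (simp add: V_def G_def matrix_mul_assoc)

text \<open>The right-hand side is minus the derivative, at \<open>\<Psi>\<close> in the direction \<open>X\<close>, of the factored Riccati
  expression \<open>(Pu - X) ** H ** (X + Pd)\<close>.\<close>
lemma sylvester_operator:
  assumes X: "block (up c) (down c) X = X"
  shows "K ** X + X ** U = X ** (H ** G) - V ** (H ** X)"
proof -
  have XP: "Pu ** X = X" "X ** Pd = X" using block_block_eq[OF X] by auto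
  have "K ** X = - (V ** H ** (Pu ** X))"
    unfolding K_def K_eq[OF Psi_block] V_def[symmetric] by (simp add: matmul.minus_left matrix_mul_assoc)
  moreover have "X ** U = (X ** Pd) ** (H ** G)"
    unfolding U_def U_eq[OF Psi_block] G_def[symmetric] by (simp add: matrix_mul_assoc)
  ultimately show ?thesis unfolding XP by (simp add: matrix_mul_assoc)
qed

text \<open>The operator acts on matrices supported on the block \<open>up c \<times> down c\<close> only; completed by the identity on the other
  entries it is an injective linear map of all matrices.\<close>
lemma sylvester_left_inverse:
  obtains S :: "real^'s^'s \<Rightarrow> real^'s^'s" where "linear S"
    "\<And>X. block (up c) (down c) X = X \<Longrightarrow> S (K ** X + X ** U) = X"
proof -
  define b where "b X = block (up c) (down c) X" for X
  define T where "T X = (K ** b X + b X ** U) + (X - b X)" for X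
  have bb: "b (b X) = b X" for X by (simp add: b_def vec_eq_iff)
  have blin: "b (X + Z) = b X + b Z" "b (k *\<^sub>R X) = k *\<^sub>R b X" for X Z k by (auto simp: b_def vec_eq_iff)
  have lin: "linear T"
    by (auto simp: linear_iff T_def blin matmul.add_left matmul.add_right matmul.scaleR_left matmul.scaleR_right algebra_simps)
  have Kb: "Pu ** K = K" using block_block_eq(1)[OF K_block] by (simp add: K_def)
  have Ub: "U ** Pd = U"
  proof -
    have "(\<Psi> + Pd) ** Pd = \<Psi> + Pd" by (simp add: matmul.add_left Psi_proj proj_idem)
    then show ?thesis unfolding U_def U_eq[OF Psi_block] by (simp add: matrix_mul_assoc[symmetric])
  qed
  have bL: "b (K ** b X + b X ** U) = K ** b X + b X ** U" for X
  proof -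
    have bP: "Pu ** b X = b X" "b X ** Pd = b X" using block_block_eq[of "up c" "down c" "b X"] bb by (auto simp: b_def)
    have 1: "b W = Pu ** W ** Pd" for W unfolding b_def by (rule block_eq_proj)
    have "Pu ** (K ** b X) ** Pd = (Pu ** K) ** (b X ** Pd)" by (simp add: matrix_mul_assoc)
    moreover have "Pu ** (b X ** U) ** Pd = (Pu ** b X) ** (U ** Pd)" by (simp add: matrix_mul_assoc)
    ultimately show ?thesis unfolding 1[of "K ** b X + b X ** U"] by (simp add: matmul.add_left matmul.add_right Kb Ub bP)
  qed
  have "inj T"
  proof (rule linear_injective_0[OF lin, THEN iffD2], intro allI impI)
    fix X assume TX: "T X = 0"
    have "b (T X) = K ** b X + b X ** U"
    proof -
      have "b (X - b X) = 0" using bb[of X] by (simp add: b_def vec_eq_iff)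
      moreover have "b (T X) = b (K ** b X + b X ** U) + b (X - b X)" unfolding T_def by (rule blin(1))
      ultimately show ?thesis by (simp only: bL add_0_right)
    qed
    moreover have "b 0 = 0" by (simp add: b_def vec_eq_iff)
    ultimately have L0: "K ** b X + b X ** U = 0" using TX by simp
    have "block (up c) (down c) (b X) = b X" using bb[of X] by (simp add: b_def)
    from sylvester_injective[OF drift this] L0 have "b X = 0" by (simp add: K_def U_def)
    then show "X = 0" using TX by (simp add: T_def)
  qed
  then obtain S where S: "linear S" "S \<circ> T = id" using linear_injective_left_inverse[OF lin] by blast
  show ?thesis
  proof (rule that[OF S(1)])
    fix X assume X: "block (up c) (down c) X = X"
    then have "T X = K ** X + X ** U" by (simp add: T_def b_def)
    then show "S (K ** X + X ** U) = X" using S(2) by (metis comp_apply id_apply)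
  qed
qed

text \<open>For \<open>Z e = Psi_eps e - \<Psi>\<close> the perturbed Riccati equation states that \<open>perturbed_form\<close> equals the
  Sylvester operator at \<open>Z e\<close>, so the inverse of the operator makes \<open>Z\<close> a branch of fixed points.\<close>
lemma Psi_eps_analytic: "real_analytic_at Psi_eps 0"
proof -
  obtain S :: "real^'s^'s \<Rightarrow> real^'s^'s" where S: "linear S"
    "\<And>X. block (up c) (down c) X = X \<Longrightarrow> S (K ** X + X ** U) = X"
    by (rule sylvester_left_inverse) (rule that)
  define Z where "Z e = Psi_eps e - \<Psi>" for e
  have "real_analytic_at Z 0"
  proof (rule analytic_branch[OF S(1) VHG])
    show "(Z \<longlongrightarrow> 0) (at 0)" unfolding Z_def using Psi_eps_tendsto by (rule LIM_zero)
    show "Z 0 = 0" by (simp add: Z_def Psi_eps_0)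
    have "\<forall>\<^sub>F e in at 0. admissible c c' e" using eventually_admissible by (simp add: eventually_nhds_conv_at)
    then show "\<forall>\<^sub>F e in at 0. Z e = S (perturbed_form V H G (tilt c c' e) (Z e))"
    proof eventually_elim
      case (elim e)
      have Zb: "block (up c) (down c) (Z e) = Z e"
      proof -
        have "block (up c) (down c) (Z e) = block (up c) (down c) (Psi_eps e) - block (up c) (down c) \<Psi>"
          by (simp add: Z_def vec_eq_iff)
        then show ?thesis unfolding Psi_eps_facts(2)[OF elim] Psi_block Z_def .
      qed
      have "V - Z e = Pu - Psi_eps e" "G + Z e = Psi_eps e + Pd" by (simp_all add: V_def G_def Z_def)
      then have "perturbed_form V H G (tilt c c' e) (Z e) = Z e ** (H ** G) - V ** (H ** Z e)"
        unfolding perturbed_form_def by (simp add: Psi_eps_facts(5)[OF elim])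
      also have "\<dots> = K ** Z e + Z e ** U" by (rule sylvester_operator[OF Zb, symmetric])
      finally show ?case using S(2)[OF Zb] by simp
    qed
  qed
  from real_analytic_add_const[OF this, of \<Psi>] show ?thesis by (simp add: Z_def)
qed

text \<open>Differentiate \<open>(Pu - Psi_eps e) ** tilt c c' e ** H ** (Psi_eps e + Pd) = 0\<close> at 0. The derivative \<open>T\<close> of the tilt is
  minus the relative perturbation of the rates, and the term containing it is simplified by
  \<open>Pd ** H ** G = U\<close> and \<open>Pu ** H ** G = \<Psi> ** U\<close>.\<close>
lemma first_order_term:
  assumes a: "\<And>i j. ((\<lambda>e. Psi_eps e $ i $ j) has_real_derivative a $ i $ j) (at 0)"
  shows "sylvester_solution A c c' \<Psi> a"
proof -
  have ev: "\<forall>\<^sub>F e in nhds 0. admissible c c' e" by (rule eventually_admissible)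
  have zero_deriv: "D = 0" if D: "(g has_real_derivative D) (at 0)" and g: "\<forall>\<^sub>F e in nhds 0. g e = (0::real)" for g D
  proof -
    have "((\<lambda>_. 0) has_real_derivative D) (at 0)" using D by (subst (asm) DERIV_cong_ev[OF refl g refl])
    then show ?thesis by (rule DERIV_unique[OF _ DERIV_const])
  qed
  have ab: "block (up c) (down c) a = a"
  proof -
    have "a $ i $ j = 0" if ij: "\<not> (i \<in> up c \<and> j \<in> down c)" for i j
    proof (rule zero_deriv[OF a])
      show "\<forall>\<^sub>F e in nhds 0. Psi_eps e $ i $ j = 0"
        using ev
      proof eventually_elim
        case (elim e)
        have "Psi_eps e $ i $ j = block (up c) (down c) (Psi_eps e) $ i $ j" by (simp add: Psi_eps_facts(2)[OF elim])
        then show ?case using ij by auto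
      qed
    qed
    then show ?thesis by (auto simp: vec_eq_iff)
  qed
  define T where "T = (\<chi> i j. if i = j \<and> c $ i \<noteq> 0 then - c' $ i / c $ i else 0)"
  have T: "mat_deriv (tilt c c') T 0" unfolding T_def by (rule tilt_deriv)
  have dP: "mat_deriv Psi_eps a 0" using a by (simp add: mat_deriv_def)
  have d1: "mat_deriv (\<lambda>e. Pu - Psi_eps e) (- a) 0"
    using a by (auto simp: mat_deriv_def intro!: derivative_eq_intros)
  have d2: "mat_deriv (\<lambda>e. Psi_eps e + Pd) a 0"
    using a by (auto simp: mat_deriv_def intro!: derivative_eq_intros)
  have d: "mat_deriv (\<lambda>e. (Pu - Psi_eps e) ** (tilt c c' e ** (H ** (Psi_eps e + Pd))))
    ((- a) ** (H ** G) + V ** (T ** (H ** G) + H ** a)) 0"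
    using mat_deriv_mult[OF d1 mat_deriv_mult[OF T mat_deriv_mult[OF mat_deriv_const[of H 0] d2]]]
    by (simp add: Psi_eps_0 tilt_0 V_def G_def)
  have "((- a) ** (H ** G) + V ** (T ** (H ** G) + H ** a)) $ i $ j = 0" for i j
  proof (rule zero_deriv)
    show "((\<lambda>e. ((Pu - Psi_eps e) ** (tilt c c' e ** (H ** (Psi_eps e + Pd)))) $ i $ j) has_real_derivative
      ((- a) ** (H ** G) + V ** (T ** (H ** G) + H ** a)) $ i $ j) (at 0)"
      using d unfolding mat_deriv_def by blast
    show "\<forall>\<^sub>F e in nhds 0. ((Pu - Psi_eps e) ** (tilt c c' e ** (H ** (Psi_eps e + Pd)))) $ i $ j = 0"
      using ev
    proof eventually_elim
      case (elim e) show ?case unfolding Psi_eps_facts(5)[OF elim] by simp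
    qed
  qed
  then have "(- a) ** (H ** G) + V ** (T ** (H ** G) + H ** a) = 0" by (simp add: vec_eq_iff)
  then have eq1: "K ** a + a ** U = V ** (T ** (H ** G))"
    unfolding sylvester_operator[OF ab] by (simp add: matmul.minus_left matmul.add_right algebra_simps)
  have UG: "U = Pd ** (H ** G)" unfolding U_def U_eq[OF Psi_block] G_def by (simp add: matrix_mul_assoc)
  have PuHG: "Pu ** (H ** G) = \<Psi> ** U"
  proof -
    have "\<Psi> ** U = (\<Psi> ** Pd) ** (H ** G)" unfolding UG by (simp add: matrix_mul_assoc)
    also have "\<dots> = \<Psi> ** (H ** G)" by (simp add: Psi_proj)
    finally have "\<Psi> ** U = \<Psi> ** (H ** G)" .
    moreover have "Pu ** (H ** G) - \<Psi> ** (H ** G) = 0" using VHG by (simp add: V_def matmul.diff_left)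
    ultimately show ?thesis by simp
  qed
  have TPu: "Pu ** T = - (inv_up c ** block (up c) (up c) (diag c')) ** Pu"
  proof -
    have "(inv_up c ** block (up c) (up c) (diag c')) $ i $ j = (\<Sum>k\<in>UNIV. if k = i then (if i = j \<and> i \<in> up c then c' $ i / c $ i else 0) else 0)" for i j
      unfolding matrix_entry by (intro sum.cong) (auto simp: inv_up_entry diag_def)
    then show ?thesis by (auto simp: vec_eq_iff proj_left proj_right T_def up_def)
  qed
  have TPd: "Pd ** T = (abs_inv_down c ** block (down c) (down c) (diag c')) ** Pd"
  proof -
    have "(abs_inv_down c ** block (down c) (down c) (diag c')) $ i $ j = (\<Sum>k\<in>UNIV. if k = i then (if i = j \<and> i \<in> down c then - c' $ i / c $ i else 0) else 0)" for i j
      unfolding matrix_entry by (intro sum.cong) (auto simp: inv_down_entry diag_def)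
    then show ?thesis by (auto simp: vec_eq_iff proj_left proj_right T_def down_def)
  qed
  have "V ** (T ** (H ** G)) = (Pu ** T) ** (H ** G) - \<Psi> ** ((Pd ** T) ** (H ** G))"
  proof -
    have "\<Psi> ** (T ** (H ** G)) = (\<Psi> ** Pd) ** (T ** (H ** G))" by (simp add: Psi_proj)
    then show ?thesis by (simp add: V_def matmul.diff_left matrix_mul_assoc)
  qed
  also have "(Pu ** T) ** (H ** G) = - (inv_up c ** block (up c) (up c) (diag c') ** \<Psi> ** U)"
    unfolding TPu matrix_mul_assoc[symmetric] PuHG by (simp add: matmul.minus_left matrix_mul_assoc)
  also have "\<Psi> ** ((Pd ** T) ** (H ** G)) = \<Psi> ** abs_inv_down c ** block (down c) (down c) (diag c') ** U"
    unfolding TPd UG by (simp add: matrix_mul_assoc)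
  finally have "K ** a + a ** U = - (\<Psi> ** abs_inv_down c ** block (down c) (down c) (diag c') ** U)
       - inv_up c ** block (up c) (up c) (diag c') ** \<Psi> ** U"
    using eq1 by simp
  then show ?thesis unfolding sylvester_solution_def using ab by (simp add: K_def U_def)
qed

lemma sylvester_unique:
  assumes "sylvester_solution A c c' \<Psi> X" "sylvester_solution A c c' \<Psi> Z"
  shows "X = Z"
proof -
  have "block (up c) (down c) (X - Z) = X - Z"
  proof -
    have "block (up c) (down c) (X - Z) = block (up c) (down c) X - block (up c) (down c) Z" by (simp add: vec_eq_iff)
    then show ?thesis using assms by (simp add: sylvester_solution_def)
  qed
  moreover have "K_matrix A c \<Psi> ** (X - Z) + (X - Z) ** U_matrix A c \<Psi> =
      (K_matrix A c \<Psi> ** X + X ** U_matrix A c \<Psi>) - (K_matrix A c \<Psi> ** Z + Z ** U_matrix A c \<Psi>)"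
    by (simp add: matmul.diff_left matmul.diff_right)
  then have "K_matrix A c \<Psi> ** (X - Z) + (X - Z) ** U_matrix A c \<Psi> = 0"
    using assms by (simp add: sylvester_solution_def)
  ultimately have "X - Z = 0" by (rule sylvester_injective[OF drift])
  then show ?thesis by simp
qed

lemma first_order_expansion:
  obtains a where "sylvester_solution A c c' \<Psi> a"
    "(\<lambda>e. norm (Psi_eps e - (\<Psi> + e *\<^sub>R a))) \<in> O[at 0](\<lambda>e. e\<^sup>2)"
proof -
  obtain a r C where r: "r > 0" "C \<ge> 0" "\<And>h. \<bar>h\<bar> < r \<Longrightarrow> norm (Psi_eps h - (Psi_eps 0 + h *\<^sub>R a)) \<le> C * h\<^sup>2"
    by (rule analytic_second_order[OF Psi_eps_analytic]) (rule that)
  have "((\<lambda>e. Psi_eps e $ i $ j) has_real_derivative a $ i $ j) (at 0)" for i j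
  proof (rule derivative_of_second_order[OF r(1)])
    fix h :: real assume h: "\<bar>h\<bar> < r"
    have "\<bar>(Psi_eps h - (Psi_eps 0 + h *\<^sub>R a)) $ i $ j\<bar> \<le> norm (Psi_eps h - (Psi_eps 0 + h *\<^sub>R a))"
      by (rule order_trans[OF component_le_norm_cart Finite_Cartesian_Product.norm_nth_le])
    then show "\<bar>Psi_eps h $ i $ j - (Psi_eps 0 $ i $ j + h * a $ i $ j)\<bar> \<le> C * h\<^sup>2"
      using r(3)[OF h] by simp
  qed
  from first_order_term[OF this] show ?thesis
  proof (rule that)
    show "(\<lambda>e. norm (Psi_eps e - (\<Psi> + e *\<^sub>R a))) \<in> O[at 0](\<lambda>e. e\<^sup>2)"
    proof (rule bigoI[where c = C])
      show "\<forall>\<^sub>F e in at 0. norm (norm (Psi_eps e - (\<Psi> + e *\<^sub>R a))) \<le> C * norm (e\<^sup>2)"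
        unfolding eventually_at using r(1,3) by (intro exI[of _ r]) (auto simp: dist_real_def Psi_eps_0)
    qed
  qed
qed

end

theorem theorem3p1:
  fixes M :: "'w measure" and \<phi> :: "real \<Rightarrow> 'w \<Rightarrow> 's::finite"
    and A :: "real^'s^'s" and c c' \<xi> :: "real^'s"
    and \<Psi> :: "real^'s^'s" and \<Psi>_eps :: "real \<Rightarrow> real^'s^'s"
  assumes chain: "markov_chain M \<phi> A"
    and init: "\<And>i. i \<in> up c \<Longrightarrow> \<P>(\<omega> in M. \<phi> 0 \<omega> = i) > 0"
    and stat: "stationary A \<xi>"
    and drift: "(\<xi> v* diag c) \<bullet> 1 < 0"
    and still: "\<And>i. i \<in> still c \<Longrightarrow> c' $ i = 0"
    and Psi: "\<Psi> = first_return M \<phi> c"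
    and Psi_eps: "\<And>\<epsilon>. \<Psi>_eps \<epsilon> = first_return M \<phi> (c + \<epsilon> *\<^sub>R c')"
  shows "(\<forall>\<epsilon>. admissible c c' \<epsilon> \<longrightarrow>
            minimal_nonneg_solution A (c + \<epsilon> *\<^sub>R c') (\<Psi>_eps \<epsilon>)) \<and>
         minimal_nonneg_solution A c \<Psi> \<and>
         real_analytic_at \<Psi>_eps 0 \<and>
         (\<exists>\<Psi>1. sylvester_solution A c c' \<Psi> \<Psi>1 \<and>
            (\<forall>X. sylvester_solution A c c' \<Psi> X \<longrightarrow> X = \<Psi>1) \<and>
            (\<lambda>\<epsilon>. norm (\<Psi>_eps \<epsilon> - (\<Psi> + \<epsilon> *\<^sub>R \<Psi>1))) \<in> O[at 0](\<lambda>\<epsilon>. \<epsilon>\<^sup>2))"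
proof -
  have "(\<xi> v* diag c) $ j = (\<Sum>i\<in>UNIV. if i = j then \<xi> $ j * c $ j else 0)" for j
    unfolding vm_entry by (intro sum.cong) (auto simp: diag_def)
  then have drift': "(\<Sum>j\<in>UNIV. \<xi> $ j * c $ j) < 0" using drift by (simp add: inner_one)
  have gen: "generator A" using chain by (simp add: markov_chain_def)
  have active: "\<exists>k. \<xi> $ k \<noteq> 0 \<and> c $ k \<noteq> 0"
  proof (rule ccontr)
    assume "\<nexists>k. \<xi> $ k \<noteq> 0 \<and> c $ k \<noteq> 0"
    then have "(\<Sum>j\<in>UNIV. \<xi> $ j * c $ j) = 0" by (intro sum.neutral) auto
    then show False using drift' by simp
  qed
  interpret fluid_generator A \<xi> c by unfold_locales (fact gen stat active)+
  have mu: "fluid_generator.\<mu> \<xi> c < 0" using drift' by (simp add: \<mu>_def)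
  interpret p: perturbed_fluid_model M \<phi> A \<xi> c c'
    by unfold_locales (use chain init still mu in auto)
  have PE: "\<Psi>_eps = p.Psi_eps" using Psi_eps by (auto simp: p.Psi_eps_def p.ceps_def)
  have P: "\<Psi> = p.\<Psi>" using Psi by (simp add: p.\<Psi>_def)
  obtain a where a: "sylvester_solution A c c' p.\<Psi> a"
    "(\<lambda>e. norm (p.Psi_eps e - (p.\<Psi> + e *\<^sub>R a))) \<in> O[at 0](\<lambda>e. e\<^sup>2)"
    by (rule p.first_order_expansion) (rule that)
  show ?thesis
  proof (intro conjI allI impI exI[of _ a])
    show "minimal_nonneg_solution A (c + \<epsilon> *\<^sub>R c') (\<Psi>_eps \<epsilon>)" if "admissible c c' \<epsilon>" for \<epsilon>
      using p.Psi_eps_facts(1)[OF that] unfolding PE p.ceps_def .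
    show "minimal_nonneg_solution A c \<Psi>" unfolding Psi by (rule p.first_return_minimal)
    show "real_analytic_at \<Psi>_eps 0" unfolding PE by (rule p.Psi_eps_analytic)
    show "X = a" if "sylvester_solution A c c' \<Psi> X" for X
      by (rule p.sylvester_unique[OF that[unfolded P] a(1)])
    show "sylvester_solution A c c' \<Psi> a" unfolding P by (rule a(1))
    show "(\<lambda>\<epsilon>. norm (\<Psi>_eps \<epsilon> - (\<Psi> + \<epsilon> *\<^sub>R a))) \<in> O[at 0](\<lambda>\<epsilon>. \<epsilon>\<^sup>2)" unfolding P PE by (rule a(2))
  qed
qed

end
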